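(* The alternation depth of languages definable in $FO^2[<,\mathrm{Inv}]$ is unbounded: for every $d$ there is a finite alphabet and a language over it definable in $FO^2[<,\mathrm{Inv}]$ whose alternation depth exceeds $d$. If $|A|=2$, then every language $L\subseteq A^*$ definable in $FO^2[<,\mathrm{Inv}]$ has alternation depth at most $3$.
   Context: $FO[<]$ is first-order logic over finite words with $<$ and unary letter predicates $a(x)$; $\Sigma_k[<]$ denotes the sentences of $FO[<]$ in prenex form with $k$ alternating blocks of quantifiers beginning with an existential block (arbitrarily many variables allowed). The alternation depth of a language $L$ definable in $FO[<]$ is the smallest $k$ such that $L$ is definable by a boolean combination of $\Sigma_k[<]$ sentences. $FO^2[<,\mathrm{Inv}]$ is two-variable first-order logic with $<$, $a(x)$, and binary predicates $a(x,y)$ meaning that $a$ occurs strictly between positions $x$ and $y$. *)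

theory Defs
  imports Main
begin

datatype 'a fo =
    FTrue
  | FLt nat nat
  | FEq nat nat
  | FLetter 'a nat
  | FNeg "'a fo"
  | FAnd "'a fo" "'a fo"
  | FOr "'a fo" "'a fo"
  | FEx nat "'a fo"
  | FAll nat "'a fo"

fun fo_sat :: "'a list \<Rightarrow> (nat \<Rightarrow> nat) \<Rightarrow> 'a fo \<Rightarrow> bool" where
  "fo_sat w v FTrue = True"
| "fo_sat w v (FLt x y) = (v x < v y)"
| "fo_sat w v (FEq x y) = (v x = v y)"
| "fo_sat w v (FLetter a x) = (v x < length w \<and> w ! v x = a)"
| "fo_sat w v (FNeg \<phi>) = (\<not> fo_sat w v \<phi>)"
| "fo_sat w v (FAnd \<phi> \<psi>) = (fo_sat w v \<phi> \<and> fo_sat w v \<psi>)"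
| "fo_sat w v (FOr \<phi> \<psi>) = (fo_sat w v \<phi> \<or> fo_sat w v \<psi>)"
| "fo_sat w v (FEx x \<phi>) = (\<exists>i < length w. fo_sat w (v(x := i)) \<phi>)"
| "fo_sat w v (FAll x \<phi>) = (\<forall>i < length w. fo_sat w (v(x := i)) \<phi>)"

fun fo_fv :: "'a fo \<Rightarrow> nat set" where
  "fo_fv FTrue = {}"
| "fo_fv (FLt x y) = {x, y}"
| "fo_fv (FEq x y) = {x, y}"
| "fo_fv (FLetter a x) = {x}"
| "fo_fv (FNeg \<phi>) = fo_fv \<phi>"
| "fo_fv (FAnd \<phi> \<psi>) = fo_fv \<phi> \<union> fo_fv \<psi>"
| "fo_fv (FOr \<phi> \<psi>) = fo_fv \<phi> \<union> fo_fv \<psi>"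
| "fo_fv (FEx x \<phi>) = fo_fv \<phi> - {x}"
| "fo_fv (FAll x \<phi>) = fo_fv \<phi> - {x}"

definition fo_sentence :: "'a fo \<Rightarrow> bool" where
  "fo_sentence \<phi> \<longleftrightarrow> fo_fv \<phi> = {}"

fun fo_qf :: "'a fo \<Rightarrow> bool" where
  "fo_qf (FEx x \<phi>) = False"
| "fo_qf (FAll x \<phi>) = False"
| "fo_qf (FNeg \<phi>) = fo_qf \<phi>"
| "fo_qf (FAnd \<phi> \<psi>) = (fo_qf \<phi> \<and> fo_qf \<psi>)"
| "fo_qf (FOr \<phi> \<psi>) = (fo_qf \<phi> \<and> fo_qf \<psi>)"
| "fo_qf _ = True"

fun is_sigma :: "nat \<Rightarrow> 'a fo \<Rightarrow> bool" and is_pi :: "nat \<Rightarrow> 'a fo \<Rightarrow> bool" where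
  "is_sigma 0 \<phi> = fo_qf \<phi>"
| "is_pi 0 \<phi> = fo_qf \<phi>"
| "is_sigma (Suc k) \<phi> = (case \<phi> of FEx x \<psi> \<Rightarrow> is_sigma (Suc k) \<psi> | _ \<Rightarrow> is_pi k \<phi>)"
| "is_pi (Suc k) \<phi> = (case \<phi> of FAll x \<psi> \<Rightarrow> is_pi (Suc k) \<psi> | _ \<Rightarrow> is_sigma k \<phi>)"

inductive bool_comb_sigma :: "nat \<Rightarrow> 'a fo \<Rightarrow> bool" for k where
  base: "is_sigma k \<phi> \<Longrightarrow> fo_sentence \<phi> \<Longrightarrow> bool_comb_sigma k \<phi>"
| neg: "bool_comb_sigma k \<phi> \<Longrightarrow> bool_comb_sigma k (FNeg \<phi>)"
| conj: "bool_comb_sigma k \<phi> \<Longrightarrow> bool_comb_sigma k \<psi> \<Longrightarrow> bool_comb_sigma k (FAnd \<phi> \<psi>)"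
| disj: "bool_comb_sigma k \<phi> \<Longrightarrow> bool_comb_sigma k \<psi> \<Longrightarrow> bool_comb_sigma k (FOr \<phi> \<psi>)"

definition fo_defines :: "'a set \<Rightarrow> 'a fo \<Rightarrow> 'a list set \<Rightarrow> bool" where
  "fo_defines A \<phi> L \<longleftrightarrow> fo_sentence \<phi> \<and> (\<forall>w \<in> lists A. w \<in> L \<longleftrightarrow> fo_sat w (\<lambda>_. 0) \<phi>)"

definition alt_depth :: "'a set \<Rightarrow> 'a list set \<Rightarrow> nat" where
  "alt_depth A L = (LEAST k. \<exists>\<phi>. bool_comb_sigma k \<phi> \<and> fo_defines A \<phi> L)"

text \<open>Two variables, encoded as bool. FBtw a x y means: a occurs at some
  position strictly between x and y, i.e. at some z with x < z < y.\<close>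

datatype 'a fo2 =
    GTrue
  | GLt bool bool
  | GEq bool bool
  | GLetter 'a bool
  | GBtw 'a bool bool
  | GNeg "'a fo2"
  | GAnd "'a fo2" "'a fo2"
  | GOr "'a fo2" "'a fo2"
  | GEx bool "'a fo2"
  | GAll bool "'a fo2"

fun fo2_sat :: "'a list \<Rightarrow> (bool \<Rightarrow> nat) \<Rightarrow> 'a fo2 \<Rightarrow> bool" where
  "fo2_sat w v GTrue = True"
| "fo2_sat w v (GLt x y) = (v x < v y)"
| "fo2_sat w v (GEq x y) = (v x = v y)"
| "fo2_sat w v (GLetter a x) = (v x < length w \<and> w ! v x = a)"
| "fo2_sat w v (GBtw a x y) = (\<exists>z. v x < z \<and> z < v y \<and> z < length w \<and> w ! z = a)"
| "fo2_sat w v (GNeg \<phi>) = (\<not> fo2_sat w v \<phi>)"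
| "fo2_sat w v (GAnd \<phi> \<psi>) = (fo2_sat w v \<phi> \<and> fo2_sat w v \<psi>)"
| "fo2_sat w v (GOr \<phi> \<psi>) = (fo2_sat w v \<phi> \<or> fo2_sat w v \<psi>)"
| "fo2_sat w v (GEx x \<phi>) = (\<exists>i < length w. fo2_sat w (v(x := i)) \<phi>)"
| "fo2_sat w v (GAll x \<phi>) = (\<forall>i < length w. fo2_sat w (v(x := i)) \<phi>)"

fun fo2_fv :: "'a fo2 \<Rightarrow> bool set" where
  "fo2_fv GTrue = {}"
| "fo2_fv (GLt x y) = {x, y}"
| "fo2_fv (GEq x y) = {x, y}"
| "fo2_fv (GLetter a x) = {x}"
| "fo2_fv (GBtw a x y) = {x, y}"
| "fo2_fv (GNeg \<phi>) = fo2_fv \<phi>"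
| "fo2_fv (GAnd \<phi> \<psi>) = fo2_fv \<phi> \<union> fo2_fv \<psi>"
| "fo2_fv (GOr \<phi> \<psi>) = fo2_fv \<phi> \<union> fo2_fv \<psi>"
| "fo2_fv (GEx x \<phi>) = fo2_fv \<phi> - {x}"
| "fo2_fv (GAll x \<phi>) = fo2_fv \<phi> - {x}"

definition fo2inv_definable :: "'a set \<Rightarrow> 'a list set \<Rightarrow> bool" where
  "fo2inv_definable A L \<longleftrightarrow>
     (\<exists>\<phi>. fo2_fv \<phi> = {} \<and> (\<forall>w \<in> lists A. w \<in> L \<longleftrightarrow> fo2_sat w (\<lambda>_. 0) \<phi>))"

end

theory Submission
  imports Defs "HOL-Library.Sublist"
begin

text \<open>Unboundedness. Over the letters \<open>0, \<dots>, n\<close> consider the property of level \<open>k + 1\<close>: some letter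
  \<open>k + 1\<close> is followed by a factor over \<open>0, \<dots>, k\<close> without the property of level \<open>k\<close>. Two variables
  express it, as the betweenness predicates confine attention to a factor. If \<open>x\<close> has and \<open>y\<close> lacks
  the property of level \<open>k\<close>, and every \<open>\<Sigma>\<^sub>k\<close> sentence of a given size true in \<open>y\<close> is true in \<open>x\<close>,
  then with \<open>X = (k + 1) x\<close>, \<open>Y = (k + 1) y\<close> and large \<open>N\<close> every \<open>\<Sigma>\<^sub>k\<^sub>+\<^sub>1\<close> sentence true in \<open>X\<^sup>N\<close>
  is true in \<open>X\<^sup>N Y X\<^sup>N\<close>: there is room for \<open>Y\<close> away from the positions of the existential block.

  Two letters. Let \<open>x < y\<close>. If both letters occur between \<open>x\<close> and \<open>y\<close>, they still do when \<open>y\<close> moves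
  further away; otherwise \<open>y\<close> lies in or next to a block of equal letters at \<open>x\<close>, which the local
  types control. Hence the duplicator wins the two-pebble game if the two words agree on the
  relative order of finitely many rankers, i.e. positions reached by steps of the form ``next (or
  previous) position with local type \<open>\<tau>\<close>'': she answers \<open>y\<close> by the first or the last position of the
  same local type in the corresponding interval between rankers, or by a local move if neither
  stands in the right relation to \<open>x\<close>. Local types are definable in \<open>\<Sigma>\<^sub>2\<close> and in \<open>\<Pi>\<^sub>2\<close>, so the order of rankers is
  definable in \<open>\<Sigma>\<^sub>3\<close>.\<close>

section \<open>Prenex forms\<close>

text \<open>Splitting both words at a pebble makes the game compatible with concatenation, so powers
  can be analysed factor by factor. The induction on \<open>k\<close> yields a winning strategy in
  one direction only, whereas a boolean combination needs both. They come from one additional block: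
  a prefix of \<open>d + 1\<close> blocks contains those of \<open>d\<close> blocks with either
  first quantifier.

  For two letters the obstacle is that rankers know nothing about the other pebble \<open>x\<close>.
  Betweenness is therefore rephrased: \<open>c\<close> occurs between \<open>x\<close> and a ranker
  \<open>q\<close> iff the search for \<open>c\<close> from \<open>q\<close> towards
  \<open>x\<close> succeeds before it reaches \<open>x\<close>. So a round costs two ranker steps,
  one to a position of the right type and one from there to a letter; hence rankers of length
  \<open>2 * D\<close> for \<open>D\<close> rounds. The recursion \<open>2 * N + 3\<close> for types
  is due to long blocks, where a type of level \<open>N\<close> is under control only if
  \<open>N\<close> equal letters are seen on either side.

  The bound 3 counts two layers of "first position such that": letter tests are quantifier-free,
  walks between letters add an existential and a universal block, and walks between types add one
  more block.\<close>

lemma fo_sat_cong: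
  "(\<And>x. x \<in> fo_fv \<phi> \<Longrightarrow> v x = v' x) \<Longrightarrow> fo_sat w v \<phi> = fo_sat w v' \<phi>"
proof (induction \<phi> arbitrary: v v')
  case (FEx x \<phi>)
  have "fo_sat w (v(x := i)) \<phi> = fo_sat w (v'(x := i)) \<phi>" for i
    by (rule FEx.IH) (use FEx.prems in auto)
  then show ?case by simp
next
  case (FAll x \<phi>)
  have "fo_sat w (v(x := i)) \<phi> = fo_sat w (v'(x := i)) \<phi>" for i
    by (rule FAll.IH) (use FAll.prems in auto)
  then show ?case by simp
next
  case (FAnd \<phi> \<psi>)
  then show ?case by (metis Un_iff fo_fv.simps(6) fo_sat.simps(6))
next
  case (FOr \<phi> \<psi>)
  then show ?case by (metis Un_iff fo_fv.simps(7) fo_sat.simps(7))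
next
  case (FNeg \<phi>)
  then show ?case by (metis fo_fv.simps(5) fo_sat.simps(5))
qed auto

lemma finite_fo_fv: "finite (fo_fv \<phi>)"
  by (induction \<phi>) auto

fun fo_rename :: "(nat \<Rightarrow> nat) \<Rightarrow> 'a fo \<Rightarrow> 'a fo" where
  "fo_rename f FTrue = FTrue"
| "fo_rename f (FLt x y) = FLt (f x) (f y)"
| "fo_rename f (FEq x y) = FEq (f x) (f y)"
| "fo_rename f (FLetter a x) = FLetter a (f x)"
| "fo_rename f (FNeg \<phi>) = FNeg (fo_rename f \<phi>)"
| "fo_rename f (FAnd \<phi> \<psi>) = FAnd (fo_rename f \<phi>) (fo_rename f \<psi>)"
| "fo_rename f (FOr \<phi> \<psi>) = FOr (fo_rename f \<phi>) (fo_rename f \<psi>)"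
| "fo_rename f (FEx x \<phi>) = FEx (f x) (fo_rename f \<phi>)"
| "fo_rename f (FAll x \<phi>) = FAll (f x) (fo_rename f \<phi>)"

lemma fo_sat_rename: "inj f \<Longrightarrow> fo_sat w v (fo_rename f \<phi>) = fo_sat w (v \<circ> f) \<phi>"
proof (induction \<phi> arbitrary: v)
  case (FEx x \<phi>)
  then have "v(f x := i) \<circ> f = (v \<circ> f)(x := i)" for i by (auto simp: fun_eq_iff inj_eq)
  then show ?case by (simp only: fo_rename.simps fo_sat.simps FEx)
next
  case (FAll x \<phi>)
  then have "v(f x := i) \<circ> f = (v \<circ> f)(x := i)" for i by (auto simp: fun_eq_iff inj_eq)
  then show ?case by (simp only: fo_rename.simps fo_sat.simps FAll)
qed auto

lemma fo_fv_rename: "inj f \<Longrightarrow> fo_fv (fo_rename f \<phi>) = f ` fo_fv \<phi>"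
  by (induction \<phi>) (auto simp: image_set_diff)

lemma size_fo_rename: "size (fo_rename f \<phi>) = size \<phi>"
  by (induction \<phi>) auto

lemma fo_qf_rename: "fo_qf (fo_rename f \<phi>) = fo_qf \<phi>"
  by (induction \<phi>) auto

definition Quant :: "bool \<Rightarrow> nat \<Rightarrow> 'a fo \<Rightarrow> 'a fo" where
  "Quant b = (if b then FEx else FAll)"

text \<open>The Boolean stands for the leading quantifier, so that each closure property is proved
  once for both classes.\<close>

definition prenex :: "bool \<Rightarrow> nat \<Rightarrow> 'a fo \<Rightarrow> bool" where
  "prenex b k \<phi> = (if b then is_sigma k \<phi> else is_pi k \<phi>)"

lemma prenex_0 [simp]: "prenex b 0 \<phi> = fo_qf \<phi>"
  by (simp add: prenex_def)

lemma prenex_Quant [simp]: "prenex b (Suc k) (Quant b x \<phi>) = prenex b (Suc k) \<phi>"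
  by (simp add: prenex_def Quant_def)

lemma prenex_Suc_cases:
  assumes "prenex b (Suc k) \<phi>"
  obtains x \<psi> where "\<phi> = Quant b x \<psi>" "prenex b (Suc k) \<psi>"
  | "\<And>x \<psi>. \<phi> \<noteq> Quant b x \<psi>" "prenex (\<not> b) k \<phi>"
  using assms by (cases \<phi>; cases b) (auto simp: prenex_def Quant_def)


lemma prenex_SucI: "prenex (\<not> b) k \<phi> \<Longrightarrow> (\<And>x \<psi>. \<phi> \<noteq> Quant b x \<psi>) \<Longrightarrow> prenex b (Suc k) \<phi>"
  by (cases \<phi>; cases b) (auto simp: prenex_def Quant_def)

lemma size_Quant [simp]: "size (Quant b x \<phi>) = Suc (size \<phi>)"
  by (simp add: Quant_def)

lemma Quant_not_qf [simp]: "\<not> fo_qf (Quant b x \<phi>)"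
  by (simp add: Quant_def)

lemma Quant_neq: "Quant b x \<phi> \<noteq> Quant (\<not> b) y \<psi>"
  by (simp add: Quant_def)

lemma prenex_mono1: "prenex b k \<phi> \<Longrightarrow> prenex b (Suc k) \<phi>"
proof (induction k arbitrary: b \<phi>)
  case 0
  then show ?case by (intro prenex_SucI) auto
next
  case (Suc k)
  show ?case using Suc.prems
  proof (induction "size \<phi>" arbitrary: \<phi> rule: less_induct)
    case less
    from less.prems show ?case
    proof (cases rule: prenex_Suc_cases)
      case (1 x \<psi>)
      then show ?thesis using less.hyps[of \<psi>] by simp
    next
      case 2
      then show ?thesis by (intro prenex_SucI Suc.IH)
    qed
  qed
qed

text \<open>The delicate case is a formula that starts with \<open>Quant b\<close> although it
  belongs to the class of \<open>\<not> b\<close>. Its leading block there is empty, so it lies in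
  the class of \<open>b\<close> two levels below \<open>Suc k\<close>, and
  \<open>prenex_mono1\<close> lifts it.\<close>

lemma prenex_Suc: assumes "prenex (\<not> b) k \<phi>" shows "prenex b (Suc k) \<phi>"
proof (cases "\<exists>x \<psi>. \<phi> = Quant b x \<psi>")
  case True
  then obtain x \<psi> where q: "\<phi> = Quant b x \<psi>" by blast
  with assms obtain k' where k: "k = Suc k'" by (cases k) auto
  from assms[unfolded k] have "prenex b k' \<phi>"
    by (cases rule: prenex_Suc_cases) (auto simp: q Quant_neq)
  then show ?thesis by (simp add: k prenex_mono1)
next
  case False
  then show ?thesis using assms prenex_SucI by blast
qed

lemma prenex_rename: "prenex b k \<phi> \<Longrightarrow> prenex b k (fo_rename f \<phi>)"
proof (induction k arbitrary: b \<phi>)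
  case 0
  then show ?case by (simp add: fo_qf_rename)
next
  case (Suc k)
  show ?case using Suc.prems
  proof (induction "size \<phi>" arbitrary: \<phi> rule: less_induct)
    case less
    from less.prems show ?case
    proof (cases rule: prenex_Suc_cases)
      case (1 x \<psi>)
      have "fo_rename f \<phi> = Quant b (f x) (fo_rename f \<psi>)" using 1 by (simp add: Quant_def)
      then show ?thesis using 1 less.hyps[of \<psi>] by simp
    next
      case 2
      then show ?thesis by (intro prenex_Suc Suc.IH)
    qed
  qed
qed

definition Conn :: "bool \<Rightarrow> 'a fo \<Rightarrow> 'a fo \<Rightarrow> 'a fo" where
  "Conn c = (if c then FAnd else FOr)"

lemma fo_fv_Quant [simp]: "fo_fv (Quant b x \<phi>) = fo_fv \<phi> - {x}"
  by (simp add: Quant_def)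

lemma fo_sat_Conn_Quant:
  assumes "w \<noteq> []" "z \<notin> fo_fv \<psi>" "\<And>v. fo_sat w v \<chi> = fo_sat w v (Conn c \<phi> \<psi>)"
  shows "fo_sat w v (Quant b z \<chi>) = fo_sat w v (Conn c (Quant b z \<phi>) \<psi>)"
proof -
  have "fo_sat w (v(z := i)) \<psi> = fo_sat w v \<psi>" for i
    by (rule fo_sat_cong) (use assms in auto)
  moreover have "length w > 0" using assms by simp
  ultimately show ?thesis by (auto simp: assms(3) Quant_def Conn_def)
qed

lemma Quant_fresh:
  assumes "finite F"
  obtains z \<phi>' where "z \<notin> F" "size \<phi>' = size \<phi>" "\<And>k. prenex b k \<phi> \<Longrightarrow> prenex b k \<phi>'"
    "fo_fv \<phi>' - {z} \<subseteq> fo_fv \<phi> - {x}"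
    "\<And>w v. fo_sat w v (Quant b z \<phi>') = fo_sat w v (Quant b x \<phi>)"
proof -
  obtain z where z: "z \<notin> F \<union> fo_fv \<phi> \<union> {x}"
    using ex_new_if_finite[of "F \<union> fo_fv \<phi> \<union> {x}"] assms by (auto simp: finite_fo_fv)
  \<comment> \<open>\<open>z\<close> may be bound in \<open>\<phi>\<close>. Exchanging the two
    names, unlike substituting one for the other, is injective and cannot cause capture.\<close>
  define f where "f = (\<lambda>u. if u = x then z else if u = z then x else u)"
  have inj: "inj f" by (auto simp: inj_def f_def)
  have "fo_sat w (v(z := i)) (fo_rename f \<phi>) = fo_sat w (v(x := i)) \<phi>" for w v i
    unfolding fo_sat_rename[OF inj]
    by (rule fo_sat_cong) (use z in \<open>auto simp: f_def\<close>)
  then have "fo_sat w v (Quant b z (fo_rename f \<phi>)) = fo_sat w v (Quant b x \<phi>)" for w v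
    by (simp add: Quant_def)
  moreover have "fo_fv (fo_rename f \<phi>) - {z} \<subseteq> fo_fv \<phi> - {x}"
    unfolding fo_fv_rename[OF inj] using z by (auto simp: f_def)
  ultimately show ?thesis
    using z by (intro that[of z "fo_rename f \<phi>"]) (auto simp: size_fo_rename prenex_rename)
qed

text \<open>Quantifiers can be pulled out of conjunctions and disjunctions only over nonempty words.\<close>

lemma prenex_Conn:
  assumes "prenex b k \<phi>" "prenex b k \<psi>"
  shows "\<exists>\<chi>. prenex b k \<chi> \<and> fo_fv \<chi> \<subseteq> fo_fv \<phi> \<union> fo_fv \<psi> \<and>
    (\<forall>w v. w \<noteq> [] \<longrightarrow> fo_sat w v \<chi> = fo_sat w v (Conn c \<phi> \<psi>))"
  using assms
proof (induction k arbitrary: b \<phi> \<psi>)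
  case 0
  then show ?case by (intro exI[of _ "Conn c \<phi> \<psi>"]) (auto simp: Conn_def)
next
  case (Suc k)
  \<comment> \<open>Pulling out a quantifier renames its body, so the hypothesis must cover every
    formula of the same size and not only the body itself.\<close>
  have step: "\<exists>\<chi>. prenex b (Suc k) \<chi> \<and> fo_fv \<chi> \<subseteq> fo_fv (Quant b x \<phi>) \<union> fo_fv \<psi> \<and>
      (\<forall>w v. w \<noteq> [] \<longrightarrow> fo_sat w v \<chi> = fo_sat w v (Conn c (Quant b x \<phi>) \<psi>))"
    if pre: "prenex b (Suc k) \<phi>"
      and IH: "\<And>\<phi>'. size \<phi>' = size \<phi> \<Longrightarrow> prenex b (Suc k) \<phi>' \<Longrightarrow>
        \<exists>\<chi>. prenex b (Suc k) \<chi> \<and> fo_fv \<chi> \<subseteq> fo_fv \<phi>' \<union> fo_fv \<psi> \<and>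
          (\<forall>w v. w \<noteq> [] \<longrightarrow> fo_sat w v \<chi> = fo_sat w v (Conn c \<phi>' \<psi>))"
    for x and \<phi> \<psi> :: "'a fo"
  proof -
    obtain z \<phi>' where z: "z \<notin> fo_fv \<psi>" "size \<phi>' = size \<phi>" "prenex b (Suc k) \<phi>'"
        "fo_fv \<phi>' - {z} \<subseteq> fo_fv \<phi> - {x}"
        and eq: "\<And>w v. fo_sat w v (Quant b z \<phi>') = fo_sat w v (Quant b x \<phi>)"
      by (rule Quant_fresh[OF finite_fo_fv[of \<psi>], of \<phi> b x]) (use pre in blast)
    obtain \<chi> where \<chi>: "prenex b (Suc k) \<chi>" "fo_fv \<chi> \<subseteq> fo_fv \<phi>' \<union> fo_fv \<psi>"
        "\<And>w v. w \<noteq> [] \<Longrightarrow> fo_sat w v \<chi> = fo_sat w v (Conn c \<phi>' \<psi>)"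
      using IH[OF z(2,3)] by blast
    have "fo_sat w v (Quant b z \<chi>) = fo_sat w v (Conn c (Quant b x \<phi>) \<psi>)" if "w \<noteq> []" for w v
      using fo_sat_Conn_Quant[OF that z(1) \<chi>(3)[OF that]] eq by (simp add: Conn_def)
    then show ?thesis using \<chi> z by (intro exI[of _ "Quant b z \<chi>"]) auto
  qed
  show ?case using Suc.prems
  proof (induction "size \<phi> + size \<psi>" arbitrary: \<phi> \<psi> rule: less_induct)
    case less
    from less.prems(1) show ?case
    proof (cases rule: prenex_Suc_cases)
      case (1 x \<phi>')
      show ?thesis unfolding 1(1)
        by (rule step[OF 1(2)]) (use less 1 in auto)
    next
      case 2
      note \<phi> = this
      from less.prems(2) show ?thesis
      proof (cases rule: prenex_Suc_cases)
        case (1 x \<psi>')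
        have "\<exists>\<chi>. prenex b (Suc k) \<chi> \<and> fo_fv \<chi> \<subseteq> fo_fv (Quant b x \<psi>') \<union> fo_fv \<phi> \<and>
          (\<forall>w v. w \<noteq> [] \<longrightarrow> fo_sat w v \<chi> = fo_sat w v (Conn c (Quant b x \<psi>') \<phi>))"
        proof (rule step[OF 1(2)])
          fix \<psi>'' :: "'a fo" assume "size \<psi>'' = size \<psi>'" "prenex b (Suc k) \<psi>''"
          then obtain \<chi> where "prenex b (Suc k) \<chi>" "fo_fv \<chi> \<subseteq> fo_fv \<phi> \<union> fo_fv \<psi>''"
            "\<forall>w v. w \<noteq> [] \<longrightarrow> fo_sat w v \<chi> = fo_sat w v (Conn c \<phi> \<psi>'')"
            using less.hyps[of \<phi> \<psi>''] less.prems 1 by auto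
          then show "\<exists>\<chi>. prenex b (Suc k) \<chi> \<and> fo_fv \<chi> \<subseteq> fo_fv \<psi>'' \<union> fo_fv \<phi> \<and>
            (\<forall>w v. w \<noteq> [] \<longrightarrow> fo_sat w v \<chi> = fo_sat w v (Conn c \<psi>'' \<phi>))"
            by (intro exI[of _ \<chi>]) (auto simp: Conn_def)
        qed
        then show ?thesis unfolding 1(1) by (auto simp: Conn_def Un_commute)
      next
        case 2
        then show ?thesis using Suc.IH[OF \<phi>(2) 2(2)] prenex_Suc by blast
      qed
    qed
  qed
qed

fun fo_dual :: "'a fo \<Rightarrow> 'a fo" where
  "fo_dual (FEx x \<phi>) = FAll x (fo_dual \<phi>)"
| "fo_dual (FAll x \<phi>) = FEx x (fo_dual \<phi>)"
| "fo_dual \<phi> = FNeg \<phi>"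

lemma fo_dual_sat: "fo_sat w v (fo_dual \<phi>) = (\<not> fo_sat w v \<phi>)"
  by (induction \<phi> arbitrary: v rule: fo_dual.induct) auto

lemma fo_dual_fv: "fo_fv (fo_dual \<phi>) = fo_fv \<phi>"
  by (induction \<phi> rule: fo_dual.induct) auto

lemma fo_dual_qf: "fo_qf \<phi> \<Longrightarrow> fo_dual \<phi> = FNeg \<phi>"
  by (cases \<phi>) auto

lemma prenex_dual: "prenex b k \<phi> \<Longrightarrow> prenex (\<not> b) k (fo_dual \<phi>)"
proof (induction k arbitrary: b \<phi>)
  case 0
  then show ?case by (simp add: fo_dual_qf)
next
  case (Suc k)
  show ?case using Suc.prems
  proof (induction "size \<phi>" arbitrary: \<phi> rule: less_induct)
    case less
    from less.prems show ?case
    proof (cases rule: prenex_Suc_cases)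
      case (1 x \<psi>)
      have "fo_dual \<phi> = Quant (\<not> b) x (fo_dual \<psi>)" using 1 by (simp add: Quant_def)
      then show ?thesis using 1 less.hyps[of \<psi>] by simp
    next
      case 2
      then show ?thesis using Suc.IH[of "\<not> b" \<phi>] by (intro prenex_Suc)
    qed
  qed
qed

text \<open>The classes \<open>\<Sigma>\<^sub>k\<close> (\<open>b = True\<close>) and \<open>\<Pi>\<^sub>k\<close> (\<open>b = False\<close>) without the prenex requirement.\<close>

inductive level :: "bool \<Rightarrow> nat \<Rightarrow> 'a fo \<Rightarrow> bool" where
  qf: "fo_qf \<phi> \<Longrightarrow> level b k \<phi>"
| neg: "level (\<not> b) k \<phi> \<Longrightarrow> level b k (FNeg \<phi>)"
| conj: "level b k \<phi> \<Longrightarrow> level b k \<psi> \<Longrightarrow> level b k (FAnd \<phi> \<psi>)"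
| disj: "level b k \<phi> \<Longrightarrow> level b k \<psi> \<Longrightarrow> level b k (FOr \<phi> \<psi>)"
| ex: "level True (Suc k) \<phi> \<Longrightarrow> level True (Suc k) (FEx x \<phi>)"
| all: "level False (Suc k) \<phi> \<Longrightarrow> level False (Suc k) (FAll x \<phi>)"
| up: "level b k \<phi> \<Longrightarrow> level b' (Suc k) \<phi>"

lemma prenex_qf: "fo_qf \<phi> \<Longrightarrow> prenex b k \<phi>"
  by (induction k) (auto intro: prenex_mono1)

lemma level_prenex:
  "level b k \<phi> \<Longrightarrow> \<exists>\<psi>. prenex b k \<psi> \<and> fo_fv \<psi> \<subseteq> fo_fv \<phi> \<and>
    (\<forall>w v. w \<noteq> [] \<longrightarrow> fo_sat w v \<psi> = fo_sat w v \<phi>)"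
proof (induction rule: level.induct)
  case (qf \<phi> b k)
  then show ?case using prenex_qf by blast
next
  case (neg b k \<phi>)
  then obtain \<psi> where "prenex (\<not> b) k \<psi>" "fo_fv \<psi> \<subseteq> fo_fv \<phi>"
    "\<forall>w v. w \<noteq> [] \<longrightarrow> fo_sat w v \<psi> = fo_sat w v \<phi>" by blast
  then show ?case using prenex_dual[of "\<not> b" k \<psi>]
    by (intro exI[of _ "fo_dual \<psi>"]) (auto simp: fo_dual_sat fo_dual_fv)
next
  case (conj b k \<phi> \<psi>)
  then obtain \<phi>' \<psi>' where "prenex b k \<phi>'" "prenex b k \<psi>'" "fo_fv \<phi>' \<subseteq> fo_fv \<phi>" "fo_fv \<psi>' \<subseteq> fo_fv \<psi>"
    "\<forall>w v. w \<noteq> [] \<longrightarrow> fo_sat w v \<phi>' = fo_sat w v \<phi>" "\<forall>w v. w \<noteq> [] \<longrightarrow> fo_sat w v \<psi>' = fo_sat w v \<psi>"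
    by blast
  then show ?case using prenex_Conn[of b k \<phi>' \<psi>' True]
    by (simp add: Conn_def) (meson Un_mono order_trans)
next
  case (disj b k \<phi> \<psi>)
  then obtain \<phi>' \<psi>' where "prenex b k \<phi>'" "prenex b k \<psi>'" "fo_fv \<phi>' \<subseteq> fo_fv \<phi>" "fo_fv \<psi>' \<subseteq> fo_fv \<psi>"
    "\<forall>w v. w \<noteq> [] \<longrightarrow> fo_sat w v \<phi>' = fo_sat w v \<phi>" "\<forall>w v. w \<noteq> [] \<longrightarrow> fo_sat w v \<psi>' = fo_sat w v \<psi>"
    by blast
  then show ?case using prenex_Conn[of b k \<phi>' \<psi>' False]
    by (simp add: Conn_def) (meson Un_mono order_trans)
next
  case (ex k \<phi> x)
  then obtain \<psi> where "prenex True (Suc k) \<psi>" "fo_fv \<psi> \<subseteq> fo_fv \<phi>"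
    "\<forall>w v. w \<noteq> [] \<longrightarrow> fo_sat w v \<psi> = fo_sat w v \<phi>" by blast
  then show ?case using prenex_Quant[of True k x \<psi>]
    by (intro exI[of _ "FEx x \<psi>"]) (auto simp: Quant_def)
next
  case (all k \<phi> x)
  then obtain \<psi> where "prenex False (Suc k) \<psi>" "fo_fv \<psi> \<subseteq> fo_fv \<phi>"
    "\<forall>w v. w \<noteq> [] \<longrightarrow> fo_sat w v \<psi> = fo_sat w v \<phi>" by blast
  then show ?case using prenex_Quant[of False k x \<psi>]
    by (intro exI[of _ "FAll x \<psi>"]) (auto simp: Quant_def)
next
  case (up b k \<phi> b')
  have "prenex b' (Suc k) \<psi>" if "prenex b k \<psi>" for \<psi> :: "'a fo"
    using that prenex_mono1[of b k \<psi>] prenex_Suc[of b' k \<psi>] by (cases "b' = b") auto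
  with up.IH show ?case by blast
qed

lemma bool_comb_sentence: "bool_comb_sigma k \<phi> \<Longrightarrow> fo_sentence \<phi>"
  by (induction rule: bool_comb_sigma.induct) (auto simp: fo_sentence_def)

lemma level_exists: "\<exists>k. level True k \<phi> \<and> level False k \<phi>"
proof (induction \<phi>)
  case (FAnd \<phi> \<psi>)
  have "level b k \<phi> \<Longrightarrow> level b (k + n) \<phi>" for b k n and \<phi> :: "'a fo"
    by (induction n) (auto intro: level.up)
  with FAnd show ?case by (metis add.commute level.conj)
next
  case (FOr \<phi> \<psi>)
  have "level b k \<phi> \<Longrightarrow> level b (k + n) \<phi>" for b k n and \<phi> :: "'a fo"
    by (induction n) (auto intro: level.up)
  with FOr show ?case by (metis add.commute level.disj)
next
  case (FNeg \<phi>)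
  then show ?case by (metis level.neg)
next
  case (FEx x \<phi>)
  then show ?case by (metis level.ex level.up)
next
  case (FAll x \<phi>)
  then show ?case by (metis level.all level.up)
qed (auto intro!: exI[of _ 0] level.qf)

text \<open>The disjunction with the test for nonemptiness repairs the value on the empty word,
  where the passage to prenex form may fail.\<close>

lemma level_bool_comb:
  assumes "level True (Suc k) \<phi>" "fo_sentence \<phi>"
  shows "\<exists>\<psi>. bool_comb_sigma (Suc k) \<psi> \<and> (\<forall>w v. fo_sat w v \<psi> = fo_sat w v \<phi>)"
proof -
  obtain \<psi> where \<psi>: "prenex True (Suc k) \<psi>" "fo_fv \<psi> \<subseteq> fo_fv \<phi>"
    "\<And>w v. w \<noteq> [] \<Longrightarrow> fo_sat w v \<psi> = fo_sat w v \<phi>"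
    using level_prenex[OF assms(1)] by blast
  define e :: "'a fo" where "e = FEx 0 FTrue"
  define c :: "'a fo" where "c = (if fo_sat [] (\<lambda>_. 0) \<phi> then FTrue else FNeg FTrue)"
  have base: "bool_comb_sigma (Suc k) \<psi>" 
    using \<psi> assms(2) by (intro bool_comb_sigma.base) (auto simp: prenex_def fo_sentence_def)
  have "prenex True (Suc k) (Quant True 0 (FTrue :: 'a fo))"
    unfolding prenex_Quant by (rule prenex_qf) simp
  then have e: "bool_comb_sigma (Suc k) e"
    by (intro bool_comb_sigma.base) (simp_all add: e_def fo_sentence_def prenex_def Quant_def)
  have "prenex True (Suc k) c" by (rule prenex_qf) (simp add: c_def)
  then have c: "bool_comb_sigma (Suc k) c"
    by (intro bool_comb_sigma.base) (simp_all add: c_def fo_sentence_def prenex_def)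
  have "fo_sat w v (FOr (FAnd e \<psi>) (FAnd (FNeg e) c)) = fo_sat w v \<phi>" for w v
  proof (cases "w = []")
    case True
    have "fo_sat [] v \<phi> = fo_sat [] (\<lambda>_. 0) \<phi>"
      by (rule fo_sat_cong) (use assms(2) in \<open>simp add: fo_sentence_def\<close>)
    with True show ?thesis by (simp add: e_def c_def)
  next
    case False
    then have "\<exists>i. i < length w" by auto
    with \<psi>(3)[OF False] show ?thesis by (simp add: e_def)
  qed
  moreover have "bool_comb_sigma (Suc k) (FOr (FAnd e \<psi>) (FAnd (FNeg e) c))"
    by (intro bool_comb_sigma.intros(2-) base e c)
  ultimately show ?thesis by blast
qed

section \<open>A word-splitting game for quantifier prefixes\<close>

text \<open>The Ehrenfeucht--Fraisse game for sentences with quantifier prefix \<open>qs\<close> (\<open>True\<close> for \<open>\<exists>\<close>) that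
  are to be transferred from \<open>u\<close> to \<open>v\<close>. A pebble splits both words, and since \<open><\<close> is the only
  relation, the game goes on independently on the two sides. The predicate \<open>p\<close> selects the
  letters that matter for quantifier-free formulas.\<close>

fun wins :: "('c \<Rightarrow> bool) \<Rightarrow> bool list \<Rightarrow> 'c list \<Rightarrow> 'c list \<Rightarrow> bool" where
  "wins p [] u v = (filter p u = filter p v)"
| "wins p (b # qs) u v = (wins p qs u v \<and>
     (if b then \<forall>l c r. u = l @ c # r \<longrightarrow> (\<exists>l' r'. v = l' @ c # r' \<and> wins p qs l l' \<and> wins p qs r r')
      else \<forall>l c r. v = l @ c # r \<longrightarrow> (\<exists>l' r'. u = l' @ c # r' \<and> wins p qs l' l \<and> wins p qs r' r)))"

lemma winsD: "wins p (b # qs) u v \<Longrightarrow> wins p qs u v"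
  by simp

lemma wins_TrueD:
  assumes "wins p (True # qs) u v" "u = l @ c # r"
  obtains l' r' where "v = l' @ c # r'" "wins p qs l l'" "wins p qs r r'"
proof -
  have "\<forall>l c r. u = l @ c # r \<longrightarrow> (\<exists>l' r'. v = l' @ c # r' \<and> wins p qs l l' \<and> wins p qs r r')"
    using assms(1) by simp
  with assms(2) that show thesis by blast
qed

lemma wins_FalseD:
  assumes "wins p (False # qs) u v" "v = l @ c # r"
  obtains l' r' where "u = l' @ c # r'" "wins p qs l' l" "wins p qs r' r"
proof -
  have "\<forall>l c r. v = l @ c # r \<longrightarrow> (\<exists>l' r'. u = l' @ c # r' \<and> wins p qs l' l \<and> wins p qs r' r)"
    using assms(1) by simp
  with assms(2) that show thesis by blast
qed

lemma wins_TrueI: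
  assumes "wins p qs u v" "\<And>l c r. u = l @ c # r \<Longrightarrow> \<exists>l' r'. v = l' @ c # r' \<and> wins p qs l l' \<and> wins p qs r r'"
  shows "wins p (True # qs) u v"
  using assms by simp

lemma wins_FalseI:
  assumes "wins p qs u v" "\<And>l c r. v = l @ c # r \<Longrightarrow> \<exists>l' r'. u = l' @ c # r' \<and> wins p qs l' l \<and> wins p qs r' r"
  shows "wins p (False # qs) u v"
  using assms by simp

lemma wins_flip: "wins p (map Not qs) u v = wins p qs v u"
  by (induction qs arbitrary: u v) auto

text \<open>By \<open>wins_flip\<close>, a statement closed under exchanging the two words needs to be proved only
  for existential moves.\<close>

lemma wins_induct [case_names Nil Ex All]:
  assumes "P []" "\<And>qs. P qs \<Longrightarrow> P (True # qs)" "\<And>qs. P (map Not qs) \<Longrightarrow> P qs"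
  shows "P qs"
proof (induction "length qs" arbitrary: qs rule: less_induct)
  case less
  show ?case
  proof (cases qs)
    case Nil
    then show ?thesis using assms by simp
  next
    case (Cons b ps)
    show ?thesis
    proof (cases b)
      case True
      then show ?thesis using Cons less assms by simp
    next
      case False
      have "P (map Not ps)" using Cons less by simp
      then have "P (map Not qs)" using assms(2) Cons False by simp
      then show ?thesis by (rule assms(3))
    qed
  qed
qed

lemma wins_refl: "wins p qs u u"
proof (induction qs arbitrary: u rule: wins_induct)
  case (Ex qs)
  then show ?case by (intro wins_TrueI) blast+
qed (simp_all add: wins_flip)

lemma wins_trans: "wins p qs u v \<Longrightarrow> wins p qs v w \<Longrightarrow> wins p qs u w"
proof (induction qs arbitrary: u v w rule: wins_induct)
  case (Ex qs)
  show ?case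
  proof (rule wins_TrueI)
    show "wins p qs u w" using Ex winsD by blast
    fix l c r assume "u = l @ c # r"
    with Ex.prems(1) obtain l1 r1 where 1: "v = l1 @ c # r1" "wins p qs l l1" "wins p qs r r1"
      by (rule wins_TrueD)
    from Ex.prems(2) 1(1) obtain l2 r2 where "w = l2 @ c # r2" "wins p qs l1 l2" "wins p qs r1 r2"
      by (rule wins_TrueD)
    with 1 Ex.IH show "\<exists>l' r'. w = l' @ c # r' \<and> wins p qs l l' \<and> wins p qs r r'" by blast
  qed
next
  case (All qs)
  then show ?case unfolding wins_flip by blast
qed simp

lemma append_eq_split:
  assumes "u @ u' = l @ c # r"
  obtains r1 where "u = l @ c # r1" "r = r1 @ u'" | l2 where "u' = l2 @ c # r" "l = u @ l2"
  using assms by (auto simp: append_eq_append_conv2 append_eq_Cons_conv Cons_eq_append_conv)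

lemma wins_append:
  "wins p qs u v \<Longrightarrow> wins p qs u' v' \<Longrightarrow> wins p qs (u @ u') (v @ v')"
proof (induction qs arbitrary: u v u' v' rule: wins_induct)
  case (Ex qs)
  show ?case
  proof (rule wins_TrueI)
    have w: "wins p qs u v" "wins p qs u' v'" using Ex.prems winsD by blast+
    then show "wins p qs (u @ u') (v @ v')" by (rule Ex.IH)
    fix l c r assume "u @ u' = l @ c # r"
    then show "\<exists>l' r'. v @ v' = l' @ c # r' \<and> wins p qs l l' \<and> wins p qs r r'"
    proof (cases rule: append_eq_split)
      case (1 r1)
      from Ex.prems(1) 1(1) obtain l' r' where "v = l' @ c # r'" "wins p qs l l'" "wins p qs r1 r'"
        by (rule wins_TrueD)
      then show ?thesis using 1 Ex.IH w by (intro exI[of _ l'] exI[of _ "r' @ v'"]) auto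
    next
      case (2 l2)
      from Ex.prems(2) 2(1) obtain l' r' where "v' = l' @ c # r'" "wins p qs l2 l'" "wins p qs r r'"
        by (rule wins_TrueD)
      then show ?thesis using 2 Ex.IH w by (intro exI[of _ "v @ l'"] exI[of _ r']) auto
    qed
  qed
qed (simp_all add: wins_flip)

lemma wins_Nil: "wins p qs u v \<Longrightarrow> filter p u = filter p v"
  by (induction qs arbitrary: u v) auto

lemma wins_mono:
  assumes "\<And>u v. wins p ps u v \<Longrightarrow> wins p qs u v" "wins p (b # ps) u v"
  shows "wins p (b # qs) u v"
proof (cases b)
  case True
  then have b: "b = True" by simp
  note w = assms(2)[unfolded b]
  have "\<exists>l' r'. v = l' @ c # r' \<and> wins p qs l l' \<and> wins p qs r r'" if "u = l @ c # r" for l c r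
    using w that by (rule wins_TrueD) (use assms(1) in blast)
  then show ?thesis unfolding b by (rule wins_TrueI[OF assms(1)[OF winsD[OF w]]])
next
  case False
  then have b: "b = False" by simp
  note w = assms(2)[unfolded b]
  have "\<exists>l' r'. u = l' @ c # r' \<and> wins p qs l' l \<and> wins p qs r' r" if "v = l @ c # r" for l c r
    using w that by (rule wins_FalseD) (use assms(1) in blast)
  then show ?thesis unfolding b by (rule wins_FalseI[OF assms(1)[OF winsD[OF w]]])
qed

lemma wins_subseq: "subseq ps qs \<Longrightarrow> wins p qs u v \<Longrightarrow> wins p ps u v"
proof (induction arbitrary: u v rule: list_emb.induct)
  case (list_emb_Nil ys)
  then show ?case by (simp add: wins_Nil)
next
  case (list_emb_Cons xs ys y)
  then show ?case by simp
next
  case (list_emb_Cons2 x y xs ys)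
  then have eq: "y = x" by simp
  show ?case by (rule wins_mono[OF list_emb_Cons2.IH list_emb_Cons2.prems[unfolded eq]])
qed

text \<open>As \<open>h\<close> creates no letter satisfying \<open>p\<close>, the filtered image is
  determined by the filtered word. The application is to erasing marks.\<close>

lemma wins_map:
  assumes "\<And>c. p (h c) \<Longrightarrow> p c"
  shows "wins p qs u v \<Longrightarrow> wins p qs (map h u) (map h v)"
proof (induction qs arbitrary: u v rule: wins_induct)
  case Nil
  have *: "filter p (map h u) = filter p (map h (filter p u))" for u
    using assms by (induction u) auto
  have "filter p u = filter p v" using Nil by simp
  then have "filter p (map h u) = filter p (map h v)" using *[of u] *[of v] by metis
  then show ?case by simp
next
  case (Ex qs)
  show ?case
  proof (rule wins_TrueI)
    show "wins p qs (map h u) (map h v)" using Ex winsD by blast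
    fix l c r assume "map h u = l @ c # r"
    then obtain l0 c0 r0 where 1: "u = l0 @ c0 # r0" "l = map h l0" "c = h c0" "r = map h r0"
      by (auto simp: map_eq_append_conv map_eq_Cons_conv)
    from Ex.prems 1(1) obtain l' r' where "v = l' @ c0 # r'" "wins p qs l0 l'" "wins p qs r0 r'"
      by (rule wins_TrueD)
    with 1 Ex.IH show "\<exists>l' r'. map h v = l' @ c # r' \<and> wins p qs l l' \<and> wins p qs r r'"
      by (intro exI[of _ "map h l'"] exI[of _ "map h r'"]) auto
  qed
qed (simp_all add: wins_flip)

section \<open>Soundness of the game for prenex sentences\<close>

text \<open>In words over \<open>'a \<times> nat set\<close> the second component of a letter collects the variables
  that are assigned to its position.\<close>

abbreviation marked :: "'a \<times> nat set \<Rightarrow> bool" where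
  "marked c \<equiv> snd c \<noteq> {}"

definition marks :: "nat set \<Rightarrow> ('a \<times> nat set) list \<Rightarrow> (nat \<Rightarrow> nat) \<Rightarrow> bool" where
  "marks X u \<mu> \<longleftrightarrow> (\<forall>x\<in>X. \<mu> x < length u \<and> (\<forall>i < length u. x \<in> snd (u ! i) \<longleftrightarrow> i = \<mu> x))"

text \<open>Together with the set of letters, this relation on the filtered word determines all
  atoms about marked positions.\<close>

fun prs :: "'c list \<Rightarrow> ('c \<times> 'c) set" where
  "prs [] = {}"
| "prs (a # u) = {a} \<times> set u \<union> prs u"

lemma prs_filter: "prs (filter p u) = {(a, b) \<in> prs u. p a \<and> p b}"
  by (induction u) auto

lemma prs_conv: "(a, b) \<in> prs u \<longleftrightarrow> (\<exists>i j. i < j \<and> j < length u \<and> u ! i = a \<and> u ! j = b)"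
proof (induction u)
  case (Cons c u)
  show ?case
  proof
    assume "(a, b) \<in> prs (c # u)"
    then consider "a = c" "b \<in> set u" | "(a, b) \<in> prs u" by auto
    then show "\<exists>i j. i < j \<and> j < length (c # u) \<and> (c # u) ! i = a \<and> (c # u) ! j = b"
    proof cases
      case 1
      then obtain j where "j < length u" "u ! j = b" by (auto simp: in_set_conv_nth)
      with 1 show ?thesis by (intro exI[of _ 0] exI[of _ "Suc j"]) auto
    next
      case 2
      then obtain i j where "i < j" "j < length u" "u ! i = a" "u ! j = b" using Cons by blast
      then show ?thesis by (intro exI[of _ "Suc i"] exI[of _ "Suc j"]) auto
    qed
  next
    assume "\<exists>i j. i < j \<and> j < length (c # u) \<and> (c # u) ! i = a \<and> (c # u) ! j = b"
    then obtain i j where ij: "i < j" "j < length (c # u)" "(c # u) ! i = a" "(c # u) ! j = b" by blast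
    then obtain j' where j': "j = Suc j'" by (cases j) auto
    show "(a, b) \<in> prs (c # u)"
    proof (cases i)
      case 0
      then show ?thesis using ij j' by auto
    next
      case (Suc i')
      then have "(a, b) \<in> prs u" using ij j' Cons by auto
      then show ?thesis by simp
    qed
  qed
qed simp

lemma marks_less:
  assumes "marks X u \<mu>" "x \<in> X" "y \<in> X"
  shows "\<mu> x < \<mu> y \<longleftrightarrow> (\<exists>a b. (a, b) \<in> prs (filter marked u) \<and> x \<in> snd a \<and> y \<in> snd b)"
proof
  assume "\<mu> x < \<mu> y"
  moreover have "x \<in> snd (u ! \<mu> x)" "y \<in> snd (u ! \<mu> y)" "\<mu> y < length u"
    using assms by (auto simp: marks_def)
  ultimately show "\<exists>a b. (a, b) \<in> prs (filter marked u) \<and> x \<in> snd a \<and> y \<in> snd b"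
    unfolding prs_filter by (intro exI[of _ "u ! \<mu> x"] exI[of _ "u ! \<mu> y"]) (auto simp: prs_conv)
next
  assume "\<exists>a b. (a, b) \<in> prs (filter marked u) \<and> x \<in> snd a \<and> y \<in> snd b"
  then obtain i j where "i < j" "j < length u" "x \<in> snd (u ! i)" "y \<in> snd (u ! j)"
    unfolding prs_filter prs_conv by blast
  moreover from this have "i = \<mu> x" "j = \<mu> y" using assms unfolding marks_def by auto
  ultimately show "\<mu> x < \<mu> y" by simp
qed

lemma marks_letter:
  assumes "marks X u \<mu>" "x \<in> X"
  shows "fst (u ! \<mu> x) = a \<longleftrightarrow> (\<exists>c\<in>set (filter marked u). x \<in> snd c \<and> fst c = a)"
proof
  assume "fst (u ! \<mu> x) = a"
  moreover have "x \<in> snd (u ! \<mu> x)" "u ! \<mu> x \<in> set u" using assms by (auto simp: marks_def)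
  ultimately show "\<exists>c\<in>set (filter marked u). x \<in> snd c \<and> fst c = a"
    by (intro bexI[of _ "u ! \<mu> x"]) auto
next
  assume "\<exists>c\<in>set (filter marked u). x \<in> snd c \<and> fst c = a"
  then obtain c where c: "c \<in> set u" "x \<in> snd c" "fst c = a" unfolding set_filter by blast
  then obtain i where "i < length u" "u ! i = c" by (auto simp: in_set_conv_nth)
  with assms c show "fst (u ! \<mu> x) = a" by (auto simp: marks_def)
qed

lemma qf_sat_marks:
  assumes "marks X u \<mu>" "marks X v \<nu>" "filter marked u = filter marked v"
  shows "fo_qf \<phi> \<Longrightarrow> fo_fv \<phi> \<subseteq> X \<Longrightarrow> fo_sat (map fst u) \<mu> \<phi> = fo_sat (map fst v) \<nu> \<phi>"
proof (induction \<phi>)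
  case (FLt x y)
  then show ?case using marks_less[OF assms(1), of x y] marks_less[OF assms(2), of x y] assms(3) by simp
next
  case (FEq x y)
  then have "\<mu> x < \<mu> y \<longleftrightarrow> \<nu> x < \<nu> y" "\<mu> y < \<mu> x \<longleftrightarrow> \<nu> y < \<nu> x"
    using marks_less[OF assms(1), of x y] marks_less[OF assms(2), of x y]
      marks_less[OF assms(1), of y x] marks_less[OF assms(2), of y x] assms(3) by simp_all
  then show ?case by auto
next
  case (FLetter a x)
  then have "x \<in> X" by simp
  then show ?case using marks_letter[OF assms(1), of x a] marks_letter[OF assms(2), of x a] assms
    by (simp add: marks_def)
qed auto

fun prefix_of :: "'a fo \<Rightarrow> bool list" where
  "prefix_of (FEx x \<phi>) = True # prefix_of \<phi>"
| "prefix_of (FAll x \<phi>) = False # prefix_of \<phi>"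
| "prefix_of \<phi> = []"

lemma prefix_of_qf: "fo_qf \<phi> \<Longrightarrow> prefix_of \<phi> = []"
  by (cases \<phi>) auto

fun is_prenex :: "'a fo \<Rightarrow> bool" where
  "is_prenex (FEx x \<phi>) = is_prenex \<phi>"
| "is_prenex (FAll x \<phi>) = is_prenex \<phi>"
| "is_prenex \<phi> = fo_qf \<phi>"

text \<open>Moving the mark \<open>x\<close> to a split-off letter: first erase it everywhere, then add it there.\<close>

definition erase :: "nat \<Rightarrow> ('a \<times> nat set) list \<Rightarrow> ('a \<times> nat set) list" where
  "erase x = map (\<lambda>(c, M). (c, M - {x}))"

lemma wins_move_mark:
  assumes "wins marked qs l l'" "wins marked qs r r'"
  shows "wins marked qs (erase x l @ (a, insert x M) # erase x r) (erase x l' @ (a, insert x M) # erase x r')"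
proof -
  have "wins marked qs (erase x l) (erase x l')" "wins marked qs (erase x r) (erase x r')"
    unfolding erase_def by (rule wins_map; use assms in auto)+
  then have "wins marked qs (erase x l @ [(a, insert x M)] @ erase x r) (erase x l' @ [(a, insert x M)] @ erase x r')"
    by (intro wins_append wins_refl)
  then show ?thesis by simp
qed

lemma marks_move:
  assumes "marks (X - {x}) (l @ (a, M) # r) \<mu>"
  shows "marks X (erase x l @ (a, insert x M) # erase x r) (\<mu>(x := length l))"
proof -
  let ?u = "l @ (a, M) # r" and ?u' = "erase x l @ (a, insert x M) # erase x r"
  have nth: "snd (?u' ! i) = (snd (?u ! i) - {x}) \<union> (if i = length l then {x} else {})"
    if "i < length ?u" for i
    using that by (auto simp: erase_def nth_append nth_Cons' case_prod_unfold)
  have len: "length ?u' = length ?u" by (simp add: erase_def)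
  show ?thesis unfolding marks_def
  proof
    fix y assume "y \<in> X"
    show "(\<mu>(x := length l)) y < length ?u' \<and>
      (\<forall>i<length ?u'. (y \<in> snd (?u' ! i)) = (i = (\<mu>(x := length l)) y))"
    proof (cases "y = x")
      case True
      then show ?thesis using nth len by auto
    next
      case False
      with \<open>y \<in> X\<close> assms(1) have "\<mu> y < length ?u" "\<forall>i<length ?u. y \<in> snd (?u ! i) \<longleftrightarrow> i = \<mu> y"
        unfolding marks_def by blast+
      moreover have "y \<in> snd (?u' ! i) \<longleftrightarrow> y \<in> snd (?u ! i)" if "i < length ?u" for i
        unfolding nth[OF that] using False by simp
      ultimately show ?thesis unfolding len using False by simp
    qed
  qed
qed

text \<open>A move splits both words, while the next quantifier again ranges over whole words.
  Gluing the halves around the newly marked letter restores one pair of words, and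
  \<open>wins_append\<close> shows that the game on it is still won.\<close>

lemma wins_sound:
  assumes "is_prenex \<phi>" "wins marked (prefix_of \<phi>) u v"
    "marks (fo_fv \<phi>) u \<mu>" "marks (fo_fv \<phi>) v \<nu>" "fo_sat (map fst u) \<mu> \<phi>"
  shows "fo_sat (map fst v) \<nu> \<phi>"
proof -
  have split: "w = take i w @ (fst (w ! i), snd (w ! i)) # drop (Suc i) w" if "i < length w"
    for i and w :: "('a \<times> nat set) list"
    using id_take_nth_drop[OF that] by simp
  have er: "map fst (erase x l @ (a, insert x M) # erase x r) = map fst (l @ (a, M) # r)" for x l a M r
    by (simp add: erase_def case_prod_unfold)
  have qf: "fo_sat (map fst v) \<nu> \<phi>"
    if "fo_qf \<phi>" "wins marked (prefix_of \<phi>) u v"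
    "marks (fo_fv \<phi>) u \<mu>" "marks (fo_fv \<phi>) v \<nu>" "fo_sat (map fst u) \<mu> \<phi>" for \<phi> u v \<mu> \<nu>
    using qf_sat_marks[OF that(3,4) _ that(1)] that by (simp add: prefix_of_qf)
  show ?thesis using assms
  proof (induction \<phi> arbitrary: u v \<mu> \<nu>)
    case (FEx x \<phi>)
    from FEx.prems(5) obtain i where i: "i < length u" "fo_sat (map fst u) (\<mu>(x := i)) \<phi>" by auto
    define l a M r where lr: "l = take i u" "a = fst (u ! i)" "M = snd (u ! i)" "r = drop (Suc i) u"
    have u: "u = l @ (a, M) # r" and l: "length l = i" unfolding lr using split[OF i(1)] i by auto
    from FEx.prems(2)[unfolded prefix_of.simps] u obtain l' r' where v: "v = l' @ (a, M) # r'"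
      and w: "wins marked (prefix_of \<phi>) l l'" "wins marked (prefix_of \<phi>) r r'"
      by (rule wins_TrueD)
    have "fo_sat (map fst (erase x l' @ (a, insert x M) # erase x r')) (\<nu>(x := length l')) \<phi>"
    proof (rule FEx.IH)
      show "is_prenex \<phi>" using FEx.prems by simp
      show "wins marked (prefix_of \<phi>) (erase x l @ (a, insert x M) # erase x r)
        (erase x l' @ (a, insert x M) # erase x r')" by (rule wins_move_mark[OF w])
      show "marks (fo_fv \<phi>) (erase x l @ (a, insert x M) # erase x r) (\<mu>(x := length l))"
        by (rule marks_move) (use FEx.prems(3) u in simp)
      show "marks (fo_fv \<phi>) (erase x l' @ (a, insert x M) # erase x r') (\<nu>(x := length l'))"
        by (rule marks_move) (use FEx.prems(4) v in simp)
      show "fo_sat (map fst (erase x l @ (a, insert x M) # erase x r)) (\<mu>(x := length l)) \<phi>"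
        unfolding er using i l u by simp
    qed
    then have "fo_sat (map fst v) (\<nu>(x := length l')) \<phi>" unfolding er v .
    then show ?case unfolding v by (auto intro!: exI[of _ "length l'"])
  next
    case (FAll x \<phi>)
    have "fo_sat (map fst v) (\<nu>(x := i)) \<phi>" if i: "i < length v" for i
    proof -
      define l a M r where lr: "l = take i v" "a = fst (v ! i)" "M = snd (v ! i)" "r = drop (Suc i) v"
      have v: "v = l @ (a, M) # r" and l: "length l = i" unfolding lr using split[OF i] i by auto
      from FAll.prems(2)[unfolded prefix_of.simps] v obtain l' r' where u: "u = l' @ (a, M) # r'"
        and w: "wins marked (prefix_of \<phi>) l' l" "wins marked (prefix_of \<phi>) r' r"
        by (rule wins_FalseD)
      have "fo_sat (map fst (erase x l @ (a, insert x M) # erase x r)) (\<nu>(x := length l)) \<phi>"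
      proof (rule FAll.IH)
        show "is_prenex \<phi>" using FAll.prems by simp
        show "wins marked (prefix_of \<phi>) (erase x l' @ (a, insert x M) # erase x r')
          (erase x l @ (a, insert x M) # erase x r)" by (rule wins_move_mark[OF w])
        show "marks (fo_fv \<phi>) (erase x l @ (a, insert x M) # erase x r) (\<nu>(x := length l))"
          by (rule marks_move) (use FAll.prems(4) v in simp)
        show "marks (fo_fv \<phi>) (erase x l' @ (a, insert x M) # erase x r') (\<mu>(x := length l'))"
          by (rule marks_move) (use FAll.prems(3) u in simp)
        have "length l' < length (map fst u)" by (simp add: u)
        then show "fo_sat (map fst (erase x l' @ (a, insert x M) # erase x r')) (\<mu>(x := length l')) \<phi>"
          unfolding er using FAll.prems(5) by (simp add: u)
      qed
      then show ?thesis unfolding er v l .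
    qed
    then show ?case by simp
  qed (rule qf, simp only: is_prenex.simps fo_qf.simps, assumption+)+
qed

text \<open>Blocks padded to a common length \<open>m\<close>: one game then serves all sentences
  with few blocks and a prefix of length at most \<open>m\<close>.\<close>

fun alternate :: "bool \<Rightarrow> nat \<Rightarrow> nat \<Rightarrow> bool list" where
  "alternate b 0 m = []"
| "alternate b (Suc k) m = replicate m b @ alternate (\<not> b) k m"

lemma alternate_Not: "map Not (alternate b k m) = alternate (\<not> b) k m"
  by (induction k arbitrary: b) auto

lemma alternate_mono: "k \<le> l \<Longrightarrow> subseq (alternate b k m) (alternate b l m)"
proof (induction k arbitrary: b l)
  case (Suc k)
  then obtain l' where l: "l = Suc l'" "k \<le> l'" by (cases l) auto
  show ?case unfolding l(1) alternate.simps
    by (rule list_emb_append_mono[OF subseq_order.order_refl Suc.IH[OF l(2)]])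
qed simp

text \<open>One spare block absorbs a wrong leading quantifier.\<close>

lemma alternate_other:
  assumes "k < l" shows "subseq (alternate b k m) (alternate c l m)"
proof (cases "b = c")
  case False
  obtain l' where l: "l = Suc l'" "k \<le> l'" using assms by (cases l) auto
  from False have "c = (\<not> b)" by simp
  then show ?thesis using list_emb_append2[OF alternate_mono[OF l(2)]] by (simp add: l(1))
qed (use assms in \<open>simp add: alternate_mono\<close>)

lemma prenex_prefix:
  fixes \<phi> :: "'a fo" shows
  "prenex b k \<phi> \<Longrightarrow> is_prenex \<phi> \<and>
    (\<forall>m\<ge>length (prefix_of \<phi>). subseq (prefix_of \<phi>) (alternate b k m))"
proof (induction k arbitrary: b \<phi>)
  case 0
  have "fo_qf \<phi> \<Longrightarrow> is_prenex \<phi>" by (cases \<phi>) auto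
  with 0 show ?case by (simp add: prefix_of_qf)
next
  case (Suc k)
  have "is_prenex \<phi> \<and> (\<exists>j (\<psi> :: 'a fo). prefix_of \<phi> = replicate j b @ prefix_of \<psi> \<and> prenex (\<not> b) k \<psi>)"
    using Suc.prems
  proof (induction "size \<phi>" arbitrary: \<phi> rule: less_induct)
    case less
    from less.prems show ?case
    proof (cases rule: prenex_Suc_cases)
      case (1 x \<psi>)
      have "is_prenex \<psi> \<and> (\<exists>j (\<chi> :: 'a fo). prefix_of \<psi> = replicate j b @ prefix_of \<chi> \<and> prenex (\<not> b) k \<chi>)"
        by (rule less.hyps) (use 1 in simp_all)
      then obtain j and \<chi> :: "'a fo" where "is_prenex \<psi>" "prefix_of \<psi> = replicate j b @ prefix_of \<chi>" "prenex (\<not> b) k \<chi>"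
        by blast
      then show ?thesis using 1 
        by (intro conjI exI[of _ "Suc j"] exI[of _ \<chi>]) (auto simp: Quant_def)
    next
      case 2
      with Suc.IH show ?thesis by (intro conjI exI[of _ 0] exI[of _ \<phi>]) auto
    qed
  qed
  then obtain j and \<psi> :: "'a fo" where j: "is_prenex \<phi>" "prefix_of \<phi> = replicate j b @ prefix_of \<psi>" "prenex (\<not> b) k \<psi>"
    by blast
  have "subseq (prefix_of \<phi>) (alternate b (Suc k) m)" if "m \<ge> length (prefix_of \<phi>)" for m
  proof -
    have "m = j + (m - j)" using that j by simp
    then have "replicate m b = replicate j b @ replicate (m - j) b" by (metis replicate_add)
    then have "subseq (replicate j b) (replicate m b)" by (simp add: list_emb_prefix)
    moreover have "subseq (prefix_of \<psi>) (alternate (\<not> b) k m)" using Suc.IH[OF j(3)] that j by simp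
    ultimately show ?thesis unfolding j(2) alternate.simps by (rule list_emb_append_mono)
  qed
  with j show ?case by blast
qed

text \<open>With \<open>Suc d\<close> blocks the prefix contains those of \<open>k\<close> blocks
  with either leading quantifier, so truth is transferred in both directions and negation does no
  harm. Binary connectives take the larger of the two bounds on \<open>m\<close>.\<close>

lemma bool_comb_wins:
  assumes "bool_comb_sigma k \<phi>" "k \<le> d"
  shows "\<exists>m0. \<forall>m\<ge>m0. \<forall>u v. wins marked (alternate True (Suc d) m) u v \<longrightarrow>
    fo_sat (map fst u) (\<lambda>_. 0) \<phi> = fo_sat (map fst v) (\<lambda>_. 0) \<phi>"
  using assms(1)
proof (induction rule: bool_comb_sigma.induct)
  case (base \<phi>)
  have p: "prenex True k \<phi>" using base by (simp add: prenex_def)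
  have "fo_sat (map fst u) (\<lambda>_. 0) \<phi> = fo_sat (map fst v) (\<lambda>_. 0) \<phi>"
    if "m \<ge> length (prefix_of \<phi>)" "wins marked (alternate True (Suc d) m) u v"
    for m and u v :: "('a \<times> nat set) list"
  proof -
    have s: "subseq (prefix_of \<phi>) (alternate True k m)" using prenex_prefix[OF p] that by blast
    have *: "wins marked (alternate b k m) u v" for b
      using assms(2) by (intro wins_subseq[OF alternate_other that(2)]) simp
    have "wins marked (alternate True k m) u v" "wins marked (alternate True k m) v u"
      using *[of True] *[of False] wins_flip[of marked "alternate True k m" u v]
      by (simp_all add: alternate_Not)
    then have "wins marked (prefix_of \<phi>) u v" "wins marked (prefix_of \<phi>) v u"
      using wins_subseq[OF s] by blast+
    then show ?thesis using wins_sound[of \<phi>] prenex_prefix[OF p] base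
      by (simp add: fo_sentence_def marks_def) blast
  qed
  then show ?case by blast
next
  case (conj \<phi> \<psi>)
  then obtain m1 m2 where "\<forall>m\<ge>m1. \<forall>u v. wins marked (alternate True (Suc d) m) u v \<longrightarrow>
    fo_sat (map fst u) (\<lambda>_. 0) \<phi> = fo_sat (map fst v) (\<lambda>_. 0) \<phi>"
    "\<forall>m\<ge>m2. \<forall>u v. wins marked (alternate True (Suc d) m) u v \<longrightarrow>
    fo_sat (map fst u) (\<lambda>_. 0) \<psi> = fo_sat (map fst v) (\<lambda>_. 0) \<psi>" by blast
  then show ?case by (intro exI[of _ "max m1 m2"]) (auto simp del: alternate.simps)
next
  case (disj \<phi> \<psi>)
  then obtain m1 m2 where "\<forall>m\<ge>m1. \<forall>u v. wins marked (alternate True (Suc d) m) u v \<longrightarrow>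
    fo_sat (map fst u) (\<lambda>_. 0) \<phi> = fo_sat (map fst v) (\<lambda>_. 0) \<phi>"
    "\<forall>m\<ge>m2. \<forall>u v. wins marked (alternate True (Suc d) m) u v \<longrightarrow>
    fo_sat (map fst u) (\<lambda>_. 0) \<psi> = fo_sat (map fst v) (\<lambda>_. 0) \<psi>" by blast
  then show ?case by (intro exI[of _ "max m1 m2"]) (auto simp del: alternate.simps)
qed simp

section \<open>Powers of a word in the game\<close>

definition pow :: "'c list \<Rightarrow> nat \<Rightarrow> 'c list" where
  "pow x n = concat (replicate n x)"

lemma pow_simps [simp]: "pow x 0 = []" "pow x (Suc n) = x @ pow x n"
  by (simp_all add: pow_def)

lemma pow_add: "pow x (m + n) = pow x m @ pow x n"
  by (simp add: pow_def replicate_add)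

lemma pow_split:
  "pow x n = l @ c # r \<Longrightarrow> \<exists>i j x' x''. Suc (i + j) = n \<and> x = x' @ c # x'' \<and> l = pow x i @ x' \<and> r = x'' @ pow x j"
proof (induction n arbitrary: l)
  case (Suc n)
  from Suc.prems have "x @ pow x n = l @ c # r" by simp
  then show ?case
  proof (cases rule: append_eq_split)
    case (1 r1)
    then show ?thesis by (intro exI[of _ 0] exI[of _ n] exI[of _ l] exI[of _ r1]) simp
  next
    case (2 l2)
    with Suc.IH obtain i j x' x'' where "Suc (i + j) = n" "x = x' @ c # x''" "l2 = pow x i @ x'" "r = x'' @ pow x j"
      by blast
    with 2 show ?thesis by (intro exI[of _ "Suc i"] exI[of _ j] exI[of _ x'] exI[of _ x'']) simp
  qed
qed simp

lemma pow_unsplit: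
  assumes "Suc (i + j) = n" "x = x' @ c # x''"
  shows "pow x n = (pow x i @ x') @ c # (x'' @ pow x j)"
proof -
  have "pow x n = pow x i @ pow x (Suc j)" using assms(1) by (metis add_Suc_right pow_add)
  then show ?thesis using assms(2) by simp
qed

text \<open>Removing one of at least \<open>2 * T + 1\<close> factors leaves two runs with together
  at least \<open>2 * T\<close> factors, so one of them is long. A short one is copied
  exactly.\<close>

lemma split_threshold:
  fixes T :: nat
  assumes "Suc (i + j) = P" "2 * T + 1 \<le> P" "2 * T + 1 \<le> N"
  shows "\<exists>i' j'. Suc (i' + j') = N \<and> (i = i' \<or> T \<le> i \<and> T \<le> i') \<and> (j = j' \<or> T \<le> j \<and> T \<le> j')"
proof (cases "i < T")
  case True
  with assms show ?thesis by (intro exI[of _ i] exI[of _ "N - Suc i"]) auto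
next
  case i: False
  show ?thesis
  proof (cases "j < T")
    case True
    with i assms show ?thesis by (intro exI[of _ "N - Suc j"] exI[of _ j]) auto
  next
    case False
    with i assms show ?thesis by (intro exI[of _ T] exI[of _ "N - Suc T"]) auto
  qed
qed

lemma filter_pow_Nil: "filter p x = [] \<Longrightarrow> filter p (pow x n) = []"
  by (induction n) auto

text \<open>Without moves left, powers of a word with no letter in \<open>p\<close> are
  indistinguishable. Each existential move raises the threshold from \<open>T\<close> to
  \<open>2 * T + 1\<close>, by \<open>split_threshold\<close>.\<close>

lemma wins_pow:
  "\<exists>T. \<forall>x m n. filter p x = [] \<longrightarrow> m \<ge> T \<longrightarrow> n \<ge> T \<longrightarrow> wins p qs (pow x m) (pow x n)"
proof (induction qs rule: wins_induct)
  case Nil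
  then show ?case by (simp add: filter_pow_Nil)
next
  case (Ex qs)
  then obtain T where T: "\<And>x m n. filter p x = [] \<Longrightarrow> m \<ge> T \<Longrightarrow> n \<ge> T \<Longrightarrow> wins p qs (pow x m) (pow x n)"
    by blast
  have T': "wins p qs (pow x i) (pow x i')" if "filter p x = []" "i = i' \<or> T \<le> i \<and> T \<le> i'" for x i i'
    using that T wins_refl by blast
  have "wins p (True # qs) (pow x m) (pow x n)"
    if x: "filter p x = []" and m: "m \<ge> 2 * T + 1" and n: "n \<ge> 2 * T + 1" for x m n
  proof (rule wins_TrueI)
    show "wins p qs (pow x m) (pow x n)" using T[OF x] m n by simp
    fix l c r assume lr: "pow x m = l @ c # r"
    obtain i j x' x'' where ij: "Suc (i + j) = m" "x = x' @ c # x''" "l = pow x i @ x'" "r = x'' @ pow x j"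
      using pow_split[OF lr] by blast
    obtain i' j' where ij': "Suc (i' + j') = n" "i = i' \<or> T \<le> i \<and> T \<le> i'" "j = j' \<or> T \<le> j \<and> T \<le> j'"
      using split_threshold[OF ij(1) m n] by blast
    show "\<exists>l' r'. pow x n = l' @ c # r' \<and> wins p qs l l' \<and> wins p qs r r'"
      unfolding ij(3,4)
      by (intro exI[of _ "pow x i' @ x'"] exI[of _ "x'' @ pow x j'"] conjI wins_append pow_unsplit ij'(1) ij(2) wins_refl T' x ij')
  qed
  then show ?case by blast
next
  case (All qs)
  then show ?case unfolding wins_flip by blast
qed

text \<open>Spoiler's pebbles leave a long run of factors \<open>x\<close> next to them, into which \<open>y\<close> is inserted.\<close>

lemma wins_insert:
  assumes "wins p (map Not qs) y x" "filter p x = []"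
  shows "\<exists>T. \<forall>n i j. n \<ge> T \<longrightarrow> i \<ge> T \<longrightarrow> j \<ge> T \<longrightarrow>
    wins p (replicate m True @ qs) (pow x n) (pow x i @ y @ pow x j)"
proof (induction m)
  case 0
  obtain T where T: "\<And>m n. m \<ge> T \<Longrightarrow> n \<ge> T \<Longrightarrow> wins p (map Not qs) (pow x m) (pow x n)"
    using wins_pow[of p "map Not qs"] assms(2) by blast
  have "wins p qs (pow x n) (pow x i @ y @ pow x j)" if "n \<ge> T" "i \<ge> T" "j \<ge> T" for n i j
  proof -
    \<comment> \<open>By \<open>wins_flip\<close> this is the game for \<open>qs\<close> from a
      plain power to the word containing \<open>y\<close>; only the exponent remains to be
      adjusted.\<close>
    have "wins p (map Not qs) (pow x i @ y @ pow x j) (pow x i @ x @ pow x j)"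
      by (intro wins_append wins_refl assms)
    moreover have "pow x i @ x @ pow x j = pow x (i + Suc j)" 
      using pow_add[of x i "Suc j"] by (simp del: add_Suc_right)
    ultimately show ?thesis using T[of "i + Suc j" n] that wins_trans wins_flip by (metis trans_le_add1)
  qed
  then show ?case by auto
next
  case (Suc m)
  let ?qs = "replicate m True @ qs"
  obtain T where T: "\<And>n i j. n \<ge> T \<Longrightarrow> i \<ge> T \<Longrightarrow> j \<ge> T \<Longrightarrow> wins p ?qs (pow x n) (pow x i @ y @ pow x j)"
    using Suc by blast
  obtain S where S: "\<And>m n. m \<ge> S \<Longrightarrow> n \<ge> S \<Longrightarrow> wins p ?qs (pow x m) (pow x n)"
    using wins_pow[of p ?qs] assms(2) by blast
  have "wins p (True # ?qs) (pow x n) (pow x i @ y @ pow x j)"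
    if n: "n \<ge> 2 * T + S + 1" and i: "i \<ge> 2 * T + S + 1" and j: "j \<ge> 2 * T + S + 1" for n i j
  proof -
    \<comment> \<open>On the side of the pebble away from \<open>y\<close> the run is cut to at most
      \<open>S\<close> factors. This leaves at least \<open>T\<close> copies of \<open>x\<close>
      between the pebble and \<open>y\<close>, which explains the bound
      \<open>2 * T + S + 1\<close>.\<close>
    have min: "wins p ?qs (pow x k) (pow x (min k S))" for k
      using S[of k "min k S"] wins_refl by (cases "k \<le> S") auto
    have "\<exists>l' r'. pow x i @ y @ pow x j = l' @ c # r' \<and> wins p ?qs l l' \<and> wins p ?qs r r'"
      if lr: "pow x n = l @ c # r" for l c r
    proof -
      obtain a b x' x'' where ab: "Suc (a + b) = n" "x = x' @ c # x''" "l = pow x a @ x'" "r = x'' @ pow x b"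
        using pow_split[OF lr] by blast
      show ?thesis
      \<comment> \<open>The factor \<open>y\<close> goes to a side of the pebble on which at least
        \<open>T\<close> factors are left.\<close>
      proof (cases "a \<ge> T")
        case True
        define b' where "b' = min b S"
        have "pow x j = (pow x (j - Suc b') @ x') @ c # (x'' @ pow x b')"
          by (rule pow_unsplit) (use j ab in \<open>auto simp: b'_def\<close>)
        then have "pow x i @ y @ pow x j = ((pow x i @ y @ pow x (j - Suc b')) @ x') @ c # (x'' @ pow x b')"
          by simp
        moreover have "wins p ?qs (pow x a @ x') ((pow x i @ y @ pow x (j - Suc b')) @ x')"
          by (rule wins_append[OF T wins_refl]) (use True i j in \<open>auto simp: b'_def\<close>)
        moreover have "wins p ?qs (x'' @ pow x b) (x'' @ pow x b')"
          unfolding b'_def by (intro wins_append wins_refl min)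
        ultimately show ?thesis unfolding ab(3,4) by blast
      next
        case False
        define a' where "a' = min a S"
        have "pow x i = (pow x a' @ x') @ c # (x'' @ pow x (i - Suc a'))"
          by (rule pow_unsplit) (use i ab in \<open>auto simp: a'_def\<close>)
        then have "pow x i @ y @ pow x j = (pow x a' @ x') @ c # (x'' @ (pow x (i - Suc a') @ y @ pow x j))"
          by simp
        moreover have "wins p ?qs (x'' @ pow x b) (x'' @ (pow x (i - Suc a') @ y @ pow x j))"
          by (rule wins_append[OF wins_refl T]) (use False n ab i j in \<open>auto simp: a'_def\<close>)
        moreover have "wins p ?qs (pow x a @ x') (pow x a' @ x')"
          unfolding a'_def by (intro wins_append wins_refl min)
        ultimately show ?thesis unfolding ab(3,4) by blast
      qed
    qed
    moreover have "wins p ?qs (pow x n) (pow x i @ y @ pow x j)" by (rule T) (use n i j in auto)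
    ultimately show ?thesis by simp
  qed
  then show ?case by (metis append_Cons replicate_Suc)
qed

section \<open>Unbounded alternation depth\<close>

fun fo_of_fo2 :: "'a fo2 \<Rightarrow> 'a fo" where
  "fo_of_fo2 GTrue = FTrue"
| "fo_of_fo2 (GLt x y) = FLt (of_bool x) (of_bool y)"
| "fo_of_fo2 (GEq x y) = FEq (of_bool x) (of_bool y)"
| "fo_of_fo2 (GLetter a x) = FLetter a (of_bool x)"
| "fo_of_fo2 (GBtw a x y) = FEx 2 (FAnd (FLt (of_bool x) 2) (FAnd (FLt 2 (of_bool y)) (FLetter a 2)))"
| "fo_of_fo2 (GNeg \<phi>) = FNeg (fo_of_fo2 \<phi>)"
| "fo_of_fo2 (GAnd \<phi> \<psi>) = FAnd (fo_of_fo2 \<phi>) (fo_of_fo2 \<psi>)"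
| "fo_of_fo2 (GOr \<phi> \<psi>) = FOr (fo_of_fo2 \<phi>) (fo_of_fo2 \<psi>)"
| "fo_of_fo2 (GEx x \<phi>) = FEx (of_bool x) (fo_of_fo2 \<phi>)"
| "fo_of_fo2 (GAll x \<phi>) = FAll (of_bool x) (fo_of_fo2 \<phi>)"

lemma inj_of_bool: "inj (of_bool :: bool \<Rightarrow> nat)"
  by (auto simp: inj_def of_bool_def split: if_splits)

lemma fo_of_fo2_fv: "fo_fv (fo_of_fo2 \<phi>) = of_bool ` fo2_fv \<phi>"
proof (induction \<phi>)
  case (GEx x \<phi>)
  then show ?case using image_set_diff[OF inj_of_bool, of "fo2_fv \<phi>" "{x}"] by simp
next
  case (GAll x \<phi>)
  then show ?case using image_set_diff[OF inj_of_bool, of "fo2_fv \<phi>" "{x}"] by simp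
qed (auto simp: of_bool_def)

lemma fo_of_fo2_sat:
  "fo_sat w v (fo_of_fo2 \<phi>) = fo2_sat w (\<lambda>b. v (of_bool b)) \<phi>"
proof (induction \<phi> arbitrary: v)
  case (GBtw a x y)
  have "(of_bool b :: nat) \<noteq> 2" for b by (cases b) auto
  then show ?case by auto
next
  case (GEx x \<phi>)
  have "(\<lambda>b. (v(of_bool x := i)) (of_bool b)) = (\<lambda>b. v (of_bool b))(x := i)" for i
    using inj_of_bool by (auto simp: inj_def)
  then show ?case by (simp only: fo_of_fo2.simps fo_sat.simps fo2_sat.simps GEx)
next
  case (GAll x \<phi>)
  have "(\<lambda>b. (v(of_bool x := i)) (of_bool b)) = (\<lambda>b. v (of_bool b))(x := i)" for i
    using inj_of_bool by (auto simp: inj_def)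
  then show ?case by (simp only: fo_of_fo2.simps fo_sat.simps fo2_sat.simps GAll)
qed auto

text \<open>A lower bound for \<open>alt_depth\<close> needs this: only if some \<open>k\<close> is
  admissible is the value of the \<open>LEAST\<close> operator itself admissible.\<close>

lemma fo2_bool_comb:
  assumes "fo2_fv \<phi> = {}"
  shows "\<exists>k \<psi>. bool_comb_sigma k \<psi> \<and> (\<forall>w. fo_sat w (\<lambda>_. 0) \<psi> = fo2_sat w (\<lambda>_. 0) \<phi>)"
proof -
  obtain k where "level True k (fo_of_fo2 \<phi>)" using level_exists by blast
  then have "level True (Suc k) (fo_of_fo2 \<phi>)" by (rule level.up)
  then obtain \<psi> where "bool_comb_sigma (Suc k) \<psi>" "\<And>w v. fo_sat w v \<psi> = fo_sat w v (fo_of_fo2 \<phi>)"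
    using level_bool_comb assms by (metis fo_of_fo2_fv fo_sentence_def image_empty)
  then show ?thesis using fo_of_fo2_sat[of _ "\<lambda>_. 0"] by metis
qed

section \<open>The alternating property\<close>

text \<open>The suffix \<open>r\<close> is read only up to its first letter above \<open>k\<close>. The quantifier alternation
  comes from the negation.\<close>

fun alternating :: "nat \<Rightarrow> nat list \<Rightarrow> bool" where
  "alternating 0 r = (\<exists>s t. r = s @ 0 # t \<and> (\<forall>c\<in>set s. c \<le> 0))"
| "alternating (Suc k) r = (\<exists>s t. r = s @ Suc k # t \<and> (\<forall>c\<in>set s. c \<le> Suc k) \<and> \<not> alternating k t)"

lemma split_before:
  assumes "\<forall>d\<in>set s. d \<le> k" "(c :: nat) > k"
  shows "t @ c # r = s @ k # t' \<longleftrightarrow> (\<exists>t''. t = s @ k # t'' \<and> t' = t'' @ c # r)"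
proof
  assume "t @ c # r = s @ k # t'"
  then show "\<exists>t''. t = s @ k # t'' \<and> t' = t'' @ c # r"
  proof (cases rule: append_eq_split)
    case (2 l2)
    then show ?thesis using assms by (cases l2) auto
  qed auto
qed auto

lemma alternating_append: "c > k \<Longrightarrow> alternating k (t @ c # r) = alternating k t"
proof (induction k arbitrary: t)
  case 0
  have "alternating 0 (t @ c # r) \<longleftrightarrow>
    (\<exists>s t'. (\<forall>c\<in>set s. c \<le> 0) \<and> (\<exists>t''. t = s @ 0 # t'' \<and> t' = t'' @ c # r))"
    using split_before[of _ 0 c t r] 0 by (simp cong: conj_cong) metis
  then show ?case by auto
next
  case (Suc k)
  have "alternating (Suc k) (t @ c # r) \<longleftrightarrow> (\<exists>s t'. (\<forall>c\<in>set s. c \<le> Suc k) \<and>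
     (\<exists>t''. t = s @ Suc k # t'' \<and> t' = t'' @ c # r) \<and> \<not> alternating k t')"
    using split_before[of _ "Suc k" c t r] Suc.prems unfolding alternating.simps by blast
  also have "\<dots> \<longleftrightarrow> alternating (Suc k) t" using Suc by auto
  finally show ?case .
qed

text \<open>Every occurrence of \<open>Suc k\<close> starts a block, and by
  \<open>alternating_append\<close> the suffix after it is read only up to the end of that
  block.\<close>

lemma alternating_blocks:
  "\<forall>t\<in>set ts. set t \<subseteq> {..k} \<Longrightarrow>
    alternating (Suc k) (concat (map ((#) (Suc k)) ts)) \<longleftrightarrow> (\<exists>t\<in>set ts. \<not> alternating k t)"
proof (induction ts)
  case (Cons t ts)
  let ?r = "concat (map ((#) (Suc k)) ts)"
  have app: "alternating k (t @ ?r) = alternating k t"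
    by (cases ts) (simp_all add: alternating_append)
  have "alternating (Suc k) (Suc k # t @ ?r) \<longleftrightarrow> \<not> alternating k (t @ ?r) \<or> alternating (Suc k) ?r"
  proof
    assume "alternating (Suc k) (Suc k # t @ ?r)"
    then obtain s u where su: "Suc k # t @ ?r = s @ Suc k # u" "\<forall>c\<in>set s. c \<le> Suc k" "\<not> alternating k u"
      by auto
    show "\<not> alternating k (t @ ?r) \<or> alternating (Suc k) ?r"
    proof (cases s)
      case Nil
      with su show ?thesis by simp
    next
      case (Cons a s')
      have "t @ ?r = s' @ Suc k # u" using su(1) unfolding Cons by (metis append_Cons list.inject)
      then show ?thesis
      proof (cases rule: append_eq_split)
        case (1 r1)
        then have "Suc k \<in> set t" by simp
        then show ?thesis using Cons.prems by auto
      next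
        case (2 l2)
        moreover have "\<forall>c\<in>set l2. c \<le> Suc k" using 2 su(2) Cons by auto
        ultimately show ?thesis using su(3) unfolding alternating.simps by blast
      qed
    qed
  next
    assume "\<not> alternating k (t @ ?r) \<or> alternating (Suc k) ?r"
    then show "alternating (Suc k) (Suc k # t @ ?r)"
    proof
      assume "\<not> alternating k (t @ ?r)"
      then show ?thesis unfolding alternating.simps
        by (intro exI[of _ "[]"] exI[of _ "t @ ?r"]) simp
    next
      assume "alternating (Suc k) ?r"
      then obtain s u where su: "?r = s @ Suc k # u" "\<forall>c\<in>set s. c \<le> Suc k" "\<not> alternating k u" by auto
      have "\<forall>c\<in>set (Suc k # t @ s). c \<le> Suc k" using su Cons.prems by auto
      then show ?thesis using su unfolding alternating.simps
        by (intro exI[of _ "Suc k # t @ s"] exI[of _ u]) simp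
    qed
  qed
  then show ?case using Cons app by simp
qed simp

section \<open>Words that few quantifier blocks do not separate\<close>

definition unmarked :: "'a list \<Rightarrow> ('a \<times> nat set) list" where
  "unmarked = map (\<lambda>c. (c, {}))"

lemma filter_unmarked: "filter marked (unmarked w) = []"
  by (simp add: unmarked_def filter_empty_conv)

lemma unmarked_pow: "unmarked (pow x n) = pow (unmarked x) n"
  by (induction n) (simp_all add: unmarked_def)

lemma pow_block: "pow (a # x) n = concat (map ((#) a) (replicate n x))"
  by (simp add: pow_def)

lemma hard_words:
  "\<exists>x y. set x \<subseteq> {..k} \<and> set y \<subseteq> {..k} \<and> alternating k x \<and> \<not> alternating k y \<and>
    wins marked (alternate True k m) (unmarked y) (unmarked x)"
proof (induction k)
  case 0
  have "alternating 0 [0]" by (auto intro!: exI[of _ "[]"])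
  then show ?case by (intro exI[of _ "[0]"] exI[of _ "[]"]) (simp add: filter_unmarked)
next
  case (Suc k)
  then obtain x y where xy: "set x \<subseteq> {..k}" "set y \<subseteq> {..k}" "alternating k x" "\<not> alternating k y"
    "wins marked (alternate True k m) (unmarked y) (unmarked x)" by blast
  let ?X = "Suc k # x" and ?Y = "Suc k # y"
  have "wins marked (alternate True k m) ([(Suc k, {})] @ unmarked y) ([(Suc k, {})] @ unmarked x)"
    by (rule wins_append[OF wins_refl xy(5)])
  \<comment> \<open>The hypothesis for a prefix beginning with an existential block is read in the
    opposite direction, where the block is universal. That is the prefix which follows the new
    existential block.\<close>
  then have "wins marked (map Not (alternate False k m)) (unmarked ?Y) (unmarked ?X)"
    by (simp add: alternate_Not unmarked_def)
  from wins_insert[OF this filter_unmarked, of m] obtain T where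
    "wins marked (replicate m True @ alternate False k m) (pow (unmarked ?X) T)
      (pow (unmarked ?X) T @ unmarked ?Y @ pow (unmarked ?X) T)" by blast
  then have w: "wins marked (alternate True (Suc k) m) (unmarked (pow ?X T))
      (unmarked (pow ?X T @ ?Y @ pow ?X T))"
    by (simp add: unmarked_pow[symmetric]) (simp add: unmarked_def)
  have "alternating (Suc k) (concat (map ((#) (Suc k)) (replicate T x @ [y] @ replicate T x)))"
    by (subst alternating_blocks) (use xy in auto)
  then have 1: "alternating (Suc k) (pow ?X T @ ?Y @ pow ?X T)" by (simp add: pow_block)
  have 2: "\<not> alternating (Suc k) (pow ?X T)"
    unfolding pow_block by (subst alternating_blocks) (use xy in auto)
  have s: "set (pow ?X T) \<subseteq> {..Suc k}" using xy by (auto simp: pow_def)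
  show ?case
    by (intro exI[of _ "pow ?X T @ ?Y @ pow ?X T"] exI[of _ "pow ?X T"] conjI s 1 2 w)
      (use s xy in auto)
qed

section \<open>Two-variable definition of the alternating property\<close>

fun fo2_conj :: "'a fo2 list \<Rightarrow> 'a fo2" where
  "fo2_conj [] = GTrue"
| "fo2_conj (\<phi> # \<phi>s) = GAnd \<phi> (fo2_conj \<phi>s)"

lemma fo2_conj_sat: "fo2_sat w v (fo2_conj \<phi>s) \<longleftrightarrow> (\<forall>\<phi>\<in>set \<phi>s. fo2_sat w v \<phi>)"
  by (induction \<phi>s) auto

lemma fo2_conj_fv: "fo2_fv (fo2_conj \<phi>s) = (\<Union>\<phi>\<in>set \<phi>s. fo2_fv \<phi>)"
  by (induction \<phi>s) auto

text \<open>Over an alphabet bounded by \<open>n\<close>, a finite conjunction excludes all letters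
  above \<open>k\<close> from the gap.\<close>

definition next_low :: "nat \<Rightarrow> nat \<Rightarrow> bool \<Rightarrow> nat fo2 \<Rightarrow> nat fo2" where
  "next_low n k b \<phi> = GEx (\<not> b) (GAnd (GLt b (\<not> b)) (GAnd (GLetter k (\<not> b))
     (GAnd (fo2_conj (map (\<lambda>c. GNeg (GBtw c b (\<not> b))) [Suc k..<Suc n])) \<phi>)))"

text \<open>The rest of the condition concerns only the suffix after the last position found, so the
  earlier position can be forgotten and the two variables take turns.\<close>

fun alternating_fo2 :: "nat \<Rightarrow> nat \<Rightarrow> bool \<Rightarrow> nat fo2" where
  "alternating_fo2 n 0 b = next_low n 0 b GTrue"
| "alternating_fo2 n (Suc k) b = next_low n (Suc k) b (GNeg (alternating_fo2 n k (\<not> b)))"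

lemma drop_split:
  "(\<exists>s t. drop (Suc i) w = s @ c # t \<and> (\<forall>d\<in>set s. Q d) \<and> P t) \<longleftrightarrow>
   (\<exists>j < length w. i < j \<and> w ! j = c \<and> (\<forall>z. i < z \<and> z < j \<longrightarrow> Q (w ! z)) \<and> P (drop (Suc j) w))"
proof
  assume "\<exists>s t. drop (Suc i) w = s @ c # t \<and> (\<forall>d\<in>set s. Q d) \<and> P t"
  then obtain s t where st: "drop (Suc i) w = s @ c # t" "\<forall>d\<in>set s. Q d" "P t" by blast
  have len: "length w = Suc i + length s + Suc (length t)"
    using arg_cong[OF st(1), of length] by (cases "length w \<le> Suc i") auto
  have nth: "w ! (Suc i + j) = (s @ c # t) ! j" for j
    using st(1) len by (metis add_leD1 le_add1 nth_drop)
  have "drop (Suc (Suc i + length s)) w = drop (Suc (length s)) (drop (Suc i) w)"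
    by (simp add: add.commute)
  then have "drop (Suc (Suc i + length s)) w = t" by (simp add: st(1))
  moreover have "Q (w ! z)" if "i < z \<and> z < Suc i + length s" for z
  proof -
    have "w ! z = (s @ c # t) ! (z - Suc i)" using nth[of "z - Suc i"] that by simp
    also have "\<dots> = s ! (z - Suc i)" using that by (auto simp: nth_append)
    also have "\<dots> \<in> set s" using that by auto
    finally show ?thesis using st by blast
  qed
  ultimately show "\<exists>j < length w. i < j \<and> w ! j = c \<and> (\<forall>z. i < z \<and> z < j \<longrightarrow> Q (w ! z)) \<and> P (drop (Suc j) w)"
    using st(3) len nth[of "length s"] by (intro exI[of _ "Suc i + length s"]) auto
next
  assume "\<exists>j < length w. i < j \<and> w ! j = c \<and> (\<forall>z. i < z \<and> z < j \<longrightarrow> Q (w ! z)) \<and> P (drop (Suc j) w)"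
  then obtain j where j: "j < length w" "i < j" "w ! j = c" "\<forall>z. i < z \<and> z < j \<longrightarrow> Q (w ! z)" "P (drop (Suc j) w)"
    by blast
  let ?w = "drop (Suc i) w" and ?k = "j - Suc i"
  have "?w = take ?k ?w @ ?w ! ?k # drop (Suc ?k) ?w" by (rule id_take_nth_drop) (use j in simp)
  moreover have "?w ! ?k = c" "drop (Suc ?k) ?w = drop (Suc j) w" using j by simp_all
  moreover have "\<forall>d\<in>set (take ?k ?w). Q d" using j by (auto simp: in_set_conv_nth)
  ultimately show "\<exists>s t. drop (Suc i) w = s @ c # t \<and> (\<forall>d\<in>set s. Q d) \<and> P t"
    using j by metis
qed

lemma next_low_sat:
  assumes "set w \<subseteq> {..n}"
  shows "fo2_sat w v (next_low n k b \<phi>) \<longleftrightarrow> (\<exists>j < length w. v b < j \<and> w ! j = k \<and>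
    (\<forall>z. v b < z \<and> z < j \<longrightarrow> w ! z \<le> k) \<and> fo2_sat w (v((\<not> b) := j)) \<phi>)"
proof -
  have "(\<forall>c\<in>{Suc k..<Suc n}. \<not> (\<exists>z. v b < z \<and> z < j \<and> z < length w \<and> w ! z = c)) \<longleftrightarrow>
    (\<forall>z. v b < z \<and> z < j \<longrightarrow> w ! z \<le> k)" if "j < length w" for j
  proof -
    have le: "w ! z \<le> n" if "z < j" for z 
      using assms \<open>j < length w\<close> that by (meson atMost_iff nth_mem order.strict_trans subsetD)
    then have "w ! z \<in> {Suc k..<Suc n} \<longleftrightarrow> \<not> w ! z \<le> k" if "z < j" for z
      using that le[OF that] by (auto simp: less_Suc_eq_le)
    moreover have "z < length w" if "z < j" for z using that \<open>j < length w\<close> by simp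
    ultimately show ?thesis by blast
  qed
  moreover have "fo2_sat w v (next_low n k b \<phi>) \<longleftrightarrow> (\<exists>j < length w. v b < j \<and> w ! j = k \<and>
    (\<forall>c\<in>{Suc k..<Suc n}. \<not> (\<exists>z. v b < z \<and> z < j \<and> z < length w \<and> w ! z = c)) \<and>
    fo2_sat w (v((\<not> b) := j)) \<phi>)"
    unfolding next_low_def by (auto simp: fo2_conj_sat simp del: upt_Suc)
  ultimately show ?thesis by (simp cong: conj_cong)
qed

lemma alternating_fo2_sat:
  "set w \<subseteq> {..n} \<Longrightarrow> fo2_sat w v (alternating_fo2 n k b) = alternating k (drop (Suc (v b)) w)"
proof (induction k arbitrary: b v)
  case 0
  then show ?case
    using drop_split[of "v b" w 0 "\<lambda>c. c \<le> 0" "\<lambda>_. True"] by (simp add: next_low_sat)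
next
  case (Suc k)
  then show ?case
    using drop_split[of "v b" w "Suc k" "\<lambda>c. c \<le> Suc k" "\<lambda>t. \<not> alternating k t"]
    by (simp add: next_low_sat)
qed

lemma alternating_fo2_fv: "fo2_fv (alternating_fo2 n k b) \<subseteq> {b}"
  by (induction k arbitrary: b) (auto simp: next_low_def fo2_conj_fv)

lemma alt_depth_unbounded:
  "\<exists>(A::nat set) L. finite A \<and> L \<subseteq> lists A \<and> fo2inv_definable A L \<and> alt_depth A L > d"
proof -
  \<comment> \<open>Level \<open>Suc d\<close> provides the spare block that
    \<open>bool_comb_wins\<close> asks for. The letter \<open>Suc n\<close> will be put in front of
    the hard words, where it gives the free variable of the formula a unique position to start
    from.\<close>
  define n where "n = Suc d"
  define \<phi> where "\<phi> = GEx False (GAnd (GLetter (Suc n) False) (alternating_fo2 (Suc n) n False))"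
  define A where "A = {..Suc n}"
  define L where "L = {w \<in> lists A. fo2_sat w (\<lambda>_. 0) \<phi>}"
  have sent: "fo2_fv \<phi> = {}" using alternating_fo2_fv by (auto simp: \<phi>_def)
  have L: "Suc n # x \<in> L \<longleftrightarrow> alternating n x" if "set x \<subseteq> {..n}" for x
  proof -
    have "set (Suc n # x) \<subseteq> {..Suc n}" using that by auto
    moreover have "i = 0" if "i < Suc (length x)" "(Suc n # x) ! i = Suc n" for i
    proof (cases i)
      case (Suc j)
      then have "j < length x" "x ! j = Suc n" using that by auto
      then have "Suc n \<in> set x" by (metis nth_mem)
      then show ?thesis using \<open>set x \<subseteq> {..n}\<close> by auto
    qed
    then have "(\<exists>i<Suc (length x). (Suc n # x) ! i = Suc n \<and> alternating n (drop i x)) \<longleftrightarrow> alternating n x"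
      by (metis drop0 nth_Cons_0 zero_less_Suc)
    ultimately show ?thesis
      by (auto simp: L_def A_def \<phi>_def alternating_fo2_sat in_lists_conv_set)
  qed
  have "d < alt_depth A L"
  proof (rule ccontr)
    let ?P = "\<lambda>k. \<exists>\<psi>. bool_comb_sigma k \<psi> \<and> fo_defines A \<psi> L"
    assume "\<not> d < alt_depth A L"
    moreover have "\<exists>k. ?P k"
      using fo2_bool_comb[OF sent] bool_comb_sentence unfolding fo_defines_def L_def by fastforce
    then have "?P (alt_depth A L)" unfolding alt_depth_def by (rule LeastI_ex)
    ultimately obtain k \<psi> where k: "k \<le> d" "bool_comb_sigma k \<psi>" "fo_defines A \<psi> L" by (meson leI)
    obtain m where m: "\<And>u v. wins marked (alternate True (Suc d) m) u v \<Longrightarrow>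
        fo_sat (map fst u) (\<lambda>_. 0) \<psi> = fo_sat (map fst v) (\<lambda>_. 0) \<psi>"
      using bool_comb_wins[OF k(2,1)] by blast
    obtain x y where xy: "set x \<subseteq> {..n}" "set y \<subseteq> {..n}" "alternating n x" "\<not> alternating n y"
      "wins marked (alternate True n m) (unmarked y) (unmarked x)" using hard_words by blast
    have "wins marked (alternate True n m) ([(Suc n, {})] @ unmarked y) ([(Suc n, {})] @ unmarked x)"
      by (rule wins_append[OF wins_refl xy(5)])
    from m[OF this[unfolded n_def]] 
    have "fo_sat (Suc n # y) (\<lambda>_. 0) \<psi> = fo_sat (Suc n # x) (\<lambda>_. 0) \<psi>"
      by (simp add: unmarked_def comp_def n_def)
    moreover have "Suc n # y \<in> lists A" "Suc n # x \<in> lists A" using xy by (auto simp: A_def in_lists_conv_set)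
    ultimately have "Suc n # y \<in> L \<longleftrightarrow> Suc n # x \<in> L" using k(3) by (simp add: fo_defines_def)
    then show False using L xy by simp
  qed
  moreover have "fo2inv_definable A L" using sent by (auto simp: fo2inv_definable_def L_def)
  ultimately show ?thesis by (intro exI[of _ A] exI[of _ L]) (auto simp: A_def L_def)
qed

section \<open>Local types over a two-letter alphabet\<close>

definition ltd :: "bool \<Rightarrow> nat \<Rightarrow> nat \<Rightarrow> bool" where
  "ltd d x y = (if d then x < y else y < x)"

lemma ltd_flip: "ltd (\<not> d) x y = ltd d y x"
  by (simp add: ltd_def)

lemma ltd_trans: "ltd d x y \<Longrightarrow> ltd d y z \<Longrightarrow> ltd d x z"
  by (auto simp: ltd_def split: if_splits)

lemma ltd_asym: "ltd d x y \<Longrightarrow> \<not> ltd d y x"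
  by (auto simp: ltd_def split: if_splits)

lemma ltd_linear: "x \<noteq> y \<Longrightarrow> ltd d x y \<or> ltd d y x"
  by (auto simp: ltd_def split: if_splits)

lemma ltd_le_trans: "\<not> ltd d y x \<Longrightarrow> ltd d y z \<Longrightarrow> ltd d x z"
  by (auto simp: ltd_def split: if_splits)

lemma ltd_trans_le: "ltd d x y \<Longrightarrow> \<not> ltd d z y \<Longrightarrow> ltd d x z"
  by (auto simp: ltd_def split: if_splits)

lemma ltd_extremal:
  assumes "finite S" "S \<noteq> {}"
  shows "\<exists>q\<in>S. \<forall>q'\<in>S. \<not> ltd d q q'"
proof (cases d)
  case True
  with assms show ?thesis by (intro bexI[of _ "Max S"]) (auto simp: ltd_def not_less)
next
  case False
  with assms show ?thesis by (intro bexI[of _ "Min S"]) (auto simp: ltd_def not_less)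
qed

text \<open>The value \<open>None\<close> is a position outside the word; it lies before the first and
  after the last position. Hence \<open>step\<close> from \<open>None\<close> finds the first or the last
  position satisfying \<open>P\<close>.\<close>

definition after :: "bool \<Rightarrow> nat option \<Rightarrow> nat \<Rightarrow> bool" where
  "after d p y = (case p of None \<Rightarrow> True | Some x \<Rightarrow> ltd d x y)"

lemma after_simps [simp]: "after d None y" "after d (Some x) y = ltd d x y"
  by (simp_all add: after_def)

definition step :: "nat \<Rightarrow> bool \<Rightarrow> (nat \<Rightarrow> bool) \<Rightarrow> nat option \<Rightarrow> nat option" where
  "step n d P p = (if \<exists>y<n. P y \<and> after d p y
     then Some (THE y. y < n \<and> P y \<and> after d p y \<and> (\<forall>z<n. P z \<longrightarrow> after d p z \<longrightarrow> \<not> ltd d z y))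
     else None)"

lemma step_None: "step n d P p = None \<longleftrightarrow> (\<forall>y<n. P y \<longrightarrow> \<not> after d p y)"
  by (auto simp: step_def)

lemma step_Some:
  "step n d P p = Some y \<longleftrightarrow>
    y < n \<and> P y \<and> after d p y \<and> (\<forall>z<n. P z \<longrightarrow> after d p z \<longrightarrow> \<not> ltd d z y)"
proof -
  let ?Q = "\<lambda>y. y < n \<and> P y \<and> after d p y \<and> (\<forall>z<n. P z \<longrightarrow> after d p z \<longrightarrow> \<not> ltd d z y)"
  have uniq: "y = y'" if "?Q y" "?Q y'" for y y' using that ltd_linear by blast
  show ?thesis
  proof (cases "\<exists>y<n. P y \<and> after d p y")
    case True
    have "\<exists>q\<in>{y. y < n \<and> P y \<and> after d p y}. \<forall>q'\<in>{y. y < n \<and> P y \<and> after d p y}. \<not> ltd (\<not> d) q q'"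
      by (rule ltd_extremal) (use True in auto)
    then obtain q where q: "?Q q" by (auto simp: ltd_flip)
    have "(THE y. ?Q y) = q" by (rule the_equality[of ?Q, OF q uniq[OF _ q]])
    then have "step n d P p = Some q" using True by (simp add: step_def)
    then show ?thesis using q uniq by auto
  qed (auto simp: step_def)
qed

lemma step_cong:
  assumes "\<And>z. z < n \<Longrightarrow> P z \<Longrightarrow> after d p z = after d p' z"
  shows "step n d P p = step n d P p'"
proof (cases "step n d P p'")
  case None
  with assms have "step n d P p = None" by (auto simp: step_None)
  with None show ?thesis by simp
next
  case (Some y)
  with assms have "step n d P p = Some y" by (auto simp: step_Some)
  with Some show ?thesis by simp
qed

lemma step_Suc: "Suc y < n \<Longrightarrow> P (Suc y) \<Longrightarrow> step n True P (Some y) = Some (Suc y)"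
  by (auto simp: step_Some ltd_def)

lemma step_pred: "y < n \<Longrightarrow> P y \<Longrightarrow> step n False P (Some (Suc y)) = Some y"
  by (auto simp: step_Some ltd_def)

fun run :: "nat \<Rightarrow> ('p \<Rightarrow> nat \<Rightarrow> bool) \<Rightarrow> (bool \<times> 'p) list \<Rightarrow> nat option \<Rightarrow> nat option" where
  "run n S [] p = p"
| "run n S ((d, \<pi>) # g) p = run n S g (step n d (S \<pi>) p)"

lemma run_append: "run n S (g @ h) p = run n S h (run n S g p)"
  by (induction n S g p rule: run.induct) auto

text \<open>The label \<open>None\<close> accepts every position of the word, so a step with it goes
  to the adjacent position.\<close>

definition has_letter :: "'a list \<Rightarrow> 'a option \<Rightarrow> nat \<Rightarrow> bool" where
  "has_letter w c i = (i < length w \<and> (c = None \<or> c = Some (w ! i)))"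

lemma has_letter_None: "has_letter w None i = (i < length w)"
  by (simp add: has_letter_def)

lemma has_letter_Some: "has_letter w (Some c) i = (i < length w \<and> w ! i = c)"
  by (auto simp: has_letter_def)

abbreviation lstep :: "'a list \<Rightarrow> bool \<Rightarrow> 'a option \<Rightarrow> nat option \<Rightarrow> nat option" where
  "lstep w d c \<equiv> step (length w) d (has_letter w c)"

definition letter :: "'a list \<Rightarrow> nat option \<Rightarrow> 'a option" where
  "letter w p = (case p of None \<Rightarrow> None | Some i \<Rightarrow> if i < length w then Some (w ! i) else None)"

lemma letter_Some [simp]: "i < length w \<Longrightarrow> letter w (Some i) = Some (w ! i)"
  and letter_None [simp]: "letter w None = None"
  by (simp_all add: letter_def)

definition steps :: "'a set \<Rightarrow> (bool \<times> 'a option) set" where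
  "steps A = UNIV \<times> insert None (Some ` A)"

text \<open>What is recorded is the letter at the end of each short walk. The constant value on all
  other walks turns agreement into equality of functions and leaves only finitely many types over a
  finite alphabet.\<close>

definition ltype :: "'a set \<Rightarrow> nat \<Rightarrow> 'a list \<Rightarrow> nat option \<Rightarrow> (bool \<times> 'a option) list \<Rightarrow> 'a option" where
  "ltype A N w p = (\<lambda>g. if length g \<le> N \<and> set g \<subseteq> steps A
     then letter w (run (length w) (has_letter w) g p) else None)"

lemma ltype_eq_iff:
  "ltype A N w p = ltype A N w' p' \<longleftrightarrow> (\<forall>g. length g \<le> N \<longrightarrow> set g \<subseteq> steps A \<longrightarrow>
    letter w (run (length w) (has_letter w) g p) = letter w' (run (length w') (has_letter w') g p'))"
  by (auto simp: ltype_def fun_eq_iff split: if_splits)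

lemma ltype_mono: "ltype A M w p = ltype A M w' p' \<Longrightarrow> N \<le> M \<Longrightarrow> ltype A N w p = ltype A N w' p'"
  by (simp add: ltype_eq_iff)

lemma ltype_letter: "ltype A N w p = ltype A N w' p' \<Longrightarrow> letter w p = letter w' p'"
  unfolding ltype_eq_iff by (drule spec[of _ "[]"]) simp

lemma ltype_step:
  assumes "ltype A (Suc N) w p = ltype A (Suc N) w' p'" "(d, c) \<in> steps A"
  shows "ltype A N w (lstep w d c p) = ltype A N w' (lstep w' d c p')"
  unfolding ltype_eq_iff
proof (intro allI impI)
  fix g assume "length g \<le> N" "set g \<subseteq> steps A"
  then show "letter w (run (length w) (has_letter w) g (lstep w d c p)) =
    letter w' (run (length w') (has_letter w') g (lstep w' d c p'))"
    using assms(1)[unfolded ltype_eq_iff, rule_format, of "(d, c) # g"] assms(2) by simp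
qed

lemma ltype_SucI:
  assumes "letter w p = letter w' p'"
    "\<And>d c. (d, c) \<in> steps A \<Longrightarrow> ltype A N w (lstep w d c p) = ltype A N w' (lstep w' d c p')"
  shows "ltype A (Suc N) w p = ltype A (Suc N) w' p'"
  unfolding ltype_eq_iff
proof (intro allI impI)
  fix g assume g: "length g \<le> Suc N" "set g \<subseteq> steps A"
  show "letter w (run (length w) (has_letter w) g p) = letter w' (run (length w') (has_letter w') g p')"
  proof (cases g)
    case Nil
    then show ?thesis using assms(1) by simp
  next
    case (Cons st h)
    obtain d c where st: "st = (d, c)" by (cases st)
    show ?thesis
      using assms(2)[of d c, unfolded ltype_eq_iff, rule_format, of h] g Cons st by simp
  qed
qed

text \<open>Moving by one position costs one level. The second word is long enough because a walk
  that leaves the word shows the letter \<open>None\<close>.\<close>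

lemma ltype_forward:
  "ltype A (N + i) w (Some x) = ltype A (N + i) w' (Some x') \<Longrightarrow> x + i < length w \<Longrightarrow> x' < length w' \<Longrightarrow>
    x' + i < length w' \<and> ltype A N w (Some (x + i)) = ltype A N w' (Some (x' + i))"
proof (induction i arbitrary: x x')
  case (Suc i)
  have "ltype A (Suc (N + i)) w (Some x) = ltype A (Suc (N + i)) w' (Some x')"
    using Suc.prems(1) unfolding add_Suc_right .
  then have t: "ltype A (N + i) w (lstep w True None (Some x)) = ltype A (N + i) w' (lstep w' True None (Some x'))"
    by (rule ltype_step) (simp add: steps_def)
  have s: "lstep w True None (Some x) = Some (Suc x)"
    using Suc.prems(2) by (intro step_Suc) (auto simp: has_letter_None)
  have "letter w' (lstep w' True None (Some x')) \<noteq> None"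
    using ltype_letter[OF t, symmetric] Suc.prems(2) unfolding s by simp
  then obtain u where "lstep w' True None (Some x') = Some u"
    by (cases "lstep w' True None (Some x')") auto
  then have x': "Suc x' < length w'" unfolding step_Some by (auto simp: ltd_def)
  then have s': "lstep w' True None (Some x') = Some (Suc x')"
    by (intro step_Suc) (auto simp: has_letter_None)
  have "Suc x' + i < length w' \<and> ltype A N w (Some (Suc x + i)) = ltype A N w' (Some (Suc x' + i))"
    by (rule Suc.IH[OF t[unfolded s s']]) (use Suc.prems(2) x' in simp_all)
  then show ?case by simp
qed simp

lemma ltype_forward_letter:
  assumes "ltype A N w (Some x) = ltype A N w' (Some x')" "i \<le> N" "x + i < length w" "x' < length w'"
  shows "x' + i < length w' \<and> w' ! (x' + i) = w ! (x + i)"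
proof -
  have "ltype A (0 + i) w (Some x) = ltype A (0 + i) w' (Some x')"
    by (rule ltype_mono[OF assms(1)]) (use assms in simp)
  then have "x' + i < length w' \<and> ltype A 0 w (Some (x + i)) = ltype A 0 w' (Some (x' + i))"
    by (rule ltype_forward) (use assms in simp_all)
  with ltype_letter[of A 0 w "Some (x + i)" w' "Some (x' + i)"] assms show ?thesis by simp
qed

text \<open>A search to the right that fails is placed just past the end: a step to the left from
  \<open>None\<close> then reaches the last position, as \<open>step_back\<close> requires.\<close>

definition pos :: "'a list \<Rightarrow> nat option \<Rightarrow> nat" where
  "pos w p = (case p of None \<Rightarrow> length w | Some i \<Rightarrow> i)"

text \<open>For \<open>i = 0\<close> a failed search has to remain \<open>None\<close>, since its
  \<open>pos\<close> is not a position of the word.\<close>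

definition go_back :: "'a list \<Rightarrow> nat option \<Rightarrow> nat \<Rightarrow> nat option" where
  "go_back w p i = (if i = 0 then p else Some (pos w p - i))"

lemma pos_Some [simp]: "pos w (Some i) = i"
  by (simp add: pos_def)

lemma step_back:
  assumes "0 < pos w p" "pos w p \<le> length w"
  shows "lstep w False None p = Some (pos w p - 1)"
  using assms unfolding step_Some by (cases p) (auto simp: pos_def ltd_def has_letter_None)

lemma ltype_back:
  "ltype A (N + i) w p = ltype A (N + i) w' p' \<Longrightarrow> i \<le> pos w p \<Longrightarrow> i \<le> pos w' p' \<Longrightarrow>
    pos w p \<le> length w \<Longrightarrow> pos w' p' \<le> length w' \<Longrightarrow>
    ltype A N w (go_back w p i) = ltype A N w' (go_back w' p' i)"
proof (induction i arbitrary: p p')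
  case 0
  then show ?case by (simp add: go_back_def)
next
  case (Suc i)
  have "(False, None) \<in> steps A" by (simp add: steps_def)
  then have "ltype A (N + i) w (lstep w False None p) = ltype A (N + i) w' (lstep w' False None p')"
    using Suc.prems(1) by (intro ltype_step) simp_all
  then have "ltype A (N + i) w (Some (pos w p - 1)) = ltype A (N + i) w' (Some (pos w' p' - 1))"
    using step_back[of w p] step_back[of w' p'] Suc.prems by simp
  moreover have "go_back u (Some (pos u q - 1)) i = go_back u q (Suc i)" for u :: "'a list" and q
    by (simp add: go_back_def)
  ultimately show ?case using Suc.IH[of "Some (pos w p - 1)" "Some (pos w' p' - 1)"] Suc.prems by simp
qed

text \<open>From a position at depth \<open>N\<close> in a block of \<open>a\<close>, a walk of at
  most \<open>N\<close> steps stays in the block until its first step to \<open>b\<close>. Such a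
  step lands at the same place from everywhere in the block, so the types of the nearest
  \<open>b\<close> on either side determine everything.\<close>

lemma ltype_deep:
  assumes "a \<noteq> b" "A = {a, b}"
  shows "N \<le> y \<Longrightarrow> N \<le> y' \<Longrightarrow>
    (\<And>i. y \<le> i + N \<Longrightarrow> i \<le> y + N \<Longrightarrow> i < length w \<and> w ! i = a) \<Longrightarrow>
    (\<And>i. y' \<le> i + N \<Longrightarrow> i \<le> y' + N \<Longrightarrow> i < length w' \<and> w' ! i = a) \<Longrightarrow>
    ltype A N w (lstep w True (Some b) (Some y)) = ltype A N w' (lstep w' True (Some b) (Some y')) \<Longrightarrow>
    ltype A N w (lstep w False (Some b) (Some y)) = ltype A N w' (lstep w' False (Some b) (Some y')) \<Longrightarrow>
    ltype A N w (Some y) = ltype A N w' (Some y')"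
proof (induction N arbitrary: y y')
  case 0
  then show ?case by (simp add: ltype_eq_iff)
next
  case (Suc N)
  have a: "i < length w" "w ! i = a" if "y \<le> i + Suc N" "i \<le> y + Suc N" for i
    using Suc.prems(3)[of i] that by auto
  have a': "i < length w'" "w' ! i = a" if "y' \<le> i + Suc N" "i \<le> y' + Suc N" for i
    using Suc.prems(4)[of i] that by auto
  have ends: "ltype A N w (lstep w d (Some b) (Some y)) = ltype A N w' (lstep w' d (Some b) (Some y'))" for d
    using ltype_mono[OF Suc.prems(5), of N] ltype_mono[OF Suc.prems(6), of N] by (cases d) simp_all
  have stay: "lstep u d (Some b) (Some i) = lstep u d (Some b) (Some j)"
    if "u ! i \<noteq> b" "u ! j \<noteq> b" "i = Suc j \<or> j = Suc i" for u :: "'a list" and d i j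
  proof (rule step_cong)
    fix z assume "has_letter u (Some b) z"
    then have "z \<noteq> i" "z \<noteq> j" using that by (auto simp: has_letter_Some)
    then show "after d (Some i) z = after d (Some j) z" using that(3) by (auto simp: ltd_def)
  qed
  have fwd: "ltype A N w (Some (Suc y)) = ltype A N w' (Some (Suc y'))"
  proof (rule Suc.IH)
    show "ltype A N w (lstep w True (Some b) (Some (Suc y))) =
      ltype A N w' (lstep w' True (Some b) (Some (Suc y')))"
      "ltype A N w (lstep w False (Some b) (Some (Suc y))) =
      ltype A N w' (lstep w' False (Some b) (Some (Suc y')))"
      using stay[of w "Suc y" y] stay[of w' "Suc y'" y'] a[of y] a[of "Suc y"] a'[of y'] a'[of "Suc y'"]
        ends assms(1) by simp_all
    show "N \<le> Suc y" "N \<le> Suc y'" using Suc.prems(1,2) by simp_all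
    show "i < length w \<and> w ! i = a" if "Suc y \<le> i + N" "i \<le> Suc y + N" for i
      using a[of i] that by simp
    show "i < length w' \<and> w' ! i = a" if "Suc y' \<le> i + N" "i \<le> Suc y' + N" for i
      using a'[of i] that by simp
  qed
  obtain z z' where z: "y = Suc z" "y' = Suc z'" using Suc.prems(1,2) by (cases y; cases y') auto
  have bwd: "ltype A N w (Some z) = ltype A N w' (Some z')"
  proof (rule Suc.IH)
    show "ltype A N w (lstep w True (Some b) (Some z)) =
      ltype A N w' (lstep w' True (Some b) (Some z'))"
      "ltype A N w (lstep w False (Some b) (Some z)) =
      ltype A N w' (lstep w' False (Some b) (Some z'))"
      using stay[of w y z] stay[of w' y' z'] a[of y] a[of z] a'[of y'] a'[of z'] ends assms(1) z
      by simp_all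
    show "N \<le> z" "N \<le> z'" using Suc.prems(1,2) z by simp_all
    show "i < length w \<and> w ! i = a" if "z \<le> i + N" "i \<le> z + N" for i
      using a[of i] that z by simp
    show "i < length w' \<and> w' ! i = a" if "z' \<le> i + N" "i \<le> z' + N" for i
      using a'[of i] that z by simp
  qed
  show ?case
  proof (rule ltype_SucI)
    show "letter w (Some y) = letter w' (Some y')" using a[of y] a'[of y'] by simp
    fix d c assume "(d, c) \<in> steps A"
    then consider "c = Some b" | "c \<noteq> Some b" "c = None \<or> c = Some a"
      by (auto simp: steps_def assms)
    then show "ltype A N w (lstep w d c (Some y)) = ltype A N w' (lstep w' d c (Some y'))"
    proof cases
      case 1
      then show ?thesis using ends by simp
    next
      case 2
      have p: "has_letter w c i" if "y \<le> i + Suc N" "i \<le> y + Suc N" for i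
        using a[OF that] 2 by (auto simp: has_letter_def)
      have p': "has_letter w' c i" if "y' \<le> i + Suc N" "i \<le> y' + Suc N" for i
        using a'[OF that] 2 by (auto simp: has_letter_def)
      show ?thesis
      proof (cases d)
        case True
        have "lstep w True c (Some y) = Some (Suc y)" "lstep w' True c (Some y') = Some (Suc y')"
          using p[of "Suc y"] p'[of "Suc y'"] a[of "Suc y"] a'[of "Suc y'"] by (intro step_Suc; simp)+
        then show ?thesis using fwd True by simp
      next
        case False
        have "lstep w False c (Some y) = Some z" "lstep w' False c (Some y') = Some z'"
          unfolding z using p[of z] p'[of z'] a[of z] a'[of z'] z by (intro step_pred; simp)+
        then show ?thesis using bwd False by simp
      qed
    qed
  qed
qed

text \<open>As only \<open>a\<close> occurs in between, \<open>y\<close> is at most the next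
  \<open>b\<close> after \<open>x\<close>. If \<open>y\<close> is near \<open>x\<close>, the
  distance to \<open>x\<close> is copied; if it is near that \<open>b\<close> (or the end of the
  word), the distance to it is copied; otherwise any position deep inside the block will do. The
  last conjunct of the conclusion records whether the open interval is empty.\<close>

lemma forward_move:
  assumes "a \<noteq> b" "A = {a, b}" "w \<in> lists A" "w' \<in> lists A"
    and x: "x < length w" "x' < length w'"
    and t: "ltype A (2 * N + 3) w (Some x) = ltype A (2 * N + 3) w' (Some x')"
    and y: "x < y" "y < length w" and between: "\<And>z. x < z \<Longrightarrow> z < y \<Longrightarrow> w ! z = a"
  shows "\<exists>y'. x' < y' \<and> y' < length w' \<and> ltype A N w (Some y) = ltype A N w' (Some y') \<and>
    (\<forall>z. x' < z \<longrightarrow> z < y' \<longrightarrow> w' ! z = a) \<and> (y = Suc x \<longleftrightarrow> y' = Suc x')"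
proof -
  have ab: "u ! z = a" if "u \<in> lists A" "z < length u" "u ! z \<noteq> b" for u z
  proof -
    have "u ! z \<in> A" using that by (simp add: in_listsD[OF that(1)])
    then show ?thesis using that assms by auto
  qed
  have nxt: "x' + i < length w' \<and> w' ! (x' + i) = w ! (x + i)" if "i \<le> 2 * N + 3" "x + i < length w" for i
    using ltype_forward_letter[OF t that x(2)] .
  define p p' where "p = lstep w True (Some b) (Some x)" and "p' = lstep w' True (Some b) (Some x')"
  have "(True, Some b) \<in> steps A" "(False, Some b) \<in> steps A" by (simp_all add: steps_def assms)
  moreover have t': "ltype A (Suc (2 * N + 2)) w (Some x) = ltype A (Suc (2 * N + 2)) w' (Some x')"
    using t by (simp add: numeral_3_eq_3)
  ultimately have tp: "ltype A (2 * N + 2) w p = ltype A (2 * N + 2) w' p'"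
    and tq: "ltype A (2 * N + 2) w (lstep w False (Some b) (Some x)) =
      ltype A (2 * N + 2) w' (lstep w' False (Some b) (Some x'))"
    unfolding p_def p'_def by (blast intro: ltype_step)+
  have pos: "i < pos u q \<and> pos u q \<le> length u \<and> (\<forall>z. i < z \<longrightarrow> z < pos u q \<longrightarrow> u ! z \<noteq> b) \<and>
      (pos u q < length u \<longrightarrow> u ! pos u q = b \<and> q = Some (pos u q))"
    if "q = lstep u True (Some b) (Some i)" "i < length u" for u :: "'a list" and q i
  proof (cases q)
    case None
    with that(1) have "lstep u True (Some b) (Some i) = None" by simp
    then show ?thesis using that(2) None unfolding step_None by (auto simp: pos_def ltd_def has_letter_Some)
  next
    case (Some j)
    with that(1) have "lstep u True (Some b) (Some i) = Some j" by simp
    then show ?thesis using that(2) Some unfolding step_Some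
      by (auto simp: pos_def ltd_def has_letter_Some) (meson order.strict_trans)
  qed
  note P = pos[OF p_def x(1)] and P' = pos[OF p'_def x(2)]
  have yp: "y \<le> pos w p"
  proof (rule ccontr)
    assume "\<not> y \<le> pos w p"
    then have "w ! pos w p = a" "w ! pos w p = b" using P between[of "pos w p"] y by auto
    then show False using assms(1) by simp
  qed
  show ?thesis
  proof (cases "y \<le> x + N + 1")
    case True
    define i where "i = y - x"
    have i: "y = x + i" "i \<le> N + 1" using True y by (auto simp: i_def)
    have "ltype A (N + i) w (Some x) = ltype A (N + i) w' (Some x')"
      by (rule ltype_mono[OF t]) (use i in simp)
    then have "x' + i < length w' \<and> ltype A N w (Some (x + i)) = ltype A N w' (Some (x' + i))"
      by (rule ltype_forward) (use x y i in simp_all)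
    moreover have "w' ! z = a" if "x' < z" "z < x' + i" for z
    proof -
      obtain j where "z = x' + j" using \<open>x' < z\<close> less_imp_add_positive by blast
      then show ?thesis using nxt[of j] between[of "x + j"] i y that by simp
    qed
    ultimately show ?thesis using i y by (intro exI[of _ "x' + i"]) auto
  next
    case far: False
    \<comment> \<open>A \<open>b\<close> or the end of the word this close to \<open>x'\<close>
      would be seen by the type of \<open>x'\<close>. After \<open>x\<close>, however, there are
      only letters \<open>a\<close> up to this distance.\<close>
    have P'_far: "x' + N + 1 < pos w' p'"
    proof (rule ccontr)
      assume *: "\<not> x' + N + 1 < pos w' p'"
      then obtain j where j: "pos w' p' = x' + j" "j \<le> N + 1" "0 < j"
        using P' less_imp_add_positive by (metis add.assoc add_le_cancel_left not_less)
      then have "x' + j < length w'" "w' ! (x' + j) = a"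
        using nxt[of j] between[of "x + j"] far y by auto
      then show False using P' j assms(1) by auto
    qed
    have letters': "w' ! z = a" if "x' < z" "z < pos w' p'" for z
      using P' that by (intro ab assms) auto
    show ?thesis
    proof (cases "pos w p \<le> y + N")
      case True
      define i where "i = pos w p - y"
      have i: "y = pos w p - i" "i \<le> N" "i \<le> pos w p" using True yp by (auto simp: i_def)
      have "ltype A (N + i) w p = ltype A (N + i) w' p'"
        by (rule ltype_mono[OF tp]) (use i in simp)
      then have tb: "ltype A N w (go_back w p i) = ltype A N w' (go_back w' p' i)"
        by (rule ltype_back) (use i P P' P'_far in auto)
      have "go_back w p i = Some y"
        using i y P by (auto simp: go_back_def)
      moreover from this have "go_back w' p' i = Some (pos w' p' - i)"
        using ltype_letter[OF tb] y by (cases p') (auto simp: go_back_def pos_def split: if_splits)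
      moreover have "pos w' p' - i < length w'"
        using ltype_letter[OF tb] y calculation by (auto simp: letter_def split: if_splits)
      ultimately show ?thesis using tb letters' P'_far i far
        by (intro exI[of _ "pos w' p' - i"]) auto
    next
      case deep: False
      have block: "x + j < length w \<and> w ! (x + j) = a" if "0 < j" "j \<le> 2 * N + 2" for j
        using P deep far that by (intro conjI ab assms) auto
      have block': "x' + j < length w' \<and> w' ! (x' + j) = a" if "0 < j" "j \<le> 2 * N + 2" for j
        using nxt[of j] block[OF that] that by auto
      have blockP: "i < length w \<and> w ! i = a" if "x < i" "i < pos w p" for i
        using P that by (intro conjI ab assms) auto
      have block'': "i < length w' \<and> w' ! i = a" if "x' < i" "i \<le> x' + (2 * N + 2)" for i
        using block'[of "i - x'"] that by auto
      \<comment> \<open>The positions \<open>x' + 1\<close> to \<open>x' + 2 * N + 2\<close> carry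
        \<open>a\<close>. This one has \<open>N\<close> of them on either side and, even for
        \<open>N = 0\<close>, is not adjacent to \<open>x'\<close>.\<close>
      let ?y' = "x' + N + 2"
      have fw: "lstep u True (Some b) (Some j) = lstep u True (Some b) (Some i)"
        if "i < j" "\<And>z. i < z \<Longrightarrow> z \<le> j \<Longrightarrow> u ! z = a" for u :: "'a list" and i j
      proof (rule step_cong)
        fix z assume "has_letter u (Some b) z"
        then have "\<not> (i < z \<and> z \<le> j)" using that assms(1) by (auto simp: has_letter_Some)
        then show "after True (Some j) z = after True (Some i) z" using that(1) by (auto simp: ltd_def)
      qed
      \<comment> \<open>Searching to the left from inside the block, the first candidate for
        \<open>b\<close> is the position where the block is bounded, that is \<open>x\<close>
        itself.\<close>
      have bw: "lstep u False (Some b) (Some j) =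
          (if u ! i = b then Some i else lstep u False (Some b) (Some i))"
        if "i < j" "i < length u" "\<And>z. i < z \<Longrightarrow> z < j \<Longrightarrow> u ! z = a" for u :: "'a list" and i j
      proof (cases "u ! i = b")
        case True
        have "\<not> ltd False z i" if "has_letter u (Some b) z" "ltd False j z" for z
        proof
          assume "ltd False z i"
          then have "i < z" "z < j" using \<open>ltd False j z\<close> by (auto simp: ltd_def)
          then show False using \<open>has_letter u (Some b) z\<close> \<open>\<And>z. i < z \<Longrightarrow> z < j \<Longrightarrow> u ! z = a\<close> assms(1)
            by (auto simp: has_letter_Some)
        qed
        then have "lstep u False (Some b) (Some j) = Some i"
          using True that(1,2) by (auto simp: step_Some has_letter_Some ltd_def[of False j i])
        then show ?thesis using True by simp
      next
        case False
        have "lstep u False (Some b) (Some j) = lstep u False (Some b) (Some i)"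
        proof (rule step_cong)
          fix z assume "has_letter u (Some b) z"
          then have "\<not> (i \<le> z \<and> z < j)" using that assms(1) False
            by (cases "z = i") (auto simp: has_letter_Some)
          then show "after False (Some j) z = after False (Some i) z" using that(1) by (auto simp: ltd_def)
        qed
        then show ?thesis using False by simp
      qed
      have x_letter: "w ! x = w' ! x'" using ltype_letter[OF t] x by simp
      have "ltype A N w (Some y) = ltype A N w' (Some ?y')"
      proof (rule ltype_deep[OF assms(1,2)])
        show "N \<le> y" "N \<le> ?y'" using far by auto
        show "i < length w \<and> w ! i = a" if "y \<le> i + N" "i \<le> y + N" for i
          using that far deep by (intro blockP) auto
        show "i < length w' \<and> w' ! i = a" if "?y' \<le> i + N" "i \<le> ?y' + N" for i
          using that by (intro block'') auto
        have "lstep w True (Some b) (Some y) = p" unfolding p_def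
          by (rule fw) (use y deep blockP in auto)
        moreover have "lstep w' True (Some b) (Some ?y') = p'" unfolding p'_def
          by (rule fw) (use block'' in auto)
        ultimately show "ltype A N w (lstep w True (Some b) (Some y)) =
          ltype A N w' (lstep w' True (Some b) (Some ?y'))"
          using ltype_mono[OF tp, of N] by simp
        have "lstep w False (Some b) (Some y) = (if w ! x = b then Some x else lstep w False (Some b) (Some x))"
          by (rule bw) (use x y between in auto)
        moreover have "lstep w' False (Some b) (Some ?y') =
          (if w' ! x' = b then Some x' else lstep w' False (Some b) (Some x'))"
          by (rule bw) (use x block'' in auto)
        ultimately show "ltype A N w (lstep w False (Some b) (Some y)) =
          ltype A N w' (lstep w' False (Some b) (Some ?y'))"
          using ltype_mono[OF tq, of N] ltype_mono[OF t, of N] x_letter by simp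
      qed
      moreover have "?y' < length w'" using block''[of ?y'] by simp
      ultimately show ?thesis using block'' far by (intro exI[of _ ?y']) auto
    qed
  qed
qed

section \<open>Reversal of words\<close>

definition mirror :: "'a list \<Rightarrow> nat option \<Rightarrow> nat option" where
  "mirror w p = map_option (\<lambda>i. length w - Suc i) p"

definition valid :: "'a list \<Rightarrow> nat option \<Rightarrow> bool" where
  "valid w p = (\<forall>i. p = Some i \<longrightarrow> i < length w)"

lemma valid_step: "valid w (step (length w) d P p)"
  by (auto simp: valid_def step_Some)

lemma ltd_mirror: "x < n \<Longrightarrow> y < n \<Longrightarrow> ltd (\<not> d) (n - Suc x) (n - Suc y) = ltd d x y"
  by (auto simp: ltd_def)

lemma has_letter_mirror: "i < length w \<Longrightarrow> has_letter (rev w) c (length w - Suc i) = has_letter w c i"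
  by (auto simp: has_letter_def rev_nth)

lemma letter_mirror: "valid w p \<Longrightarrow> letter (rev w) (mirror w p) = letter w p"
  by (cases p) (auto simp: mirror_def valid_def rev_nth)

lemma step_mirror:
  assumes "valid w p"
  shows "lstep (rev w) (\<not> d) c (mirror w p) = mirror w (lstep w d c p)"
proof -
  let ?n = "length w"
  have after: "after (\<not> d) (mirror w p) (?n - Suc z) = after d p z" if "z < ?n" for z
    using assms that by (cases p) (auto simp: mirror_def valid_def ltd_mirror)
  have rep: "\<exists>z<?n. u = ?n - Suc z" if "u < ?n" for u
    using that by (intro exI[of _ "?n - Suc u"]) auto
  show ?thesis
  proof (cases "lstep w d c p")
    case None
    have "lstep (rev w) (\<not> d) c (mirror w p) = None"
      unfolding step_None
    proof (intro allI impI)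
      fix u assume u: "u < length (rev w)" "has_letter (rev w) c u"
      then obtain z where z: "z < ?n" "u = ?n - Suc z" using rep[of u] by auto
      then show "\<not> after (\<not> d) (mirror w p) u"
        using None[unfolded step_None] u after[OF z(1)] has_letter_mirror[OF z(1), of c] by auto
    qed
    with None show ?thesis by (simp add: mirror_def)
  next
    case (Some y)
    note S = Some[unfolded step_Some]
    have "lstep (rev w) (\<not> d) c (mirror w p) = Some (?n - Suc y)"
      unfolding step_Some
    proof (intro conjI allI impI)
      show "?n - Suc y < length (rev w)" using S by auto
      show "has_letter (rev w) c (?n - Suc y)" using S has_letter_mirror by blast
      show "after (\<not> d) (mirror w p) (?n - Suc y)" using S after by blast
      fix u assume u: "u < length (rev w)" "has_letter (rev w) c u" "after (\<not> d) (mirror w p) u"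
      then obtain z where z: "z < ?n" "u = ?n - Suc z" using rep[of u] by auto
      then have "\<not> ltd d z y"
        using S u after[OF z(1)] has_letter_mirror[OF z(1), of c] by auto
      then show "\<not> ltd (\<not> d) u (?n - Suc y)" using z S ltd_mirror by metis
    qed
    with Some show ?thesis by (simp add: mirror_def)
  qed
qed

lemma run_mirror:
  "valid w p \<Longrightarrow> run (length (rev w)) (has_letter (rev w)) (map (apfst Not) g) (mirror w p) =
    mirror w (run (length w) (has_letter w) g p) \<and> valid w (run (length w) (has_letter w) g p)"
proof (induction g arbitrary: p)
  case (Cons st g)
  obtain d c where st: "st = (d, c)" by (cases st)
  show ?case using Cons.IH[OF valid_step] step_mirror[OF Cons.prems] by (simp add: st)
qed simp

lemma ltype_mirror:
  assumes "valid w p" "valid w' p'" "ltype A N w p = ltype A N w' p'"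
  shows "ltype A N (rev w) (mirror w p) = ltype A N (rev w') (mirror w' p')"
  unfolding ltype_eq_iff
proof (intro allI impI)
  fix g :: "(bool \<times> 'a option) list" assume g: "length g \<le> N" "set g \<subseteq> steps A"
  let ?g = "map (apfst Not) g"
  have "length ?g \<le> N" "set ?g \<subseteq> steps A" using g by (auto simp: steps_def)
  then have *: "letter w (run (length w) (has_letter w) ?g p) = letter w' (run (length w') (has_letter w') ?g p')"
    using assms(3)[unfolded ltype_eq_iff] by blast
  have g2: "map (apfst Not) ?g = g" by (induction g) auto
  show "letter (rev w) (run (length (rev w)) (has_letter (rev w)) g (mirror w p)) =
    letter (rev w') (run (length (rev w')) (has_letter (rev w')) g (mirror w' p'))"
    using * run_mirror[OF assms(1), of ?g] run_mirror[OF assms(2), of ?g] unfolding g2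
    by (simp add: letter_mirror)
qed

definition between :: "'a list \<Rightarrow> bool \<Rightarrow> 'a \<Rightarrow> nat \<Rightarrow> nat \<Rightarrow> bool" where
  "between w d c x y = (\<exists>z<length w. ltd d x z \<and> ltd d z y \<and> w ! z = c)"

lemma between_mirror:
  assumes "x < length w" "y < length w"
  shows "between (rev w) (\<not> d) c (length w - Suc x) (length w - Suc y) = between w d c x y"
proof -
  let ?n = "length w"
  have "between (rev w) (\<not> d) c (?n - Suc x) (?n - Suc y) \<longleftrightarrow>
    (\<exists>z<?n. ltd (\<not> d) (?n - Suc x) (?n - Suc z) \<and> ltd (\<not> d) (?n - Suc z) (?n - Suc y) \<and> w ! z = c)"
  proof
    assume "between (rev w) (\<not> d) c (?n - Suc x) (?n - Suc y)"
    then obtain z where z: "z < ?n" "ltd (\<not> d) (?n - Suc x) z" "ltd (\<not> d) z (?n - Suc y)" "rev w ! z = c"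
      by (auto simp: between_def)
    then have "?n - Suc (?n - Suc z) = z" by simp
    with z show "\<exists>z<?n. ltd (\<not> d) (?n - Suc x) (?n - Suc z) \<and> ltd (\<not> d) (?n - Suc z) (?n - Suc y) \<and> w ! z = c"
      by (intro exI[of _ "?n - Suc z"]) (auto simp: rev_nth)
  next
    assume "\<exists>z<?n. ltd (\<not> d) (?n - Suc x) (?n - Suc z) \<and> ltd (\<not> d) (?n - Suc z) (?n - Suc y) \<and> w ! z = c"
    then obtain z where z: "z < ?n" "ltd (\<not> d) (?n - Suc x) (?n - Suc z)"
      "ltd (\<not> d) (?n - Suc z) (?n - Suc y)" "w ! z = c" by blast
    then show "between (rev w) (\<not> d) c (?n - Suc x) (?n - Suc y)"
      unfolding between_def by (intro exI[of _ "?n - Suc z"]) (auto simp: rev_nth)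
  qed
  also have "\<dots> \<longleftrightarrow> between w d c x y"
    unfolding between_def using assms ltd_mirror by (metis (no_types, lifting))
  finally show ?thesis .
qed

text \<open>Reversing both words reduces moves to the left to moves to the right. As all letters in
  between are \<open>a\<close>, betweenness of \<open>a\<close> means that the two positions are not
  adjacent, and \<open>forward_move\<close> preserves this.\<close>

lemma local_move:
  assumes A: "a \<noteq> b" "A = {a, b}" "w \<in> lists A" "w' \<in> lists A"
    and x: "x < length w" "x' < length w'"
    and t: "ltype A (2 * N + 3) w (Some x) = ltype A (2 * N + 3) w' (Some x')"
    and y: "ltd d x y" "y < length w" and "\<not> between w d b x y"
  shows "\<exists>y'<length w'. ltd d x' y' \<and> ltype A N w (Some y) = ltype A N w' (Some y') \<and>
    (\<forall>c\<in>A. between w d c x y = between w' d c x' y')"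
proof -
  have main: "\<exists>y'<length w'. ltd True x' y' \<and> ltype A N w (Some y) = ltype A N w' (Some y') \<and>
    (\<forall>c\<in>A. between w True c x y = between w' True c x' y')"
    if A': "w \<in> lists A" "w' \<in> lists A" and x: "x < length w" "x' < length w'"
    and t: "ltype A (2 * N + 3) w (Some x) = ltype A (2 * N + 3) w' (Some x')"
    and y: "ltd True x y" "y < length w" and nb: "\<not> between w True b x y" for w w' :: "'a list" and x x' y
  proof -
    have letters: "w ! z = a" if "x < z" "z < y" for z
    proof -
      have z: "z < length w" using that(2) y(2) by simp
      then have "w ! z \<noteq> b" using that nb by (auto simp: between_def ltd_def)
      moreover have "w ! z \<in> A" using z in_listsD[OF A'(1)] by simp
      ultimately
      show ?thesis using A(2) by simp
    qed
    have "x < y" using y by (simp add: ltd_def)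
    from forward_move[OF A(1,2) A' x t this y(2) letters] obtain y' where y': "x' < y'" "y' < length w'"
      "ltype A N w (Some y) = ltype A N w' (Some y')" "\<And>z. x' < z \<Longrightarrow> z < y' \<Longrightarrow> w' ! z = a"
      "y = Suc x \<longleftrightarrow> y' = Suc x'" by blast
    have "between w True a x y \<longleftrightarrow> y \<noteq> Suc x"
    proof
      show "y \<noteq> Suc x" if "between w True a x y" using that by (auto simp: between_def ltd_def)
      assume "y \<noteq> Suc x"
      then show "between w True a x y" unfolding between_def
        using letters[of "Suc x"] \<open>x < y\<close> y(2) by (intro exI[of _ "Suc x"]) (auto simp: ltd_def)
    qed
    moreover have "between w' True a x' y' \<longleftrightarrow> y' \<noteq> Suc x'"
    proof
      show "y' \<noteq> Suc x'" if "between w' True a x' y'" using that by (auto simp: between_def ltd_def)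
      assume "y' \<noteq> Suc x'"
      then show "between w' True a x' y'" unfolding between_def
        using y'(1,2) y'(4)[of "Suc x'"] by (intro exI[of _ "Suc x'"]) (auto simp: ltd_def)
    qed
    moreover have "\<not> between w' True b x' y'" using y'(4) A(1) by (auto simp: between_def ltd_def)
    ultimately have "\<forall>c\<in>A. between w True c x y = between w' True c x' y'"
      using nb y'(5) unfolding A(2) by simp
    then show ?thesis using y'(1-3) by (intro exI[of _ y']) (simp add: ltd_def)
  qed
  show ?thesis
  proof (cases d)
    case True
    then show ?thesis using main[OF A(3,4) x t, of y] y assms(10) by simp
  next
    case False
    let ?m = "\<lambda>w i. length w - Suc i"
    have "\<exists>y'<length (rev w'). ltd True (?m w' x') y' \<and>
      ltype A N (rev w) (Some (?m w y)) = ltype A N (rev w') (Some y') \<and>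
      (\<forall>c\<in>A. between (rev w) True c (?m w x) (?m w y) = between (rev w') True c (?m w' x') y')"
    proof (rule main)
      show "rev w \<in> lists A" "rev w' \<in> lists A" using A(3,4) by (auto simp: in_lists_conv_set)
      show "ltype A (2 * N + 3) (rev w) (Some (?m w x)) = ltype A (2 * N + 3) (rev w') (Some (?m w' x'))"
        using ltype_mirror[OF _ _ t] x by (simp add: mirror_def valid_def)
      show "ltd True (?m w x) (?m w y)" using ltd_mirror[OF x(1) y(2), of False] y(1) False by simp
      show "\<not> between (rev w) True b (?m w x) (?m w y)"
        using between_mirror[OF x(1) y(2), of False b] assms(10) False by simp
      show "?m w x < length (rev w)" "?m w' x' < length (rev w')" "?m w y < length (rev w)"
        using x y(2) by simp_all
    qed
    then obtain u where u: "u < length w'" "ltd True (?m w' x') u"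
      "ltype A N (rev w) (Some (?m w y)) = ltype A N (rev w') (Some u)"
      "\<forall>c\<in>A. between (rev w) True c (?m w x) (?m w y) = between (rev w') True c (?m w' x') u" by auto
    define y' where "y' = ?m w' u"
    have y': "y' < length w'" "u = ?m w' y'" using u by (auto simp: y'_def)
    have "ltd False x' y'" using u(2) ltd_mirror[OF x(2) y'(1), of False] unfolding y'(2)[symmetric] by simp
    moreover have "ltype A N w (Some y) = ltype A N w' (Some y')"
    proof -
      have "mirror (rev w) (Some (?m w y)) = Some y" using y(2) by (simp add: mirror_def)
      moreover have "mirror (rev w') (Some u) = Some y'" by (simp add: mirror_def y'_def)
      moreover have "valid (rev w) (Some (?m w y))" "valid (rev w') (Some u)"
        using y(2) u(1) by (simp_all add: valid_def)
      ultimately show ?thesis using ltype_mirror[OF _ _ u(3)] by simp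
    qed
    moreover have "between w False c x y = between w' False c x' y'" if "c \<in> A" for c
      using u(4) that between_mirror[OF x(1) y(2), of False c] between_mirror[OF x(2) y'(1), of False c]
      unfolding y'(2)[symmetric] by simp
    moreover have "d = False" using False by simp
    ultimately show ?thesis using y'(1) by blast
  qed
qed

section \<open>Rankers\<close>

text \<open>A finite set that contains all types over \<open>A\<close>, in the shape expected by
  \<open>finite_set_of_finite_funs\<close>. Not every member has to be the type of a
  position.\<close>

definition ltypes :: "'a set \<Rightarrow> nat \<Rightarrow> ((bool \<times> 'a option) list \<Rightarrow> 'a option) set" where
  "ltypes A K = {f. (\<forall>g. (g \<in> {g. set g \<subseteq> steps A \<and> length g \<le> K} \<longrightarrow> f g \<in> insert None (Some ` A)) \<and>
     (g \<notin> {g. set g \<subseteq> steps A \<and> length g \<le> K} \<longrightarrow> f g = None))}"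

lemma finite_steps: "finite A \<Longrightarrow> finite (steps A)"
  by (simp add: steps_def)

lemma finite_ltypes: "finite A \<Longrightarrow> finite (ltypes A K)"
  unfolding ltypes_def by (intro finite_set_of_finite_funs finite_lists_length_le finite_steps) auto

lemma ltype_in: "w \<in> lists A \<Longrightarrow> ltype A K w p \<in> ltypes A K"
  by (auto simp: ltypes_def ltype_def letter_def in_listsD split: option.splits)

text \<open>Steps to a type find candidates for the duplicator's answer; steps to a letter test
  betweenness.\<close>

type_synonym 'a label = "'a option + ((bool \<times> 'a option) list \<Rightarrow> 'a option)"

fun label_sat :: "'a set \<Rightarrow> nat \<Rightarrow> 'a list \<Rightarrow> 'a label \<Rightarrow> nat \<Rightarrow> bool" where
  "label_sat A K w (Inl c) i = has_letter w c i"
| "label_sat A K w (Inr \<tau>) i = (i < length w \<and> ltype A K w (Some i) = \<tau>)"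

definition ranker :: "'a set \<Rightarrow> nat \<Rightarrow> 'a list \<Rightarrow> (bool \<times> 'a label) list \<Rightarrow> nat option" where
  "ranker A K w r = run (length w) (label_sat A K w) r None"

definition rankers :: "'a set \<Rightarrow> nat \<Rightarrow> nat \<Rightarrow> (bool \<times> 'a label) list set" where
  "rankers A K m = {r. set r \<subseteq> UNIV \<times> (Inl ` insert None (Some ` A) \<union> Inr ` ltypes A K) \<and> length r \<le> m}"

lemma finite_rankers: "finite A \<Longrightarrow> finite (rankers A K m)"
  unfolding rankers_def by (intro finite_lists_length_le) (simp add: finite_ltypes)

lemma ranker_Nil [simp]: "ranker A K w [] = None"
  by (simp add: ranker_def)

lemma ranker_snoc: "ranker A K w (r @ [(d, l)]) = step (length w) d (label_sat A K w l) (ranker A K w r)"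
  by (simp add: ranker_def run_append)

lemma rankers_mono: "r \<in> rankers A K m \<Longrightarrow> m \<le> n \<Longrightarrow> r \<in> rankers A K n"
  by (auto simp: rankers_def)

lemma rankers_snoc: "r \<in> rankers A K m \<Longrightarrow> l \<in> Inl ` insert None (Some ` A) \<union> Inr ` ltypes A K \<Longrightarrow>
    r @ [(d, l)] \<in> rankers A K (Suc m)"
  by (auto simp: rankers_def)

lemma ranker_less: "ranker A K w r = Some q \<Longrightarrow> q < length w"
proof (induction r rule: rev_induct)
  case (snoc st r)
  then show ?case by (cases st) (auto simp: ranker_snoc step_Some)
qed simp

text \<open>It suffices to look at the \<open>c\<close> nearest to \<open>y\<close>. If
  \<open>y\<close> is the value of a ranker, this turns betweenness into a comparison of
  \<open>x\<close> with a ranker that is longer by one step.\<close>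

lemma between_step:
  assumes "y < length w"
  shows "between w d c x y \<longleftrightarrow> (\<exists>q. lstep w (\<not> d) (Some c) (Some y) = Some q \<and> ltd d x q)"
proof
  assume "between w d c x y"
  then obtain z where z: "z < length w" "ltd d x z" "ltd d z y" "w ! z = c" by (auto simp: between_def)
  then obtain q where q: "lstep w (\<not> d) (Some c) (Some y) = Some q"
    using step_None[of "length w" "\<not> d" "has_letter w (Some c)" "Some y"]
    by (cases "lstep w (\<not> d) (Some c) (Some y)") (auto simp: ltd_flip has_letter_Some)
  then have "\<not> ltd d q z" unfolding step_Some using z by (simp add: ltd_flip has_letter_Some)
  with z(2) q show "\<exists>q. lstep w (\<not> d) (Some c) (Some y) = Some q \<and> ltd d x q"
    using ltd_trans_le by blast
next
  assume "\<exists>q. lstep w (\<not> d) (Some c) (Some y) = Some q \<and> ltd d x q"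
  then obtain q where "lstep w (\<not> d) (Some c) (Some y) = Some q" "ltd d x q" by blast
  then show "between w d c x y"
    unfolding step_Some between_def by (intro exI[of _ q]) (auto simp: ltd_flip has_letter_Some)
qed

definition same_order :: "bool \<Rightarrow> nat option \<Rightarrow> nat option \<Rightarrow> nat option \<Rightarrow> nat option \<Rightarrow> bool" where
  "same_order d p q p' q' \<longleftrightarrow> ((p = None) = (p' = None)) \<and> ((q = None) = (q' = None)) \<and>
    (\<forall>i j i' j'. p = Some i \<longrightarrow> q = Some j \<longrightarrow> p' = Some i' \<longrightarrow> q' = Some j' \<longrightarrow> ltd d i j = ltd d i' j')"

section \<open>The duplicator's answer to one move\<close>

text \<open>For \<open>n\<close> rounds a pebble must be matched up to local types of level \<open>local_depth n\<close>.\<close>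

fun local_depth :: "nat \<Rightarrow> nat" where
  "local_depth 0 = 0"
| "local_depth (Suc n) = 2 * local_depth n + 3"

lemma local_depth_mono: "n \<le> m \<Longrightarrow> local_depth n \<le> local_depth m"
  by (rule lift_Suc_mono_le[of local_depth]) simp_all

text \<open>The level \<open>K\<close> of the types in ranker labels is fixed for the whole game, at
  the depth needed at its start; what shrinks from round to round is the length of the
  rankers.\<close>

locale word_pair =
  fixes A :: "'a set" and w w' :: "'a list" and K D :: nat
  assumes card_A: "card A = 2" and w: "w \<in> lists A" "w' \<in> lists A"
    and K: "K = local_depth D"
    and order: "\<And>r r' d. r \<in> rankers A K (2 * D) \<Longrightarrow> r' \<in> rankers A K (2 * D) \<Longrightarrow>
      same_order d (ranker A K w r) (ranker A K w r') (ranker A K w' r) (ranker A K w' r')"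
    and types: "\<And>r i i'. r \<in> rankers A K (2 * D) \<Longrightarrow> ranker A K w r = Some i \<Longrightarrow> ranker A K w' r = Some i' \<Longrightarrow>
      ltype A K w (Some i) = ltype A K w' (Some i')"
begin

lemma None_iff: "r \<in> rankers A K (2 * D) \<Longrightarrow> ranker A K w r = None \<longleftrightarrow> ranker A K w' r = None"
  using order[of r r] by (auto simp: same_order_def)

lemma ltd_iff:
  assumes "r \<in> rankers A K (2 * D)" "r' \<in> rankers A K (2 * D)"
    "ranker A K w r = Some i" "ranker A K w r' = Some j"
    "ranker A K w' r = Some i'" "ranker A K w' r' = Some j'"
  shows "ltd d i j = ltd d i' j'"
  using order[OF assms(1,2), of d] assms by (auto simp: same_order_def)

text \<open>The pebble is compared only with rankers of length at most \<open>2 * n\<close>, because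
  each later round uses up two steps.\<close>

definition matched :: "nat \<Rightarrow> nat \<Rightarrow> nat \<Rightarrow> bool" where
  "matched n x x' \<longleftrightarrow> x < length w \<and> x' < length w' \<and>
    ltype A (local_depth n) w (Some x) = ltype A (local_depth n) w' (Some x') \<and>
    (\<forall>r\<in>rankers A K (2 * n). \<forall>q q' d. ranker A K w r = Some q \<longrightarrow> ranker A K w' r = Some q' \<longrightarrow>
      ltd d x q = ltd d x' q')"

definition same_side :: "bool \<Rightarrow> nat \<Rightarrow> nat \<Rightarrow> nat \<Rightarrow> nat \<Rightarrow> bool" where
  "same_side d x y x' y' \<longleftrightarrow> ltd d x y = ltd d x' y' \<and>
    (\<forall>c\<in>A. between w d c x y = between w' d c x' y')"

lemma matched_mono:
  assumes "matched m x x'" "n \<le> m" shows "matched n x x'"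
  unfolding matched_def
proof (intro conjI ballI allI impI)
  show "ltype A (local_depth n) w (Some x) = ltype A (local_depth n) w' (Some x')"
    using assms by (auto simp: matched_def intro: ltype_mono local_depth_mono)
  fix r q q' d assume r: "r \<in> rankers A K (2 * n)" "ranker A K w r = Some q" "ranker A K w' r = Some q'"
  have "r \<in> rankers A K (2 * m)" by (rule rankers_mono[OF r(1)]) (use assms(2) in simp)
  then show "ltd d x q = ltd d x' q'" using assms(1) r unfolding matched_def by blast
qed (use assms(1) in \<open>simp_all add: matched_def\<close>)

text \<open>Appending a step to \<open>c\<close> brings the length to at most
  \<open>2 * Suc n\<close>, and with such rankers \<open>x\<close> can still be compared. By
  \<open>between_step\<close> this decides betweenness.\<close>

lemma matched_same_side:
  assumes m: "matched (Suc n) x x'" "Suc n \<le> D" and r: "r \<in> rankers A K (Suc (2 * n))"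
    and q: "ranker A K w r = Some q" "ranker A K w' r = Some q'"
  shows "same_side d x q x' q'"
  unfolding same_side_def
proof (intro conjI ballI)
  have r': "r \<in> rankers A K (2 * Suc n)" by (rule rankers_mono[OF r]) simp
  then show "ltd d x q = ltd d x' q'" using m q by (simp add: matched_def)
  fix c assume c: "c \<in> A"
  define s where "s = r @ [(\<not> d, Inl (Some c))]"
  have s: "s \<in> rankers A K (2 * Suc n)" using rankers_snoc[OF r, of "Inl (Some c)"] c by (simp add: s_def)
  have [simp]: "label_sat A K u (Inl (Some c)) = has_letter u (Some c)" for u by (rule ext) simp
  have eq: "ranker A K w s = lstep w (\<not> d) (Some c) (Some q)"
    "ranker A K w' s = lstep w' (\<not> d) (Some c) (Some q')"
    unfolding s_def ranker_snoc q by simp_all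
  have s': "s \<in> rankers A K (2 * D)" by (rule rankers_mono[OF s]) (use m(2) in simp)
  have "between w d c x q \<longleftrightarrow> (\<exists>u. ranker A K w s = Some u \<and> ltd d x u)"
    unfolding eq by (rule between_step) (rule ranker_less[OF q(1)])
  moreover have "between w' d c x' q' \<longleftrightarrow> (\<exists>u. ranker A K w' s = Some u \<and> ltd d x' u)"
    unfolding eq by (rule between_step) (rule ranker_less[OF q(2)])
  moreover have "ltd d x u = ltd d x' u'" if "ranker A K w s = Some u" "ranker A K w' s = Some u'" for u u'
    using m(1) s that unfolding matched_def by blast
  ultimately show "between w d c x q = between w' d c x' q'"
    using None_iff[OF s'] by (metis not_None_eq)
qed

text \<open>\<open>closest n d y r\<close>: among the rankers of length \<open>2 n\<close>, none is closer to \<open>y\<close>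
  on the \<open>d\<close>-smaller side than \<open>r\<close> (which is undefined if there is none at all).\<close>

definition closest :: "nat \<Rightarrow> bool \<Rightarrow> nat \<Rightarrow> (bool \<times> 'a label) list \<Rightarrow> bool" where
  "closest n d y r \<longleftrightarrow> r \<in> rankers A K (2 * n) \<and> (\<forall>l. ranker A K w r = Some l \<longrightarrow> ltd d l y) \<and>
    (\<forall>s\<in>rankers A K (2 * n). \<forall>q. ranker A K w s = Some q \<longrightarrow> ltd d q y \<longrightarrow>
      (\<exists>l. ranker A K w r = Some l \<and> \<not> ltd d l q))"

lemma closest_exists: "\<exists>r. closest n d y r"
proof -
  let ?S = "{q. \<exists>s\<in>rankers A K (2 * n). ranker A K w s = Some q \<and> ltd d q y}"
  show ?thesis
  proof (cases "?S = {}")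
    case True
    then show ?thesis by (intro exI[of _ "[]"]) (auto simp: closest_def rankers_def)
  next
    case False
    have "finite ?S" by (rule finite_subset[of _ "{..<length w}"]) (auto dest: ranker_less)
    from ltd_extremal[OF this False] obtain l where l: "l \<in> ?S" "\<forall>q\<in>?S. \<not> ltd d l q" by blast
    then obtain r where "r \<in> rankers A K (2 * n)" "ranker A K w r = Some l" by blast
    with l show ?thesis by (intro exI[of _ r]) (auto simp: closest_def)
  qed
qed

text \<open>Rankers before \<open>y\<close> lie at or before the closest one, and their order is the
  same in \<open>w'\<close>. So \<open>y'\<close> has to be compared with a single ranker on this
  side.\<close>

lemma closest_transfer:
  assumes r: "closest n d y r" "n \<le> D" and y': "\<And>l'. ranker A K w' r = Some l' \<Longrightarrow> ltd d l' y'"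
    and s: "s \<in> rankers A K (2 * n)" "ranker A K w s = Some q" "ranker A K w' s = Some q'" "ltd d q y"
  shows "ltd d q' y'"
proof -
  obtain l where l: "ranker A K w r = Some l" "\<not> ltd d l q"
    using r(1) s(1,2,4) unfolding closest_def by blast
  have rs: "r \<in> rankers A K (2 * D)" "s \<in> rankers A K (2 * D)"
    using r s rankers_mono[of _ A K "2 * n" "2 * D"] by (auto simp: closest_def)
  obtain l' where l': "ranker A K w' r = Some l'" using None_iff[OF rs(1)] l by auto
  have "\<not> ltd d l' q'" using ltd_iff[OF rs l(1) s(2) l' s(3)] l(2) by simp
  then show ?thesis using y'[OF l'] ltd_le_trans by blast
qed

lemma matchedI:
  assumes "n \<le> D" "closest n d y r" "closest n (\<not> d) y s" "y < length w" "y' < length w'"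
    "\<forall>q\<in>rankers A K (2 * n). ranker A K w q \<noteq> Some y"
    "ltype A (local_depth n) w (Some y) = ltype A (local_depth n) w' (Some y')"
    "\<And>l'. ranker A K w' r = Some l' \<Longrightarrow> ltd d l' y'"
    "\<And>l'. ranker A K w' s = Some l' \<Longrightarrow> ltd d y' l'"
  shows "matched n y y'"
  unfolding matched_def
proof (intro conjI ballI allI impI)
  fix t q q' e assume t: "t \<in> rankers A K (2 * n)" "ranker A K w t = Some q" "ranker A K w' t = Some q'"
  have "q \<noteq> y" using assms(6) t(1,2) by auto
  then have "ltd d q y \<or> ltd (\<not> d) q y" using ltd_linear ltd_flip by blast
  moreover have "ltd d q y \<Longrightarrow> ltd d q' y'"
    using closest_transfer[OF assms(2,1,8) t] by blast
  moreover have "ltd (\<not> d) q y \<Longrightarrow> ltd (\<not> d) q' y'"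
    using closest_transfer[OF assms(3,1) _ t, of y'] assms(9) ltd_flip by blast
  ultimately show "ltd e y q = ltd e y' q'" by (auto simp: ltd_def split: if_splits)
qed (use assms in auto)

text \<open>The witness is the first position past \<open>r\<close> that has the type of
  \<open>y\<close>. It exists and does not lie past \<open>y\<close>, because \<open>y\<close>
  itself is a candidate.\<close>

lemma closest_step:
  assumes "closest n d y r" "n < D" "y < length w"
  shows "\<exists>s q q'. s \<in> rankers A K (Suc (2 * n)) \<and> ranker A K w s = Some q \<and> ranker A K w' s = Some q' \<and>
    \<not> ltd d y q \<and> ltype A K w (Some y) = ltype A K w' (Some q') \<and>
    (\<forall>l'. ranker A K w' r = Some l' \<longrightarrow> ltd d l' q')"
proof -
  let ?\<tau> = "ltype A K w (Some y)"
  define s where "s = r @ [(d, Inr ?\<tau>)]"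
  have r: "r \<in> rankers A K (2 * n)" using assms by (simp add: closest_def)
  have s: "s \<in> rankers A K (Suc (2 * n))"
    unfolding s_def by (rule rankers_snoc[OF r]) (simp add: ltype_in w)
  have D: "r \<in> rankers A K (2 * D)" "s \<in> rankers A K (2 * D)"
    by (rule rankers_mono[OF r] rankers_mono[OF s], use assms in simp)+
  have after: "after d (ranker A K w r) y"
    using assms(1) by (cases "ranker A K w r") (auto simp: closest_def)
  have "ranker A K w s \<noteq> None"
    unfolding s_def ranker_snoc step_None using assms(3) after by auto
  then obtain q where q: "ranker A K w s = Some q" by blast
  then obtain q' where q': "ranker A K w' s = Some q'" using None_iff[OF D(2)] by auto
  have "\<not> ltd d y q"
    using q assms(3) after unfolding s_def ranker_snoc step_Some by auto
  moreover have "ltype A K w' (Some q') = ?\<tau>"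
    using q' unfolding s_def ranker_snoc step_Some by simp
  moreover have "ltd d l' q'" if "ranker A K w' r = Some l'" for l'
    using q' that unfolding s_def ranker_snoc step_Some by simp
  ultimately show ?thesis using s q q' by auto
qed

lemma between_mono: "between w d c x y \<Longrightarrow> \<not> ltd d z y \<Longrightarrow> between w d c x z"
  unfolding between_def using ltd_trans_le by blast

lemma between_mono': "between w' d c x y \<Longrightarrow> \<not> ltd d z y \<Longrightarrow> between w' d c x z"
  unfolding between_def using ltd_trans_le by blast

lemma move:
  assumes m: "matched (Suc n) x x'" "n < D" and y: "ltd d x y" "y < length w"
  shows "\<exists>y'. matched n y y' \<and> same_side d x y x' y'"
proof (cases "\<exists>r\<in>rankers A K (2 * n). ranker A K w r = Some y")
  case True
  then obtain r where r: "r \<in> rankers A K (2 * n)" "ranker A K w r = Some y" by blast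
  have rD: "r \<in> rankers A K (2 * D)" by (rule rankers_mono[OF r(1)]) (use m in simp)
  obtain y' where y': "ranker A K w' r = Some y'" using None_iff[OF rD] r by auto
  have r1: "r \<in> rankers A K (Suc (2 * n))" by (rule rankers_mono[OF r(1)]) simp
  have "same_side d x y x' y'" by (rule matched_same_side[OF m(1) _ r1 r(2) y']) (use m in simp)
  moreover have "matched n y y'" unfolding matched_def
  proof (intro conjI ballI allI impI)
    show "y' < length w'" using ranker_less[OF y'] .
    show "ltype A (local_depth n) w (Some y) = ltype A (local_depth n) w' (Some y')"
      by (rule ltype_mono[OF types[OF rD r(2) y']]) (use m(2) K local_depth_mono in simp)
    fix s q q' e assume s: "s \<in> rankers A K (2 * n)" "ranker A K w s = Some q" "ranker A K w' s = Some q'"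
    have sD: "s \<in> rankers A K (2 * D)" by (rule rankers_mono[OF s(1)]) (use m in simp)
    show "ltd e y q = ltd e y' q'" by (rule ltd_iff[OF rD sD r(2) s(2) y' s(3)])
  qed (rule y(2))
  ultimately show ?thesis by blast
next
  case False
  then have noranker: "\<forall>q\<in>rankers A K (2 * n). ranker A K w q \<noteq> Some y" by blast
  obtain r where r: "closest n d y r" using closest_exists by blast
  obtain s where s: "closest n (\<not> d) y s" using closest_exists by blast
  have nD: "n \<le> D" using m by simp
  have depth: "local_depth n \<le> K" using K local_depth_mono nD by simp
  obtain r1 q1 q1' where r1: "r1 \<in> rankers A K (Suc (2 * n))" "ranker A K w r1 = Some q1"
    "ranker A K w' r1 = Some q1'" "\<not> ltd d y q1" "ltype A K w (Some y) = ltype A K w' (Some q1')"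
    "\<And>l'. ranker A K w' r = Some l' \<Longrightarrow> ltd d l' q1'"
    using closest_step[OF r m(2) y(2)] by blast
  obtain s1 q2 q2' where s1: "s1 \<in> rankers A K (Suc (2 * n))" "ranker A K w s1 = Some q2"
    "ranker A K w' s1 = Some q2'" "\<not> ltd d q2 y" "ltype A K w (Some y) = ltype A K w' (Some q2')"
    "\<And>l'. ranker A K w' s = Some l' \<Longrightarrow> ltd d q2' l'"
    using closest_step[OF s m(2) y(2)] unfolding ltd_flip by blast
  have toD: "t \<in> rankers A K (2 * D)" if "t \<in> rankers A K (2 * n) \<or> t \<in> rankers A K (Suc (2 * n))" for t
    using that rankers_mono[of t A K "2 * n" "2 * D"] rankers_mono[of t A K "Suc (2 * n)" "2 * D"] m(2) by auto
  have rsD: "r \<in> rankers A K (2 * D)" "s \<in> rankers A K (2 * D)"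
    "r1 \<in> rankers A K (2 * D)" "s1 \<in> rankers A K (2 * D)"
    using r s r1 s1 toD unfolding closest_def by blast+
  have side1: "same_side d x q1 x' q1'" by (rule matched_same_side[OF m(1) _ r1(1-3)]) (use m in simp)
  have side2: "same_side d x q2 x' q2'" by (rule matched_same_side[OF m(1) _ s1(1-3)]) (use m in simp)
  note matchedI' = matchedI[OF nD r s y(2) _ noranker]
  have q1_s: "ltd d q1' u'" if u': "ranker A K w' s = Some u'" for u'
  proof -
    obtain u where u: "ranker A K w s = Some u" using None_iff[OF rsD(2)] u' by auto
    then have "ltd d y u" using s by (simp add: closest_def ltd_flip)
    then have "ltd d q1 u" by (rule ltd_le_trans[OF r1(4)])
    then show ?thesis using ltd_iff[OF rsD(3,2) r1(2) u r1(3) u'] by simp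
  qed
  have q2_r: "ltd d u' q2'" if u': "ranker A K w' r = Some u'" for u'
  proof -
    obtain u where u: "ranker A K w r = Some u" using None_iff[OF rsD(1)] u' by auto
    then have "ltd d u y" using r by (simp add: closest_def)
    then have "ltd d u q2" using s1(4) by (rule ltd_trans_le)
    then show ?thesis using ltd_iff[OF rsD(1,4) u s1(2) u' s1(3)] by simp
  qed
  have xq2: "ltd d x q2" using y(1) s1(4) by (rule ltd_trans_le)
  show ?thesis
  proof (cases "ltd d x q1 \<and> (\<forall>c\<in>A. between w d c x q1 = between w d c x y)")
    case True
    have "matched n y q1'"
      by (rule matchedI'[OF ranker_less[OF r1(3)] ltype_mono[OF r1(5) depth] r1(6) q1_s])
    moreover have "same_side d x y x' q1'" using True side1 y(1) unfolding same_side_def by metis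
    ultimately show ?thesis by blast
  next
    case not1: False
    show ?thesis
    proof (cases "\<forall>c\<in>A. between w d c x q2 = between w d c x y")
      case True
      have "matched n y q2'"
        by (rule matchedI'[OF ranker_less[OF s1(3)] ltype_mono[OF s1(5) depth] q2_r s1(6)])
      moreover have "same_side d x y x' q2'" using True xq2 side2 y(1) unfolding same_side_def by metis
      ultimately show ?thesis by blast
    next
      case not2: False
      \<comment> \<open>Some letter occurs between \<open>x\<close> and \<open>q2\<close> but not
        between \<open>x\<close> and \<open>y\<close>. In a two-letter alphabet only one letter can
        then occur between \<open>x\<close> and \<open>y\<close>, so a local move applies.\<close>
      have "\<exists>b\<in>A. \<not> between w d b x y" using not2 between_mono[OF _ s1(4)] by blast
      then obtain b where b: "b \<in> A" "\<not> between w d b x y" by blast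
      obtain a where a: "A = {a, b}" "a \<noteq> b" using card_A b(1) by (auto simp: card_2_iff)
      have "x < length w" "x' < length w'" using m(1) by (auto simp: matched_def)
      moreover have "ltype A (2 * local_depth n + 3) w (Some x) = ltype A (2 * local_depth n + 3) w' (Some x')"
        using m(1) unfolding matched_def local_depth.simps by blast
      ultimately have "\<exists>y'<length w'. ltd d x' y' \<and>
          ltype A (local_depth n) w (Some y) = ltype A (local_depth n) w' (Some y') \<and>
          (\<forall>c\<in>A. between w d c x y = between w' d c x' y')"
        by (rule local_move[OF a(2,1) w _ _ _ y b(2)])
      then obtain y' where y': "y' < length w'" "ltd d x' y'"
        "ltype A (local_depth n) w (Some y) = ltype A (local_depth n) w' (Some y')"
        "\<And>c. c \<in> A \<Longrightarrow> between w d c x y = between w' d c x' y'" by blast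
      \<comment> \<open>If \<open>y'\<close> did not lie past \<open>q1'\<close>, monotonicity would
        give a closed chain of implications: from \<open>x\<close>, \<open>q1\<close> to
        \<open>x\<close>, \<open>y\<close>, hence to \<open>x'\<close>, \<open>y'\<close>, then to
        \<open>x'\<close>, \<open>q1'\<close> and back to \<open>x\<close>, \<open>q1\<close>. Then
        \<open>q1\<close> would have had the right relation to \<open>x\<close>. The argument for
        \<open>q2\<close> is alike.\<close>
      have q1y: "ltd d q1' y'"
      proof (rule ccontr)
        assume *: "\<not> ltd d q1' y'"
        have "ltd d x' q1'" by (rule ltd_trans_le[OF y'(2) *])
        then have x1: "ltd d x q1" using side1 by (simp add: same_side_def)
        have "between w d c x q1 = between w d c x y" if c: "c \<in> A" for c
          using between_mono[OF _ r1(4), of c x] between_mono'[OF _ *, of c x'] y'(4)[OF c] side1 c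
          unfolding same_side_def by blast
        then show False using not1 x1 by blast
      qed
      have q2y: "ltd d y' q2'"
      proof (rule ccontr)
        assume *: "\<not> ltd d y' q2'"
        have "between w d c x q2 = between w d c x y" if c: "c \<in> A" for c
          using between_mono[OF _ s1(4), of c x] between_mono'[OF _ *, of c x'] y'(4)[OF c] side2 c
          unfolding same_side_def by blast
        then show False using not2 by blast
      qed
      have "matched n y y'"
        by (rule matchedI'[OF y'(1,3) ltd_trans[OF r1(6) q1y] ltd_trans[OF q2y s1(6)]])
      moreover have "same_side d x y x' y'" using y'(2,4) y(1) unfolding same_side_def by blast
      ultimately show ?thesis by blast
    qed
  qed
qed

end

section \<open>Symmetry, and the game for two-variable formulas\<close>

lemma word_pair_sym:
  assumes "word_pair A w w' K D" shows "word_pair A w' w K D"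
proof -
  interpret word_pair A w w' K D by fact
  show ?thesis
  proof
    fix r r' d assume "r \<in> rankers A K (2 * D)" "r' \<in> rankers A K (2 * D)"
    from order[OF this, of d]
    show "same_order d (ranker A K w' r) (ranker A K w' r') (ranker A K w r) (ranker A K w r')"
      unfolding same_order_def by blast
  next
    fix r i i' assume "r \<in> rankers A K (2 * D)" "ranker A K w' r = Some i" "ranker A K w r = Some i'"
    then show "ltype A K w' (Some i) = ltype A K w (Some i')" using types by metis
  qed (fact card_A w K)+
qed

context word_pair begin

lemma matched_sym: "word_pair.matched A w' w K n x' x \<longleftrightarrow> matched n x x'"
  unfolding matched_def word_pair.matched_def[OF word_pair_sym[OF word_pair_axioms]]
    eq_commute[of "ltype A (local_depth n) w' (Some x')"] by blast

lemma same_side_sym: "word_pair.same_side A w' w d x' y' x y \<longleftrightarrow> same_side d x y x' y'"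
  unfolding same_side_def word_pair.same_side_def[OF word_pair_sym[OF word_pair_axioms]] by blast

lemma same_side_flip: "same_side (\<not> d) y x y' x' = same_side d x y x' y'"
  unfolding same_side_def between_def ltd_flip by (simp add: conj.commute conj.left_commute)

lemma same_side_both:
  assumes "same_side d x y x' y'" "ltd d x y"
  shows "same_side e x y x' y'"
proof (cases "e = d")
  case False
  then have e: "e = (\<not> d)" by simp
  have "\<not> ltd e x y" "\<not> ltd e x' y'"
    using assms unfolding e ltd_flip same_side_def by (auto dest: ltd_asym)
  moreover have "\<not> between u e c i j" if "\<not> ltd e i j" for u :: "'a list" and c i j
    using that ltd_trans unfolding between_def by meson
  ultimately show ?thesis by (simp add: same_side_def)
qed (use assms in simp)

lemma same_side_refl: "same_side d x x x' x'"
  unfolding same_side_def between_def by (auto simp: ltd_def split: if_splits)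

lemma move_any:
  assumes "matched (Suc n) x x'" "n < D" "y < length w"
  shows "\<exists>y'. matched n y y' \<and> (\<forall>d. same_side d x y x' y')"
proof (cases "x = y")
  case True
  then show ?thesis using assms matched_mono[OF assms(1), of n] same_side_refl by auto
next
  case False
  then obtain d where d: "ltd d x y" by (metis ltd_flip ltd_linear)
  then show ?thesis using move[OF assms(1,2) d assms(3)] same_side_both[OF _ d] by blast
qed

end

fun qdepth :: "'a fo2 \<Rightarrow> nat" where
  "qdepth (GNeg \<phi>) = qdepth \<phi>"
| "qdepth (GAnd \<phi> \<psi>) = max (qdepth \<phi>) (qdepth \<psi>)"
| "qdepth (GOr \<phi> \<psi>) = max (qdepth \<phi>) (qdepth \<psi>)"
| "qdepth (GEx x \<phi>) = Suc (qdepth \<phi>)"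
| "qdepth (GAll x \<phi>) = Suc (qdepth \<phi>)"
| "qdepth _ = 0"

context word_pair begin

definition similar :: "nat \<Rightarrow> (bool \<Rightarrow> nat) \<Rightarrow> (bool \<Rightarrow> nat) \<Rightarrow> bool" where
  "similar n v v' \<longleftrightarrow> (\<forall>z. matched n (v z) (v' z)) \<and>
    (\<forall>x y d. same_side d (v x) (v y) (v' x) (v' y))"

text \<open>The variable that is not moved is the \<open>x\<close> of \<open>move_any\<close>; with
  two variables there is no further pebble whose relation to the new position would have to be
  preserved.\<close>

lemma similar_move:
  assumes "similar (Suc n) v v'" "n < D" "i < length w"
  shows "\<exists>i'<length w'. similar n (v(z := i)) (v'(z := i'))"
proof -
  have m: "matched (Suc n) (v (\<not> z)) (v' (\<not> z))" using assms(1) by (simp add: similar_def)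
  obtain i' where i': "matched n i i'" "\<And>d. same_side d (v (\<not> z)) i (v' (\<not> z)) i'"
    using move_any[OF m assms(2,3)] by blast
  have flip: "same_side d i (v (\<not> z)) i' (v' (\<not> z))" for d
    using i'(2)[of "\<not> d"] same_side_flip by blast
  have "same_side d ((v(z := i)) x) ((v(z := i)) y) ((v'(z := i')) x) ((v'(z := i')) y)" for x y d
  proof -
    consider "x = z" "y = z" | "x = z" "y = (\<not> z)" | "x = (\<not> z)" "y = z" | "x = (\<not> z)" "y = (\<not> z)"
      by (cases x; cases y; cases z) auto
    then show ?thesis by cases (simp_all add: i'(2) flip same_side_refl)
  qed
  moreover have "matched n ((v(z := i)) u) ((v'(z := i')) u)" for u
  proof (cases "u = z")
    case False
    then have "u = (\<not> z)" by auto
    then show ?thesis using matched_mono[OF m, of n] by simp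
  qed (use i' in simp)
  moreover have "i' < length w'" using i'(1) by (simp add: matched_def)
  ultimately show ?thesis unfolding similar_def by blast
qed

lemma similar_sym: "word_pair.similar A w' w K n v' v \<longleftrightarrow> similar n v v'"
  unfolding similar_def word_pair.similar_def[OF word_pair_sym[OF word_pair_axioms]]
  by (simp add: matched_sym same_side_sym)

lemma similar_move':
  assumes "similar (Suc n) v v'" "n < D" "i' < length w'"
  shows "\<exists>i<length w. similar n (v(z := i)) (v'(z := i'))"
  using word_pair.similar_move[OF word_pair_sym[OF word_pair_axioms], of n v' v i' z] assms
  by (simp add: similar_sym)

lemma similar_sat:
  "similar n v v' \<Longrightarrow> qdepth \<phi> \<le> n \<Longrightarrow> n \<le> D \<Longrightarrow> fo2_sat w v \<phi> = fo2_sat w' v' \<phi>"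
proof (induction \<phi> arbitrary: n v v')
  case (GLt x y)
  then have "same_side True (v x) (v y) (v' x) (v' y)" by (simp add: similar_def)
  then show ?case by (simp add: same_side_def ltd_def)
next
  case (GEq x y)
  then have "same_side d (v x) (v y) (v' x) (v' y)" for d by (simp add: similar_def)
  from this[of True] this[of False] show ?case by (auto simp: same_side_def ltd_def)
next
  case (GLetter a x)
  then have "matched n (v x) (v' x)" by (simp add: similar_def)
  then show ?case using ltype_letter[of A "local_depth n" w "Some (v x)" w' "Some (v' x)"]
    by (simp add: matched_def)
next
  case (GBtw a x y)
  have *: "fo2_sat u \<mu> (GBtw a x y) \<longleftrightarrow> between u True a (\<mu> x) (\<mu> y)" for u \<mu>
    by (auto simp: between_def ltd_def)
  \<comment> \<open>The formula may mention letters outside \<open>A\<close>, on which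
    \<open>same_side\<close> is silent; they occur in neither word.\<close>
  have **: "\<not> between u d a i j" if "u \<in> lists A" "a \<notin> A" for u d i j
    using that in_listsD[of u A] by (auto simp: between_def)
  show ?case
  proof (cases "a \<in> A")
    case True
    then show ?thesis using GBtw(1) unfolding * by (simp add: similar_def same_side_def)
  next
    case False
    then show ?thesis unfolding * using ** w by blast
  qed
next
  case (GEx z \<phi>)
  then obtain k where k: "n = Suc k" "qdepth \<phi> \<le> k" by (cases n) auto
  have "fo2_sat w (v(z := i)) \<phi> = fo2_sat w' (v'(z := i')) \<phi>"
    if "similar k (v(z := i)) (v'(z := i'))" for i i'
    by (rule GEx.IH[OF that k(2)]) (use GEx.prems(3) k(1) in simp)
  then show ?case using similar_move[of k v v' _ z] similar_move'[of k v v' _ z] GEx.prems k(1)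
    by (simp only: fo2_sat.simps) (metis Suc_le_lessD)
next
  case (GAll z \<phi>)
  then obtain k where k: "n = Suc k" "qdepth \<phi> \<le> k" by (cases n) auto
  have "fo2_sat w (v(z := i)) \<phi> = fo2_sat w' (v'(z := i')) \<phi>"
    if "similar k (v(z := i)) (v'(z := i'))" for i i'
    by (rule GAll.IH[OF that k(2)]) (use GAll.prems(3) k(1) in simp)
  then show ?case using similar_move[of k v v' _ z] similar_move'[of k v v' _ z] GAll.prems k(1)
    by (simp only: fo2_sat.simps) (metis Suc_le_lessD)
next
  case (GAnd \<phi> \<psi>)
  then show ?case by (metis fo2_sat.simps(7) max.bounded_iff qdepth.simps(2))
next
  case (GOr \<phi> \<psi>)
  then show ?case by (metis fo2_sat.simps(8) max.bounded_iff qdepth.simps(3))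
next
  case (GNeg \<phi>)
  then show ?case by (metis fo2_sat.simps(6) qdepth.simps(1))
qed simp

text \<open>Both variables start at position 0, which is the value of a ranker with one step. For
  this ranker to be available \<open>D\<close> must be positive, hence the \<open>Suc\<close> where
  \<open>D\<close> is chosen for the upper bound.\<close>

lemma similar_initial:
  assumes "w \<noteq> []" "w' \<noteq> []" "0 < D"
  shows "similar D (\<lambda>_. 0) (\<lambda>_. 0)"
proof -
  define r :: "(bool \<times> 'a label) list" where "r = [(True, Inl None)]"
  have r: "r \<in> rankers A K (2 * D)" using assms(3) by (simp add: r_def rankers_def)
  have 0: "ranker A K u r = Some 0" if "u \<noteq> []" for u
  proof -
    have "ranker A K u ([] @ [(True, Inl None)]) = Some 0"
      unfolding ranker_snoc ranker_Nil step_Some using that by (auto simp: has_letter_None ltd_def)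
    then show ?thesis by (simp add: r_def)
  qed
  note w0 = 0[OF assms(1)] 0[OF assms(2)]
  have "matched D 0 0" unfolding matched_def
  proof (intro conjI ballI allI impI)
    show "ltype A (local_depth D) w (Some 0) = ltype A (local_depth D) w' (Some 0)"
      using types[OF r w0] K by simp
    fix s q q' d assume "s \<in> rankers A K (2 * D)" "ranker A K w s = Some q" "ranker A K w' s = Some q'"
    then show "ltd d 0 q = ltd d 0 q'" by (rule ltd_iff[OF r _ w0(1) _ w0(2)])
  next
    show "0 < length w" "0 < length w'" using assms(1,2) by simp_all
  qed
  then show ?thesis unfolding similar_def using same_side_refl by blast
qed

lemma same_sat:
  assumes "w \<noteq> []" "w' \<noteq> []" "0 < D" "qdepth \<phi> \<le> D"
  shows "fo2_sat w (\<lambda>_. 0) \<phi> = fo2_sat w' (\<lambda>_. 0) \<phi>"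
  by (rule similar_sat[OF similar_initial[OF assms(1-3)] assms(4) order_refl])

end

section \<open>Definability of rankers\<close>

text \<open>Agreement is demanded only if the variables in \<open>X\<close> denote positions of the
  word. Side conditions such as \<open>v x < length w\<close> are then free.\<close>

definition definable :: "bool \<Rightarrow> nat \<Rightarrow> nat set \<Rightarrow> ('a list \<Rightarrow> (nat \<Rightarrow> nat) \<Rightarrow> bool) \<Rightarrow> bool" where
  "definable b k X P \<longleftrightarrow> (\<exists>\<phi>. level b k \<phi> \<and> fo_fv \<phi> \<subseteq> X \<and>
     (\<forall>w v. (\<forall>x\<in>X. v x < length w) \<longrightarrow> fo_sat w v \<phi> = P w v))"

lemma definableI:
  "level b k \<phi> \<Longrightarrow> fo_fv \<phi> \<subseteq> X \<Longrightarrow>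
    (\<And>w v. (\<And>x. x \<in> X \<Longrightarrow> v x < length w) \<Longrightarrow> fo_sat w v \<phi> = P w v) \<Longrightarrow> definable b k X P"
  unfolding definable_def by blast

lemma definableE:
  assumes "definable b k X P"
  obtains \<phi> where "level b k \<phi>" "fo_fv \<phi> \<subseteq> X"
    "\<And>w v. (\<And>x. x \<in> X \<Longrightarrow> v x < length w) \<Longrightarrow> fo_sat w v \<phi> = P w v"
  using assms unfolding definable_def by blast

lemma definable_cong:
  assumes "definable b k X P" "\<And>w v. (\<And>x. x \<in> X \<Longrightarrow> v x < length w) \<Longrightarrow> P w v = Q w v"
  shows "definable b k X Q"
  using assms unfolding definable_def by (metis (no_types, lifting))

lemma definable_up: "definable b k X P \<Longrightarrow> definable b' (Suc k) X P"
  unfolding definable_def using level.up by blast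

lemma definable_weaken: "definable b k X P \<Longrightarrow> X \<subseteq> Y \<Longrightarrow> definable b k Y P"
  unfolding definable_def by (meson order_trans subset_iff)

lemma definable_not: assumes "definable (\<not> b) k X P" shows "definable b k X (\<lambda>w v. \<not> P w v)"
proof -
  obtain \<phi> where "level (\<not> b) k \<phi>" "fo_fv \<phi> \<subseteq> X"
    "\<forall>w v. (\<forall>x\<in>X. v x < length w) \<longrightarrow> fo_sat w v \<phi> = P w v" using assms unfolding definable_def by blast
  then show ?thesis unfolding definable_def by (intro exI[of _ "FNeg \<phi>"]) (simp add: level.neg)
qed

lemma definable_and:
  assumes "definable b k X P" "definable b k X Q" shows "definable b k X (\<lambda>w v. P w v \<and> Q w v)"
proof -
  obtain \<phi> \<psi> where "level b k \<phi>" "level b k \<psi>" "fo_fv \<phi> \<subseteq> X" "fo_fv \<psi> \<subseteq> X"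
    "\<forall>w v. (\<forall>x\<in>X. v x < length w) \<longrightarrow> fo_sat w v \<phi> = P w v"
    "\<forall>w v. (\<forall>x\<in>X. v x < length w) \<longrightarrow> fo_sat w v \<psi> = Q w v"
    using assms unfolding definable_def by blast
  then show ?thesis unfolding definable_def by (intro exI[of _ "FAnd \<phi> \<psi>"]) (simp add: level.conj)
qed

lemma definable_or:
  assumes "definable b k X P" "definable b k X Q" shows "definable b k X (\<lambda>w v. P w v \<or> Q w v)"
proof -
  obtain \<phi> \<psi> where "level b k \<phi>" "level b k \<psi>" "fo_fv \<phi> \<subseteq> X" "fo_fv \<psi> \<subseteq> X"
    "\<forall>w v. (\<forall>x\<in>X. v x < length w) \<longrightarrow> fo_sat w v \<phi> = P w v"
    "\<forall>w v. (\<forall>x\<in>X. v x < length w) \<longrightarrow> fo_sat w v \<psi> = Q w v"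
    using assms unfolding definable_def by blast
  then show ?thesis unfolding definable_def by (intro exI[of _ "FOr \<phi> \<psi>"]) (simp add: level.disj)
qed

lemma definable_const: "definable b k X (\<lambda>w v. c)"
  by (rule definableI[of _ _ "if c then FTrue else FNeg FTrue"]) (auto intro: level.qf)

lemma definable_ltd: "x \<in> X \<Longrightarrow> y \<in> X \<Longrightarrow> definable b k X (\<lambda>w v. ltd d (v x) (v y))"
  by (rule definableI[of _ _ "if d then FLt x y else FLt y x"]) (auto intro: level.qf simp: ltd_def)

lemma definable_eq: "x \<in> X \<Longrightarrow> y \<in> X \<Longrightarrow> definable b k X (\<lambda>w v. v x = v y)"
  by (rule definableI[of _ _ "FEq x y"]) (auto intro: level.qf)

lemma definable_letter: "x \<in> X \<Longrightarrow> definable b k X (\<lambda>w v. w ! v x = c)"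
  by (rule definableI[of _ _ "FLetter c x"]) (auto intro: level.qf)

lemma definable_ex:
  fixes P :: "'a list \<Rightarrow> _"
  assumes "definable True (Suc k) (insert y X) P"
  shows "definable True (Suc k) X (\<lambda>w v. \<exists>i<length w. P w (v(y := i)))"
  using assms
proof (rule definableE)
  fix \<phi> :: "'a fo" assume \<phi>: "level True (Suc k) \<phi>" "fo_fv \<phi> \<subseteq> insert y X"
    "\<And>w v. (\<And>x. x \<in> insert y X \<Longrightarrow> v x < length w) \<Longrightarrow> fo_sat w v \<phi> = P w v"
  show ?thesis
  proof (rule definableI)
    show "level True (Suc k) (FEx y \<phi>)" using \<phi>(1) by (rule level.ex)
    show "fo_fv (FEx y \<phi>) \<subseteq> X" using \<phi>(2) by auto
    fix w :: "'a list" and v assume "\<And>x. x \<in> X \<Longrightarrow> v x < length w"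
    then have "fo_sat w (v(y := i)) \<phi> = P w (v(y := i))" if "i < length w" for i
      using that by (intro \<phi>(3)) auto
    then show "fo_sat w v (FEx y \<phi>) = (\<exists>i<length w. P w (v(y := i)))" by auto
  qed
qed

lemma definable_all:
  assumes "definable False (Suc k) (insert y X) P"
  shows "definable False (Suc k) X (\<lambda>w v. \<forall>i<length w. P w (v(y := i)))"
proof -
  have "definable True (Suc k) (insert y X) (\<lambda>w v. \<not> P w v)"
    by (rule definable_not) (simp add: assms)
  from definable_not[of False, simplified, OF definable_ex[OF this]] show ?thesis
    by (rule definable_cong) blast
qed

lemma definable_ball:
  "finite S \<Longrightarrow> (\<And>a. a \<in> S \<Longrightarrow> definable b k X (P a)) \<Longrightarrow> definable b k X (\<lambda>w v. \<forall>a\<in>S. P a w v)"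
proof (induction S rule: finite_induct)
  case empty
  then show ?case using definable_const[of b k X True] by simp
next
  case (insert a S)
  then have "definable b k X (\<lambda>w v. P a w v \<and> (\<forall>a\<in>S. P a w v))" by (intro definable_and) auto
  then show ?case by simp
qed

lemma definable_after:
  assumes "set_option s \<subseteq> X" "y \<in> X"
  shows "definable b k X (\<lambda>w v. after d (map_option v s) (v y))"
  using assms definable_const[of b k X True] definable_ltd[of _ X y b k d] by (cases s) auto

lemma map_option_fresh: "y \<notin> set_option s \<Longrightarrow> map_option (v(y := i)) s = map_option v s"
  by (cases s) auto

lemma fresh_variable: "\<exists>u :: nat. u \<notin> set_option s \<and> u \<noteq> y"
  using ex_new_if_finite[of "set_option s \<union> {y}"] by (auto simp: infinite_UNIV_nat)

text \<open>That \<open>y\<close> is the first position with \<open>S\<close> says that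
  \<open>S\<close> holds at \<open>y\<close> and fails at all earlier candidates: a formula of level
  \<open>Suc k\<close> and the universal closure of a negated one. One more level contains
  both.\<close>

lemma definable_step:
  assumes S: "\<And>x. definable True (Suc k) {x} (\<lambda>w v. S w (v x))" and lt: "\<And>w i. S w i \<Longrightarrow> i < length w"
  shows "definable True (Suc (Suc k)) (insert y (set_option s))
      (\<lambda>w v. step (length w) d (S w) (map_option v s) = Some (v y))"
    and "definable True (Suc (Suc k)) (set_option s)
      (\<lambda>w v. step (length w) d (S w) (map_option v s) = None)"
proof -
  obtain u where u: "u \<notin> set_option s" "u \<noteq> y" using fresh_variable by blast
  have notS: "definable False (Suc k) X (\<lambda>w v. \<not> S w (v u))" if "u \<in> X" for X
    by (rule definable_not) (use that in \<open>simp add: definable_weaken[OF S[of u]]\<close>)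
  have "definable False (Suc k) (insert u (insert y (set_option s))) (\<lambda>w v. \<not> S w (v u) \<or>
      \<not> after d (map_option v s) (v u) \<or> \<not> ltd d (v u) (v y))"
    by (intro definable_or notS definable_not[of False, simplified] definable_after definable_ltd) auto
  from definable_all[OF this]
  have 1: "definable True (Suc (Suc k)) (insert y (set_option s)) (\<lambda>w v. \<forall>i<length w. \<not> S w i \<or>
      \<not> after d (map_option v s) i \<or> \<not> ltd d i (v y))"
    by (rule definable_up[OF definable_cong]) (use u in \<open>simp add: map_option_fresh\<close>)
  have 2: "definable True (Suc (Suc k)) (insert y (set_option s)) (\<lambda>w v. S w (v y))"
    by (rule definable_up[OF definable_weaken[OF S]]) simp
  have 3: "definable True (Suc (Suc k)) (insert y (set_option s)) (\<lambda>w v. after d (map_option v s) (v y))"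
    by (rule definable_after) auto
  from definable_and[OF 2 definable_and[OF 3 1]]
  show "definable True (Suc (Suc k)) (insert y (set_option s))
      (\<lambda>w v. step (length w) d (S w) (map_option v s) = Some (v y))"
    by (rule definable_cong) (auto simp: step_Some dest: lt)
  have "definable False (Suc k) (insert u (set_option s)) (\<lambda>w v. \<not> S w (v u) \<or>
      \<not> after d (map_option v s) (v u))"
    by (intro definable_or notS definable_not[of False, simplified] definable_after) auto
  from definable_all[OF this]
  have "definable True (Suc (Suc k)) (set_option s) (\<lambda>w v. \<forall>i<length w. \<not> S w i \<or>
      \<not> after d (map_option v s) i)"
    by (rule definable_up[OF definable_cong]) (use u in \<open>simp add: map_option_fresh\<close>)
  then show "definable True (Suc (Suc k)) (set_option s)
      (\<lambda>w v. step (length w) d (S w) (map_option v s) = None)"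
    by (rule definable_cong) (auto simp: step_None)
qed

lemma run_less:
  "(\<And>i. p = Some i \<Longrightarrow> i < n) \<Longrightarrow> run n S g p = Some j \<Longrightarrow> j < n"
proof (induction g arbitrary: p)
  case (Cons st g)
  obtain d \<pi> where "st = (d, \<pi>)" by (cases st)
  with Cons.prems(2) have "run n S g (step n d (S \<pi>) p) = Some j" by simp
  then show ?case by (rule Cons.IH[rotated]) (simp add: step_Some)
qed simp

text \<open>The level does not grow with the length of the walk, since intermediate positions are
  bound by existential quantifiers in front. An intermediate search may fail, and the walk then
  continues from \<open>None\<close>; this is a separate disjunct.\<close>

lemma definable_run:
  fixes S :: "'a list \<Rightarrow> 'p \<Rightarrow> nat \<Rightarrow> bool"
  assumes S: "\<And>\<pi> x. definable True (Suc k) {x} (\<lambda>w v. S w \<pi> (v x))"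
    and lt: "\<And>w \<pi> i. S w \<pi> i \<Longrightarrow> i < length w"
  shows "(\<forall>y. definable True (Suc (Suc k)) (insert y (set_option s))
        (\<lambda>w v. run (length w) (S w) g (map_option v s) = Some (v y))) \<and>
    definable True (Suc (Suc k)) (set_option s)
        (\<lambda>w v. run (length w) (S w) g (map_option v s) = None)"
proof (induction g rule: rev_induct)
  case Nil
  show ?case
  proof (cases s)
    case None
    then show ?thesis by (simp add: definable_const)
  next
    case (Some x)
    then show ?thesis by (simp add: definable_const definable_eq)
  qed
next
  case (snoc st g)
  obtain d \<pi> where st: "st = (d, \<pi>)" by (cases st)
  let ?R = "\<lambda>w v. run (length w) (S w) g (map_option v s)"
  note step = definable_step[where S = "\<lambda>w. S w \<pi>" and d = d, OF S lt]
  have less: "i < length w" if "\<And>x. x \<in> set_option s \<Longrightarrow> v x < length w" "?R w v = Some i" for w v i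
    using run_less[OF _ that(2)] that(1) by (cases s) auto
  have main: "definable True (Suc (Suc k)) Y (\<lambda>w v. step (length w) d (S w \<pi>) (?R w v) = c v)"
    if Y: "set_option s \<subseteq> Y" "z \<notin> Y" and z: "\<And>v i. c (v(z := i)) = c v"
      and some: "definable True (Suc (Suc k)) (insert z Y) (\<lambda>w v. step (length w) d (S w \<pi>) (Some (v z)) = c v)"
      and none: "definable True (Suc (Suc k)) Y (\<lambda>w v. step (length w) d (S w \<pi>) None = c v)"
    for Y z and c :: "(nat \<Rightarrow> nat) \<Rightarrow> nat option"
  proof -
    have zs: "z \<notin> set_option s" using Y by auto
    have "definable True (Suc (Suc k)) (insert z Y) (\<lambda>w v. ?R w v = Some (v z) \<and>
        step (length w) d (S w \<pi>) (Some (v z)) = c v)"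
      by (rule definable_and[OF definable_weaken some]) (use snoc Y in auto)
    from definable_ex[OF this]
    have "definable True (Suc (Suc k)) Y (\<lambda>w v. \<exists>i<length w. ?R w v = Some i \<and>
        step (length w) d (S w \<pi>) (Some i) = c v)"
      by (simp add: map_option_fresh[OF zs] z)
    moreover have "definable True (Suc (Suc k)) Y (\<lambda>w v. ?R w v = None \<and>
        step (length w) d (S w \<pi>) None = c v)"
      by (rule definable_and[OF definable_weaken none]) (use snoc Y in auto)
    ultimately have "definable True (Suc (Suc k)) Y (\<lambda>w v. (\<exists>i<length w. ?R w v = Some i \<and>
        step (length w) d (S w \<pi>) (Some i) = c v) \<or>
        (?R w v = None \<and> step (length w) d (S w \<pi>) None = c v))" by (rule definable_or)
    then show ?thesis
    proof (rule definable_cong)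
      fix w :: "'a list" and v :: "nat \<Rightarrow> nat" assume "\<And>x. x \<in> Y \<Longrightarrow> v x < length w"
      then have "\<And>x. x \<in> set_option s \<Longrightarrow> v x < length w" using Y by auto
      from less[OF this] show "((\<exists>i<length w. ?R w v = Some i \<and> step (length w) d (S w \<pi>) (Some i) = c v) \<or>
        (?R w v = None \<and> step (length w) d (S w \<pi>) None = c v)) =
        (step (length w) d (S w \<pi>) (?R w v) = c v)"
        by (cases "?R w v") auto
    qed
  qed
  have "definable True (Suc (Suc k)) (insert y (set_option s))
    (\<lambda>w v. step (length w) d (S w \<pi>) (?R w v) = Some (v y))" for y
  proof -
    obtain z where z: "z \<notin> set_option s" "z \<noteq> y" using fresh_variable by blast
    show ?thesis
    proof (rule main[where z = z])
      show "definable True (Suc (Suc k)) (insert z (insert y (set_option s)))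
          (\<lambda>w v. step (length w) d (S w \<pi>) (Some (v z)) = Some (v y))"
        using definable_weaken[OF step(1)[where y = y and s = "Some z"]] by auto
      show "definable True (Suc (Suc k)) (insert y (set_option s))
          (\<lambda>w v. step (length w) d (S w \<pi>) None = Some (v y))"
        using definable_weaken[OF step(1)[where y = y and s = None]] by auto
    qed (use z in auto)
  qed
  moreover have "definable True (Suc (Suc k)) (set_option s)
    (\<lambda>w v. step (length w) d (S w \<pi>) (?R w v) = None)"
  proof -
    obtain z where z: "z \<notin> set_option s" "z \<noteq> 0" using fresh_variable by blast
    show ?thesis
    proof (rule main[where z = z])
      show "definable True (Suc (Suc k)) (insert z (set_option s))
          (\<lambda>w v. step (length w) d (S w \<pi>) (Some (v z)) = None)"
        using definable_weaken[OF step(2)[where s = "Some z"]] by auto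
      show "definable True (Suc (Suc k)) (set_option s)
          (\<lambda>w v. step (length w) d (S w \<pi>) None = None)"
        using definable_weaken[OF step(2)[where s = None]] by auto
    qed (use z in auto)
  qed
  ultimately show ?case by (simp add: run_append st)
qed

lemma definable_has_letter: "definable b k {x} (\<lambda>w v. has_letter w c (v x))"
proof (cases c)
  case None
  show ?thesis by (rule definable_cong[OF definable_const[of _ _ _ True]]) (simp add: None has_letter_None)
next
  case (Some a)
  show ?thesis
    by (rule definable_cong[OF definable_letter[of x _ _ _ a]]) (simp_all add: Some has_letter_Some)
qed

lemma restricted_eq_iff:
  "(\<lambda>g. if g \<in> G then f g else c) = t \<longleftrightarrow> (\<forall>g\<in>G. f g = t g) \<and> (\<forall>g. g \<notin> G \<longrightarrow> t g = c)"
  by (auto simp: fun_eq_iff)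

text \<open>Letter tests are quantifier-free, so each walk is definable in
  \<open>\<Sigma>\<^sub>2\<close>. A type prescribes the outcome of every short walk, failure
  included, and is therefore a finite conjunction of such formulas without negation.\<close>

lemma definable_ltype:
  fixes A :: "'a set"
  assumes "finite A"
  shows "definable True 2 {x} (\<lambda>w v. v x < length w \<and> ltype A K w (Some (v x)) = \<tau>)"
proof -
  let ?G = "{g. set g \<subseteq> steps A \<and> length g \<le> K}"
  let ?R = "\<lambda>(w :: 'a list) v g. run (length w) (has_letter w) g (Some (v x))"
  let ?R' = "\<lambda>w v g. letter w (?R w v g)"
  have eq: "ltype A K w (Some (v x)) = (\<lambda>g. if g \<in> ?G then ?R' w v g else None)" for w v
    by (auto simp: ltype_def fun_eq_iff)
  have run: "definable True 2 {y, x} (\<lambda>w v. ?R w v g = Some (v y))"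
    "definable True 2 {x} (\<lambda>w v. ?R w v g = None)" for g y
    using definable_run[of 0 has_letter "Some x" g, OF definable_has_letter]
    by (simp_all add: has_letter_def numeral_2_eq_2)
  have letter: "definable True 2 {x} (\<lambda>w v. letter w (?R w v g) = c)" for g c
  proof (cases c)
    case None
    show ?thesis
    proof (rule definable_cong[OF run(2)[where g = g]])
      fix w :: "'a list" and v assume "\<And>y. y \<in> {x} \<Longrightarrow> v y < length w"
      then show "(?R w v g = None) = (letter w (?R w v g) = c)"
        using run_less[of "Some (v x)" "length w" "has_letter w" g]
        by (cases "?R w v g") (auto simp: None)
    qed
  next
    case (Some a)
    have "definable True (Suc 1) {Suc x, x} (\<lambda>w v. ?R w v g = Some (v (Suc x)) \<and> w ! v (Suc x) = a)"
      using definable_and[OF run(1)[where g = g and y = "Suc x"] definable_letter[of "Suc x" "{Suc x, x}" True 2 a]]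
      by (simp add: numeral_2_eq_2)
    from definable_ex[OF this] show ?thesis
      unfolding Suc_1
    proof (rule definable_cong)
      fix w :: "'a list" and v assume "\<And>y. y \<in> {x} \<Longrightarrow> v y < length w"
      then show "(\<exists>i<length w. ?R w (v(Suc x := i)) g = Some ((v(Suc x := i)) (Suc x)) \<and>
          w ! (v(Suc x := i)) (Suc x) = a) = (letter w (?R w v g) = c)"
        using run_less[of "Some (v x)" "length w" "has_letter w" g]
        by (cases "?R w v g") (auto simp: Some)
    qed
  qed
  have "finite ?G" by (intro finite_lists_length_le finite_steps assms)
  then have "definable True 2 {x} (\<lambda>w v. (\<forall>g\<in>?G. letter w (?R w v g) = \<tau> g) \<and> (\<forall>g. g \<notin> ?G \<longrightarrow> \<tau> g = None))"
    by (intro definable_and definable_ball letter definable_const)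
  then show ?thesis
  proof (rule definable_cong)
    fix w :: "'a list" and v assume "\<And>y. y \<in> {x} \<Longrightarrow> v y < length w"
    then show "((\<forall>g\<in>?G. letter w (?R w v g) = \<tau> g) \<and> (\<forall>g. g \<notin> ?G \<longrightarrow> \<tau> g = None)) =
      (v x < length w \<and> ltype A K w (Some (v x)) = \<tau>)"
      using restricted_eq_iff[of ?G "?R' w v" None \<tau>] by (simp add: eq)
  qed
qed

lemma definable_label: "finite A \<Longrightarrow> definable True 2 {x} (\<lambda>w v. label_sat A K w l (v x))"
  by (cases l) (simp_all add: definable_has_letter definable_ltype)

lemma label_sat_less: "label_sat A K w l i \<Longrightarrow> i < length w"
  by (cases l) (auto simp: has_letter_def)

lemma definable_ranker:
  assumes "finite A"
  shows "definable True 3 {y} (\<lambda>w v. ranker A K w r = Some (v y))"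
    and "definable True 3 {} (\<lambda>w v. ranker A K w r = None)"
proof -
  note run = definable_run[of 1 "label_sat A K" None r, OF _ label_sat_less]
  have "definable True (Suc 1) {x} (\<lambda>w v. label_sat A K w l (v x))" for x l
    using definable_label[OF assms] by (simp add: numeral_2_eq_2)
  from run[OF this]
  show "definable True 3 {y} (\<lambda>w v. ranker A K w r = Some (v y))"
    "definable True 3 {} (\<lambda>w v. ranker A K w r = None)"
    by (simp_all add: ranker_def numeral_3_eq_3)
qed

section \<open>Boolean combinations and the upper bound\<close>

definition bool_sigma :: "nat \<Rightarrow> ('a list \<Rightarrow> bool) \<Rightarrow> bool" where
  "bool_sigma k P \<longleftrightarrow> (\<exists>\<psi>. bool_comb_sigma k \<psi> \<and> (\<forall>w. fo_sat w (\<lambda>_. 0) \<psi> = P w))"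

lemma bool_sigmaI: "bool_comb_sigma k \<psi> \<Longrightarrow> (\<And>w. fo_sat w (\<lambda>_. 0) \<psi> = P w) \<Longrightarrow> bool_sigma k P"
  unfolding bool_sigma_def by blast

lemma bool_sigmaE:
  assumes "bool_sigma k P"
  obtains \<psi> where "bool_comb_sigma k \<psi>" "\<And>w. fo_sat w (\<lambda>_. 0) \<psi> = P w"
  using assms unfolding bool_sigma_def by blast

lemma bool_sigma_definable:
  assumes "definable True (Suc k) {} (\<lambda>w v. P w)" shows "bool_sigma (Suc k) P"
proof -
  obtain \<phi> where \<phi>: "level True (Suc k) \<phi>" "fo_fv \<phi> \<subseteq> {}" "\<forall>w v. fo_sat w v \<phi> = P w"
    using assms unfolding definable_def by auto
  then have "fo_sentence \<phi>" by (simp add: fo_sentence_def)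
  from level_bool_comb[OF \<phi>(1) this] obtain \<psi> where
    "bool_comb_sigma (Suc k) \<psi>" "\<forall>w v. fo_sat w v \<psi> = fo_sat w v \<phi>" by blast
  then show ?thesis using \<phi>(3) by (intro bool_sigmaI[of _ \<psi>]) simp_all
qed

lemma bool_sigma_not: "bool_sigma k P \<Longrightarrow> bool_sigma k (\<lambda>w. \<not> P w)"
  by (erule bool_sigmaE, rule bool_sigmaI, erule bool_comb_sigma.neg) simp

lemma bool_sigma_and: "bool_sigma k P \<Longrightarrow> bool_sigma k Q \<Longrightarrow> bool_sigma k (\<lambda>w. P w \<and> Q w)"
  by (elim bool_sigmaE, rule bool_sigmaI, erule (1) bool_comb_sigma.conj) simp

lemma bool_sigma_or: "bool_sigma k P \<Longrightarrow> bool_sigma k Q \<Longrightarrow> bool_sigma k (\<lambda>w. P w \<or> Q w)"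
  by (elim bool_sigmaE, rule bool_sigmaI, erule (1) bool_comb_sigma.disj) simp

lemma bool_sigma_const: "bool_sigma (Suc k) (\<lambda>w. c)"
  by (rule bool_sigma_definable[OF definable_const])

lemma bool_sigma_ball:
  "finite S \<Longrightarrow> (\<And>a. a \<in> S \<Longrightarrow> bool_sigma (Suc k) (P a)) \<Longrightarrow> bool_sigma (Suc k) (\<lambda>w. \<forall>a\<in>S. P a w)"
proof (induction S rule: finite_induct)
  case (insert a S)
  then have "bool_sigma (Suc k) (\<lambda>w. P a w \<and> (\<forall>a\<in>S. P a w))" by (intro bool_sigma_and) auto
  then show ?case by simp
qed (simp add: bool_sigma_const)

lemma bool_sigma_bex:
  "finite S \<Longrightarrow> (\<And>a. a \<in> S \<Longrightarrow> bool_sigma (Suc k) (P a)) \<Longrightarrow> bool_sigma (Suc k) (\<lambda>w. \<exists>a\<in>S. P a w)"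
proof (induction S rule: finite_induct)
  case (insert a S)
  then have "bool_sigma (Suc k) (\<lambda>w. P a w \<or> (\<exists>a\<in>S. P a w))" by (intro bool_sigma_or) auto
  then show ?case by simp
qed (simp add: bool_sigma_const)

text \<open>Membership depends only on which predicates in \<open>\<Theta>\<close> hold. Hence
  \<open>L\<close> is described by the disjunction over the finitely many truth patterns that words
  of \<open>L\<close> realise.\<close>

lemma bool_sigma_determined:
  assumes "finite \<Theta>" "\<And>P. P \<in> \<Theta> \<Longrightarrow> bool_sigma (Suc k) P"
    and det: "\<And>w w'. w \<in> lists A \<Longrightarrow> w' \<in> lists A \<Longrightarrow> (\<And>P. P \<in> \<Theta> \<Longrightarrow> P w = P w') \<Longrightarrow> w \<in> L \<longleftrightarrow> w' \<in> L"
  shows "\<exists>Q. bool_sigma (Suc k) Q \<and> (\<forall>w\<in>lists A. w \<in> L \<longleftrightarrow> Q w)"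
proof -
  let ?K = "{S \<in> Pow \<Theta>. \<exists>u\<in>lists A \<inter> L. S = {P \<in> \<Theta>. P u}}"
  let ?Q = "\<lambda>w. \<exists>S\<in>?K. (\<forall>P\<in>S. P w) \<and> (\<forall>P\<in>\<Theta> - S. \<not> P w)"
  have "bool_sigma (Suc k) ?Q"
  proof (rule bool_sigma_bex)
    show "finite ?K" using assms(1) by simp
    fix S assume "S \<in> ?K"
    then have S: "S \<subseteq> \<Theta>" by blast
    show "bool_sigma (Suc k) (\<lambda>w. (\<forall>P\<in>S. P w) \<and> (\<forall>P\<in>\<Theta> - S. \<not> P w))"
    proof (rule bool_sigma_and[OF bool_sigma_ball bool_sigma_ball])
      show "finite S" using S assms(1) by (rule finite_subset)
      show "finite (\<Theta> - S)" using assms(1) by simp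
      show "bool_sigma (Suc k) P" if "P \<in> S" for P using assms(2) S that by blast
      show "bool_sigma (Suc k) (\<lambda>w. \<not> P w)" if "P \<in> \<Theta> - S" for P
        by (rule bool_sigma_not) (use assms(2) that in blast)
    qed
  qed
  moreover have "w \<in> L \<longleftrightarrow> ?Q w" if w: "w \<in> lists A" for w
  proof
    assume L: "w \<in> L"
    show "?Q w"
    proof
      show "{P \<in> \<Theta>. P w} \<in> ?K" using w L by blast
      show "(\<forall>P\<in>{P \<in> \<Theta>. P w}. P w) \<and> (\<forall>P\<in>\<Theta> - {P \<in> \<Theta>. P w}. \<not> P w)" by simp
    qed
  next
    assume "?Q w"
    then obtain S where S: "S \<in> ?K" "(\<forall>P\<in>S. P w) \<and> (\<forall>P\<in>\<Theta> - S. \<not> P w)" by (rule bexE)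
    from S(1) obtain u where u: "u \<in> lists A" "u \<in> L" "S = {P \<in> \<Theta>. P u}" by blast
    have "P u = P w" if "P \<in> \<Theta>" for P 
    proof (cases "P u")
      case True
      then have "P \<in> S" using that u(3) by simp
      from bspec[OF conjunct1[OF S(2)] this] True show ?thesis by simp
    next
      case False
      then have "P \<in> \<Theta> - S" using that u(3) by simp
      from bspec[OF conjunct2[OF S(2)] this] False show ?thesis by simp
    qed
    from det[OF u(1) w this] u(2) show "w \<in> L" by simp
  qed
  ultimately show ?thesis by (intro exI[of _ ?Q] conjI ballI)
qed

lemma alt_depth_two_letters:
  assumes A: "card A = 2" and "fo2inv_definable A L"
  shows "alt_depth A L \<le> 3"
proof -
  obtain \<phi> where \<phi>: "\<And>w. w \<in> lists A \<Longrightarrow> w \<in> L \<longleftrightarrow> fo2_sat w (\<lambda>_. 0) \<phi>"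
    using assms(2) by (auto simp: fo2inv_definable_def)
  have fin: "finite A" using A card.infinite by fastforce
  define D where "D = Suc (qdepth \<phi>)"
  define K where "K = local_depth D"
  define R where "R = rankers A K (2 * D)"
  define \<Theta>1 where "\<Theta>1 = (\<lambda>(d, r, r') w. \<exists>i<length w. \<exists>j<length w.
    ranker A K w r = Some i \<and> ranker A K w r' = Some j \<and> ltd d i j) ` (UNIV \<times> R \<times> R)"
  define \<Theta>2 where "\<Theta>2 = (\<lambda>r w. ranker A K w r = None) ` R"
  define \<Theta>3 where "\<Theta>3 = (\<lambda>(r, \<tau>) w. \<exists>i<length w.
    ranker A K w r = Some i \<and> i < length w \<and> ltype A K w (Some i) = \<tau>) ` (R \<times> ltypes A K)"
  \<comment> \<open>The empty word has no position for a pebble and is therefore told apart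
    explicitly; \<open>same_sat\<close> is about nonempty words.\<close>
  let ?\<Theta> = "insert (\<lambda>w. w = []) (\<Theta>1 \<union> \<Theta>2 \<union> \<Theta>3)"
  have finR: "finite R" unfolding R_def by (rule finite_rankers[OF fin])
  have "\<exists>Q. bool_sigma (Suc 2) Q \<and> (\<forall>w\<in>lists A. w \<in> L \<longleftrightarrow> Q w)"
  proof (rule bool_sigma_determined)
    show "finite ?\<Theta>" using finR finite_ltypes[OF fin] by (simp add: \<Theta>1_def \<Theta>2_def \<Theta>3_def)
    fix P assume "P \<in> ?\<Theta>"
    then consider (e) "P = (\<lambda>w. w = [])" | (1) "P \<in> \<Theta>1" | (2) "P \<in> \<Theta>2" | (3) "P \<in> \<Theta>3" by blast
    then show "bool_sigma (Suc 2) P"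
    proof cases
      case e
      have "bool_sigma (Suc 2) (\<lambda>w :: 'a list. \<exists>i<length w. True)"
        by (rule bool_sigma_definable, rule definable_ex[of 2 0 "{}" "\<lambda>w v. True"]) (rule definable_const)
      moreover have "(\<exists>i<length w. True) \<longleftrightarrow> w \<noteq> []" for w :: "'a list" by auto
      ultimately show ?thesis using bool_sigma_not[of "Suc 2" "\<lambda>w :: 'a list. w \<noteq> []"] unfolding e by simp
    next
      case 1
      then obtain d r r' where P: "P = (\<lambda>w. \<exists>i<length w. \<exists>j<length w.
        ranker A K w r = Some i \<and> ranker A K w r' = Some j \<and> ltd d i j)" by (auto simp: \<Theta>1_def)
      have "definable True (Suc 2) {1, 0} (\<lambda>w v. ranker A K w r = Some (v 0) \<and>
          ranker A K w r' = Some (v 1) \<and> ltd d (v 0) (v 1))"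
        using definable_ranker(1)[OF fin]
        by (intro definable_and definable_ltd definable_weaken[of _ _ "{0}" _ "{1, 0}"]
            definable_weaken[of _ _ "{1}" _ "{1, 0}"]) (auto simp: numeral_3_eq_3 numeral_2_eq_2)
      from definable_ex[OF definable_ex[OF this]] show ?thesis
        unfolding P by (intro bool_sigma_definable) simp
    next
      case 2
      then obtain r where P: "P = (\<lambda>w. ranker A K w r = None)" by (auto simp: \<Theta>2_def)
      show ?thesis unfolding P using definable_ranker(2)[OF fin]
        by (intro bool_sigma_definable) (simp add: numeral_3_eq_3 numeral_2_eq_2)
    next
      case 3
      then obtain r \<tau> where P: "P = (\<lambda>w. \<exists>i<length w.
        ranker A K w r = Some i \<and> i < length w \<and> ltype A K w (Some i) = \<tau>)" by (auto simp: \<Theta>3_def)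
      have "definable True (Suc 2) {0} (\<lambda>w v. ranker A K w r = Some (v 0) \<and>
          v 0 < length w \<and> ltype A K w (Some (v 0)) = \<tau>)"
        using definable_and[OF definable_ranker(1)[OF fin, of 0 K r]
            definable_up[OF definable_ltype[OF fin, of 0 K \<tau>], folded numeral_3_eq_3[folded numeral_2_eq_2]]]
        by (simp add: numeral_3_eq_3 numeral_2_eq_2)
      from definable_ex[OF this] show ?thesis
        unfolding P by (intro bool_sigma_definable) simp
    qed
  next
    fix w w' assume w: "w \<in> lists A" "w' \<in> lists A" and eq: "\<And>P. P \<in> ?\<Theta> \<Longrightarrow> P w = P w'"
    have empty: "w = [] \<longleftrightarrow> w' = []" using eq[of "\<lambda>w. w = []"] by simp
    have none: "ranker A K w r = None \<longleftrightarrow> ranker A K w' r = None" if "r \<in> R" for r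
      using eq[of "\<lambda>w. ranker A K w r = None"] that by (auto simp: \<Theta>2_def)
    have order: "(\<exists>i<length w. \<exists>j<length w. ranker A K w r = Some i \<and> ranker A K w r' = Some j \<and> ltd d i j) =
      (\<exists>i<length w'. \<exists>j<length w'. ranker A K w' r = Some i \<and> ranker A K w' r' = Some j \<and> ltd d i j)"
      if "r \<in> R" "r' \<in> R" for r r' d
      by (rule eq[of "\<lambda>w. \<exists>i<length w. \<exists>j<length w. ranker A K w r = Some i \<and> ranker A K w r' = Some j \<and> ltd d i j"])
        (use that in \<open>auto simp: \<Theta>1_def image_iff\<close>)
    have types: "(\<exists>i<length w. ranker A K w r = Some i \<and> i < length w \<and> ltype A K w (Some i) = \<tau>) =
      (\<exists>i<length w'. ranker A K w' r = Some i \<and> i < length w' \<and> ltype A K w' (Some i) = \<tau>)"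
      if "r \<in> R" "\<tau> \<in> ltypes A K" for r \<tau>
      by (rule eq[of "\<lambda>w. \<exists>i<length w. ranker A K w r = Some i \<and> i < length w \<and> ltype A K w (Some i) = \<tau>"])
        (use that in \<open>auto simp: \<Theta>3_def image_iff\<close>)
    have "word_pair A w w' K D"
    proof
      fix r r' d assume r: "r \<in> rankers A K (2 * D)" "r' \<in> rankers A K (2 * D)"
      then show "same_order d (ranker A K w r) (ranker A K w r') (ranker A K w' r) (ranker A K w' r')"
        using none[of r] none[of r'] order[of r r' d] ranker_less[of A K w] ranker_less[of A K w']
        unfolding same_order_def R_def by auto
    next
      fix r i i' assume r: "r \<in> rankers A K (2 * D)" "ranker A K w r = Some i" "ranker A K w' r = Some i'"
      then show "ltype A K w (Some i) = ltype A K w' (Some i')"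
        using types[of r "ltype A K w (Some i)"] ltype_in[OF w(1)] ranker_less[OF r(2)]
        unfolding R_def by auto
    qed (use A w K_def in auto)
    then interpret word_pair A w w' K D .
    show "w \<in> L \<longleftrightarrow> w' \<in> L"
    proof (cases "w = []")
      case True
      then show ?thesis using empty by simp
    next
      case False
      then show ?thesis using same_sat[of \<phi>] \<phi> w empty by (simp add: D_def)
    qed
  qed
  then obtain Q where Q: "bool_sigma 3 Q" "\<forall>w\<in>lists A. w \<in> L \<longleftrightarrow> Q w" by (auto simp: numeral_3_eq_3 numeral_2_eq_2)
  then obtain \<psi> where "bool_comb_sigma 3 \<psi>" "fo_defines A \<psi> L"
    unfolding bool_sigma_def fo_defines_def using bool_comb_sentence by blast
  then show ?thesis unfolding alt_depth_def by (intro Least_le) blast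
qed

theorem theorem8:
  shows "(\<forall>d::nat. \<exists>(A::nat set) L. finite A \<and> L \<subseteq> lists A \<and>
            fo2inv_definable A L \<and> alt_depth A L > d)
       \<and> (\<forall>(A::'a set) L. card A = 2 \<longrightarrow> L \<subseteq> lists A \<longrightarrow>
            fo2inv_definable A L \<longrightarrow> alt_depth A L \<le> 3)"
proof (intro conjI allI impI)
  fix d :: nat
  show "\<exists>(A::nat set) L. finite A \<and> L \<subseteq> lists A \<and> fo2inv_definable A L \<and> alt_depth A L > d"
    by (rule alt_depth_unbounded)
next
  fix A :: "'a set" and L assume "card A = 2" "fo2inv_definable A L"
  then show "alt_depth A L \<le> 3" by (rule alt_depth_two_letters)
qed

end
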